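(* Let $\alpha\in(1,2]$ and let $\{X_n : n\ge 1\}$ be a sequence of i.i.d. positive random variables with $\mathbb{E}X_1=\mu$, in the domain of attraction of an $\alpha$-stable law $\mathcal{L}_\alpha$ whose characteristic function is $$\phi(u)=\exp(-u^2/2)\ \text{ if }\alpha=2,\qquad \phi(u)=\exp\bigl(-|u|^{\alpha}\bigl(1-i\,\mathrm{sgn}(u)\tan(\tfrac12\pi\alpha)\bigr)\bigr)\ \text{ if }1<\alpha<2.$$ Let $S_n=X_1+\cdots+X_n$ and let $(a_n)$ be a sequence of positive numbers such that $(S_n-\mu n)/a_n$ converges in distribution to $\mathcal{L}_\alpha$ as $n\to\infty$. For $0\le t\le 1$ define $$\pi_n(t):=\left(\prod_{k=1}^{[nt]}\frac{S_k}{\mu k}\right)^{\mu/a_n}.$$ Then for every $t\in[0,1]$ and every real $x$, $$\frac{1}{\log N}\sum_{n=1}^{N}\frac1n\,\mathbf{I}\bigl(\pi_n(t)\le x\bigr)\longrightarrow F_t(x)\quad\text{almost surely as } N\to\infty,$$ where $F_t$ is the distribution function of the random variable $\exp\left(\int_0^t \frac{\mathcal{L}_\alpha(s)}{s}\,ds\right)$, and $\{\mathcal{L}_\alpha(s): s\ge 0\}$ is the $\alpha$-stable Lévy process with $\mathcal{L}_\alpha(1)$ equal in distribution to $\mathcal{L}_\alpha$.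
   Context: $\mathbf{I}(A)$ denotes the indicator function of the event $A$; $[nt]$ denotes the integer part of $nt$; an empty product equals $1$. Throughout, $\log x$ stands for $\ln(\max\{x,e\})$. A sequence of i.i.d. random variables $\{X_n\}$ with partial sums $S_n$ is said to be in the domain of attraction of a stable law $\mathcal{L}_\alpha$ (one of the stable distributions with index $\alpha\in(0,2]$) if there exist sequences $(a_n)$ and $(b_n)$ such that $(S_n-b_n)/a_n$ converges in distribution to $\mathcal{L}_\alpha$. *)

theory Defs
  imports "HOL-Probability.Probability"
begin

text \<open>The convention \<open>log x = ln (max {x, e})\<close>, so that division by \<open>log N\<close> is
  meaningful for every \<open>N\<close>.\<close>

definition clog :: "real \<Rightarrow> real" where
  "clog x = ln (max x (exp 1))"

text \<open>The sequences start at index 1; the value \<open>X 0\<close> is never used.\<close>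

definition partial_sum :: "(nat \<Rightarrow> 'a \<Rightarrow> real) \<Rightarrow> nat \<Rightarrow> 'a \<Rightarrow> real" where
  "partial_sum X n \<omega> = (\<Sum>k=1..n. X k \<omega>)"

definition iid :: "'a measure \<Rightarrow> (nat \<Rightarrow> 'a \<Rightarrow> real) \<Rightarrow> bool" where
  "iid M X \<longleftrightarrow>
     prob_space.indep_vars M (\<lambda>_. borel) X {1..} \<and>
     (\<forall>n\<ge>1. distr M borel (X n) = distr M borel (X 1))"

definition in_domain_of_attraction ::
    "'a measure \<Rightarrow> (nat \<Rightarrow> 'a \<Rightarrow> real) \<Rightarrow> real measure \<Rightarrow> bool" where
  "in_domain_of_attraction M X L \<longleftrightarrow>
     (\<exists>a b. (\<forall>n\<ge>1. a n > 0) \<and>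
       weak_conv_m (\<lambda>n. distr M borel (\<lambda>\<omega>. (partial_sum X n \<omega> - b n) / a n)) L)"

definition stable_char :: "real \<Rightarrow> real \<Rightarrow> complex" where
  "stable_char \<alpha> u =
     (if \<alpha> = 2 then exp (- complex_of_real (u\<^sup>2 / 2))
      else exp (- complex_of_real (\<bar>u\<bar> powr \<alpha>) *
                (1 - \<i> * complex_of_real (sgn u * tan (pi * \<alpha> / 2)))))"

definition stable_law :: "real \<Rightarrow> real measure \<Rightarrow> bool" where
  "stable_law \<alpha> L \<longleftrightarrow> real_distribution L \<and> (\<forall>u. char L u = stable_char \<alpha> u)"

definition cadlag :: "(real \<Rightarrow> real) \<Rightarrow> bool" where
  "cadlag f \<longleftrightarrow>
     (\<forall>s\<ge>0. continuous (at_right s) f) \<and> (\<forall>s>0. \<exists>l. (f \<longlongrightarrow> l) (at_left s))"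

text \<open>Only the values \<open>Y s\<close> with \<open>s \<ge> 0\<close> matter. Stochastic continuity is not listed
  because it follows from stationary increments and right-continuity at \<open>0\<close>.\<close>

definition levy_process :: "'b measure \<Rightarrow> (real \<Rightarrow> 'b \<Rightarrow> real) \<Rightarrow> bool" where
  "levy_process P Y \<longleftrightarrow>
     prob_space P \<and>
     (\<forall>s\<ge>0. Y s \<in> borel_measurable P) \<and>
     (AE \<omega> in P. Y 0 \<omega> = 0) \<and>
     (\<forall>n (r :: nat \<Rightarrow> real). 0 \<le> r 0 \<and> (\<forall>i<n. r i < r (Suc i)) \<longrightarrow>
        prob_space.indep_vars P (\<lambda>_. borel) (\<lambda>i \<omega>. Y (r (Suc i)) \<omega> - Y (r i) \<omega>) {..<n}) \<and>
     (\<forall>s\<ge>0. \<forall>h\<ge>0. distr P borel (\<lambda>\<omega>. Y (s + h) \<omega> - Y s \<omega>) = distr P borel (Y h)) \<and>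
     (\<forall>\<omega>\<in>space P. cadlag (\<lambda>s. Y s \<omega>))"

definition sum_product ::
    "(nat \<Rightarrow> 'a \<Rightarrow> real) \<Rightarrow> real \<Rightarrow> (nat \<Rightarrow> real) \<Rightarrow> nat \<Rightarrow> real \<Rightarrow> 'a \<Rightarrow> real" where
  "sum_product X \<mu> a n t \<omega> =
     (\<Prod>k=1..nat \<lfloor>real n * t\<rfloor>. partial_sum X k \<omega> / (\<mu> * real k)) powr (\<mu> / a n)"

text \<open>For \<open>\<alpha> > 1\<close> and a centred \<open>\<alpha>\<close>-stable process, \<open>Y s / s\<close> is almost surely Lebesgue
  integrable over \<open>[0, t]\<close>, since the expectation of its modulus is a constant
  multiple of \<open>s powr (1 / \<alpha> - 1)\<close>.\<close>

definition exp_integral_cdf :: "'b measure \<Rightarrow> (real \<Rightarrow> 'b \<Rightarrow> real) \<Rightarrow> real \<Rightarrow> real \<Rightarrow> real" where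
  "exp_integral_cdf P Y t =
     cdf (distr P borel (\<lambda>\<omega>. exp (LBINT s:{0..t}. Y s \<omega> / s)))"

end

theory Submission imports Defs
begin

text \<open>
  Let \<open>S n\<close> be the centred partial sum and \<open>m = [n t]\<close>. Up to an error caused by replacing
  \<open>ln (1 + x)\<close> by \<open>x\<close>, the logarithm of the normalized product is
  \<open>T n m = (\<Sum>k=1..m. S k / k) / a n\<close>, a linear functional of the summands. Two facts about \<open>T\<close> give
  the theorem: the laws of \<open>T n [n t]\<close> converge to the law of the integral of \<open>Y s / s\<close> over \<open>[0, t]\<close>,
  and for bounded Lipschitz \<open>g\<close> the logarithmic averages of \<open>g (T n [n t])\<close> stay almost surely
  close to those of the expectations.

  Both rest on moment bounds. The convergence of the powers \<open>\<phi> (u / a n) ^ n\<close> of the characteristic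
  function is uniform on compact sets (\<open>uniform_limit_char\<close>), so one can take logarithms
  (\<open>Ln_lim\<close>) and compare the resulting relation at two indices. This shows that \<open>a n\<close> grows
  between any two powers of \<open>n\<close> with exponents below and above \<open>1 / \<alpha>\<close> (\<open>potter_lower\<close>,
  \<open>potter_upper\<close>) and that \<open>n * norm (1 - \<phi> (u / a n))\<close> is at most a multiple of \<open>u powr g\<close> for
  \<open>g < \<alpha>\<close> (\<open>one_minus_char_le\<close>). Such a bound controls absolute moments of order below
  \<open>g\<close> (\<open>moment_bound\<close>), so the moments of \<open>S n / a n\<close> of some order \<open>p > 1\<close> are bounded
  (\<open>moment_sum_D\<close>).

  For the almost sure part, remove from \<open>T n m\<close> the contribution of the first \<open>l\<close> summands. What
  remains is independent of \<open>T l\<close>, and what is removed has expected modulus at most a multiple of a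
  positive power of \<open>l / n\<close>. The correlations of \<open>g (T n [n t])\<close> therefore decay like a power of
  \<open>l / n\<close>, and a strong law for logarithmic averages applies (\<open>AE_log_avg_tendsto_0\<close>,
  \<open>AE_log_avg_centred\<close>).

  For the convergence of laws, cut \<open>{1..m}\<close> into \<open>r\<close> blocks of equal length and replace \<open>S k / k\<close> by
  its value at the end of the block. The expected error is small uniformly in \<open>n\<close> when \<open>r\<close> is
  large, and for fixed \<open>r\<close> the characteristic functions converge (\<open>expectation_T_tendsto\<close>).
  The limit is the law of the Riemann sum with \<open>r\<close> cells of the integral of \<open>Y s / s\<close>, which is close
  to the integral by the same estimate (\<open>expectation_W_minus_grid_sum\<close>).

  As the partial sums eventually exceed a fixed fraction of their mean, the linearization error is, up
  to finitely many terms, at most a multiple of \<open>(\<Sum>k\<le>n. \<bar>S k / k\<bar> powr p) / a n\<close>. The expectation of this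
  quotient is at most a multiple of a negative power of \<open>n\<close>, so its logarithmic averages vanish (\<open>AE_log_avg_R\<close>). Finally the characteristic
  function of the integral vanishes at infinity, its law has no atoms for \<open>t > 0\<close>, and Lipschitz
  functions can be replaced by indicators of half-lines (\<open>log_avg_indicator_tendsto\<close>).
\<close>

section \<open>Sums of powers and logarithmic averages\<close>

text \<open>By concavity of \<open>x powr b\<close> each summand is at most \<open>1 / b\<close> times the
  increment of \<open>x powr b\<close> over the preceding unit interval, so the sum telescopes.\<close>

lemma sum_powr_le:
  fixes b :: real
  assumes "0 < b" "b \<le> 1"
  shows "(\<Sum>k=1..n. real k powr (b - 1)) \<le> real n powr b / b"
proof (induction n)
  case 0 then show ?case by simp
next
  case (Suc n)
  have "real (Suc n) powr (b - 1) \<le> (real (Suc n) powr b - real n powr b) / b"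
  proof (cases "n = 0")
    case True then show ?thesis using assms by (simp add: divide_simps)
  next
    case False
    have "\<exists>z. real n < z \<and> z < real (Suc n) \<and>
        real (Suc n) powr b - real n powr b = (real (Suc n) - real n) * (b * z powr (b - 1))"
    proof (rule MVT2)
      fix x :: real assume "real n \<le> x"
      then have "x > 0" using False by simp
      then show "((\<lambda>x. x powr b) has_real_derivative b * x powr (b - 1)) (at x)"
        by (auto intro!: derivative_eq_intros)
    qed simp
    then obtain z where z: "real n < z" "z < real (Suc n)"
      "real (Suc n) powr b - real n powr b = b * z powr (b - 1)"
      by auto
    have "real (Suc n) powr (b - 1) \<le> z powr (b - 1)"
      using z False assms by (intro powr_mono2') auto
    then show ?thesis using z assms by (simp add: field_simps)
  qed
  with Suc show ?case using assms by (simp add: field_simps)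
qed

definition log_avg :: "(nat \<Rightarrow> real) \<Rightarrow> nat \<Rightarrow> real" where
  "log_avg f N = (\<Sum>n=1..N. f n / real n) / clog (real N)"

lemma clog_ge_1: "clog x \<ge> 1"
proof -
  have "ln (exp 1) \<le> ln (max x (exp 1))"
    by (subst ln_le_cancel_iff) (auto simp: less_max_iff_disj)
  then show ?thesis by (simp add: clog_def)
qed

lemma clog_pos: "clog x > 0"
  using clog_ge_1[of x] by linarith

lemma ln_le_clog: "x > 0 \<Longrightarrow> ln x \<le> clog x"
  unfolding clog_def by (subst ln_le_cancel_iff) (auto simp: less_max_iff_disj)

lemma clog_at_top: "filterlim (\<lambda>N. clog (real N)) at_top sequentially"
proof (rule filterlim_at_top_mono)
  show "filterlim (\<lambda>N. ln (real N)) at_top sequentially"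
    by (rule filterlim_compose[OF ln_at_top filterlim_real_sequentially])
  show "eventually (\<lambda>N. ln (real N) \<le> clog (real N)) sequentially"
    using eventually_gt_at_top[of 0] by eventually_elim (simp add: ln_le_clog)
qed

lemma log_avg_mono: "(\<And>n. n \<ge> 1 \<Longrightarrow> f n \<le> g n) \<Longrightarrow> log_avg f N \<le> log_avg g N"
  unfolding log_avg_def
  by (intro divide_right_mono sum_mono) (auto intro: less_imp_le clog_pos)

lemma log_avg_add: "log_avg (\<lambda>n. f n + g n) N = log_avg f N + log_avg g N"
  by (simp add: log_avg_def sum.distrib add_divide_distrib)

lemma log_avg_diff: "log_avg (\<lambda>n. f n - g n) N = log_avg f N - log_avg g N"
  by (simp add: log_avg_def sum_subtractf diff_divide_distrib)

lemma log_avg_cmult: "log_avg (\<lambda>n. c * f n) N = c * log_avg f N"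
  by (simp add: log_avg_def sum_distrib_left)

lemma log_avg_abs_le: "\<bar>log_avg f N\<bar> \<le> log_avg (\<lambda>n. \<bar>f n\<bar>) N"
proof -
  have "\<bar>\<Sum>n=1..N. f n / real n\<bar> \<le> (\<Sum>n=1..N. \<bar>f n\<bar> / real n)"
    using sum_abs[of "\<lambda>n. f n / real n" "{1..N}"] by simp
  then show ?thesis
    using clog_pos[of "real N"] by (simp add: log_avg_def abs_divide divide_right_mono)
qed

lemma sum_inverse_eq_harm: "(\<Sum>n=1..N. 1 / real n) = harm N"
  by (simp add: harm_def inverse_eq_divide)

lemma log_avg_const: "log_avg (\<lambda>_. c) \<longlonglongrightarrow> c"
proof -
  have "(\<lambda>N. (harm N - ln (real N)) / clog (real N)) \<longlonglongrightarrow> 0"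
    by (rule real_tendsto_divide_at_top[OF euler_mascheroni_LIMSEQ clog_at_top])
  then have "(\<lambda>N. (harm N - ln (real N)) / clog (real N) + 1) \<longlonglongrightarrow> 0 + 1"
    by (intro tendsto_intros)
  moreover have "eventually (\<lambda>N. (harm N - ln (real N)) / clog (real N) + 1 = log_avg (\<lambda>_. 1) N) sequentially"
    using eventually_ge_at_top[of 3]
  proof eventually_elim
    case (elim N)
    have "exp 1 < (3::real)" using e_less_272 by simp
    with elim have "clog (real N) = ln (real N)" "ln (real N) > 0"
      by (simp_all add: clog_def max_def)
    then show ?case
      unfolding log_avg_def sum_inverse_eq_harm by (simp add: diff_divide_distrib)
  qed
  ultimately have "log_avg (\<lambda>_. 1) \<longlonglongrightarrow> 1"
    by (simp add: tendsto_cong)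
  then have "(\<lambda>N. c * log_avg (\<lambda>_. 1) N) \<longlonglongrightarrow> c * 1"
    by (intro tendsto_intros)
  then show ?thesis
    by (simp add: log_avg_cmult[symmetric])
qed

lemma log_avg_tendsto_0:
  assumes "f \<longlonglongrightarrow> 0"
  shows "log_avg f \<longlonglongrightarrow> 0"
proof (rule LIMSEQ_I)
  fix e :: real assume e: "e > 0"
  obtain K where K: "\<And>n. n \<ge> K \<Longrightarrow> \<bar>f n\<bar> < e / 4"
    using LIMSEQ_D[OF assms, of "e / 4"] e by auto
  define C where "C = (\<Sum>n\<in>{1..K}. \<bar>f n\<bar> / real n)"
  have "(\<lambda>N. C / clog (real N)) \<longlonglongrightarrow> 0"
    by (rule real_tendsto_divide_at_top[OF tendsto_const clog_at_top])
  then have "eventually (\<lambda>N. C / clog (real N) < e / 2) sequentially"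
    by (rule order_tendstoD) (use e in simp)
  moreover have "eventually (\<lambda>N. log_avg (\<lambda>_. 1) N < 2) sequentially"
    by (rule order_tendstoD[OF log_avg_const]) simp
  ultimately have "eventually (\<lambda>N. norm (log_avg f N - 0) < e) sequentially"
  proof eventually_elim
    case (elim N)
    have "(\<Sum>n=1..N. \<bar>f n\<bar> / real n) \<le> (\<Sum>n\<in>{1..N}\<inter>{1..K}. \<bar>f n\<bar> / real n) + (\<Sum>n\<in>{1..N}-{1..K}. \<bar>f n\<bar> / real n)"
      by (intro eq_refl sum.Int_Diff) simp
    also have "(\<Sum>n\<in>{1..N}\<inter>{1..K}. \<bar>f n\<bar> / real n) \<le> C"
      unfolding C_def by (intro sum_mono2) auto
    also have "(\<Sum>n\<in>{1..N}-{1..K}. \<bar>f n\<bar> / real n) \<le> (\<Sum>n\<in>{1..N}-{1..K}. (e / 4) / real n)"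
      by (intro sum_mono divide_right_mono less_imp_le[OF K]) auto
    also have "\<dots> \<le> (\<Sum>n\<in>{1..N}. (e / 4) / real n)"
      using e by (intro sum_mono2) auto
    finally have "(\<Sum>n=1..N. \<bar>f n\<bar> / real n) / clog (real N) \<le> (C + (\<Sum>n\<in>{1..N}. (e / 4) / real n)) / clog (real N)"
      using clog_pos[of "real N"] by (simp add: divide_right_mono)
    also have "\<dots> = C / clog (real N) + e / 4 * log_avg (\<lambda>_. 1) N"
      by (simp add: log_avg_def add_divide_distrib sum_distrib_left)
    also have "\<dots> < e / 2 + e / 4 * 2"
      using elim e by (intro add_strict_mono mult_strict_left_mono) auto
    finally show ?case
      using log_avg_abs_le[of f N] by (simp add: log_avg_def)
  qed
  then show "\<exists>no. \<forall>n\<ge>no. norm (log_avg f n - 0) < e"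
    by (simp add: eventually_sequentially)
qed

lemma log_avg_tendsto:
  assumes "f \<longlonglongrightarrow> c"
  shows "log_avg f \<longlonglongrightarrow> c"
proof -
  have "log_avg (\<lambda>n. f n - c) \<longlonglongrightarrow> 0"
    using assms by (intro log_avg_tendsto_0) (simp add: LIM_zero)
  from tendsto_add[OF this log_avg_const[of c]] show ?thesis
    by (simp add: log_avg_diff)
qed

lemma log_avg_summable:
  assumes "summable (\<lambda>n. f n / real n)"
  shows "log_avg f \<longlonglongrightarrow> 0"
proof -
  have "(\<lambda>N. (\<Sum>n\<le>N. f n / real n) / clog (real N)) \<longlonglongrightarrow> 0"
    by (rule real_tendsto_divide_at_top[OF summable_LIMSEQ'[OF assms] clog_at_top])
  moreover have "(\<Sum>n\<le>N. f n / real n) = (\<Sum>n=1..N. f n / real n)" for N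
    by (rule sum.mono_neutral_right) (auto simp: not_le)
  ultimately show ?thesis by (simp add: log_avg_def[abs_def])
qed

lemma (in prob_space) AE_summable_of_summable_expectation:
  fixes f :: "nat \<Rightarrow> 'a \<Rightarrow> real"
  assumes [measurable]: "\<And>n. integrable M (f n)" and nn: "\<And>n. AE x in M. 0 \<le> f n x"
    and s: "summable (\<lambda>n. expectation (f n))"
  shows "AE x in M. summable (\<lambda>n. f n x)"
proof -
  have "(\<integral>\<^sup>+x. (\<Sum>n. ennreal (f n x)) \<partial>M) = (\<Sum>n. \<integral>\<^sup>+x. ennreal (f n x) \<partial>M)"
    by (rule nn_integral_suminf) measurable
  also have "\<dots> = (\<Sum>n. ennreal (expectation (f n)))"
    by (intro suminf_cong nn_integral_eq_integral assms)
  also have "\<dots> = ennreal (\<Sum>n. expectation (f n))"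
    by (rule suminf_ennreal2[OF _ s]) (intro integral_nonneg_AE nn)
  finally have "(\<integral>\<^sup>+x. (\<Sum>n. ennreal (f n x)) \<partial>M) \<noteq> \<infinity>" by simp
  then have "AE x in M. (\<Sum>n. ennreal (f n x)) \<noteq> \<infinity>"
    by (intro nn_integral_PInf_AE) measurable
  moreover have "AE x in M. \<forall>n. 0 \<le> f n x" using nn by (simp add: AE_all_countable)
  ultimately show ?thesis
  proof eventually_elim
    case (elim x)
    then show ?case
      by (intro summable_suminf_not_top) auto
  qed
qed

lemma harm_diff_le:
  assumes "0 < m" "m \<le> n"
  shows "harm n - harm m \<le> ln (real n / real m)"
  using euler_mascheroni_sequence_decreasing[of m n] assms by (simp add: ln_div)

text \<open>A strong law for logarithmic averages of bounded variables whose correlations decay like a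
  power of the ratio of the indices: the second moment of the weighted sum up to \<open>N\<close> is then of
  order \<open>ln N\<close>, which is summable relative to \<open>(ln N)\<^sup>2\<close> along \<open>N = 2 ^ (k\<^sup>2)\<close>; between two such
  indices the sum changes by at most the harmonic increment, which is of order \<open>k\<close>,
  negligible against \<open>ln N\<close>.\<close>

lemma (in prob_space) AE_log_avg_tendsto_0:
  fixes \<xi> :: "nat \<Rightarrow> 'a \<Rightarrow> real"
  assumes [measurable]: "\<And>n. random_variable borel (\<xi> n)"
    and bd: "\<And>n x. \<bar>\<xi> n x\<bar> \<le> B"
    and b: "0 < b" "b \<le> 1"
    and cov: "\<And>l n. 1 \<le> l \<Longrightarrow> l \<le> n \<Longrightarrow>
      \<bar>expectation (\<lambda>x. \<xi> l x * \<xi> n x)\<bar> \<le> C * (real l / real n) powr b"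
  shows "AE x in M. log_avg (\<lambda>n. \<xi> n x) \<longlonglongrightarrow> 0"
proof -
  define Q where "Q N x = (\<Sum>n=1..N. \<xi> n x / real n)" for N x
  have B0: "B \<ge> 0" using bd[of undefined undefined] by linarith
  have C0: "0 \<le> C"
  proof (rule order_trans)
    show "\<bar>expectation (\<lambda>x. \<xi> 1 x * \<xi> 1 x)\<bar> \<le> C" using cov[of 1 1] by simp
  qed simp
  have [measurable]: "random_variable borel (Q N)" for N unfolding Q_def by measurable
  have int2: "integrable M (\<lambda>x. \<xi> l x * \<xi> n x)" for l n
    by (rule integrable_const_bound[of _ "B * B"])
      (auto simp: abs_mult intro!: AE_I2 mult_mono bd B0)
  have intQ: "integrable M (\<lambda>x. (Q N x)\<^sup>2)" for N
    unfolding Q_def power2_eq_square sum_product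
    by (intro Bochner_Integration.integrable_sum) (use int2 in \<open>simp add: field_simps\<close>)
  have EQ: "expectation (\<lambda>x. (Q N x)\<^sup>2) \<le> 2 * C / b * harm N" for N
  proof -
    define c where "c l n = \<bar>expectation (\<lambda>x. \<xi> l x * \<xi> n x)\<bar> / (real l * real n)" for l n
    have csym: "c l n = c n l" for l n by (simp add: c_def mult.commute)
    have c0: "c l n \<ge> 0" for l n by (simp add: c_def)
    have row: "(\<Sum>l=1..n. c l n) \<le> C / b * (1 / real n)" if "1 \<le> n" for n
    proof -
      have "(\<Sum>l=1..n. c l n) \<le> (\<Sum>l=1..n. C * real n powr (-b) / real n * real l powr (b - 1))"
      proof (rule sum_mono)
        fix l assume l: "l \<in> {1..n}"
        have "c l n \<le> C * (real l / real n) powr b / (real l * real n)"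
          unfolding c_def using l by (intro divide_right_mono cov) auto
        also have "\<dots> = C * real n powr (-b) / real n * real l powr (b - 1)"
          using l that by (simp add: powr_divide powr_diff powr_minus field_simps)
        finally show "c l n \<le> C * real n powr (-b) / real n * real l powr (b - 1)" .
      qed
      also have "\<dots> \<le> C * real n powr (-b) / real n * (real n powr b / b)"
        unfolding sum_distrib_left[symmetric] using b C0
        by (intro mult_left_mono sum_powr_le) auto
      also have "\<dots> = C / b * (1 / real n)"
        using that by (simp add: powr_minus field_simps)
      finally show ?thesis .
    qed
    have "expectation (\<lambda>x. (Q N x)\<^sup>2) = (\<Sum>l=1..N. \<Sum>n=1..N. expectation (\<lambda>x. \<xi> l x / real l * (\<xi> n x / real n)))"
      unfolding Q_def power2_eq_square sum_product using int2
      by (subst Bochner_Integration.integral_sum, force)+ (simp add: field_simps)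
    also have "\<dots> \<le> (\<Sum>l=1..N. \<Sum>n=1..N. c l n)"
      by (intro sum_mono) (simp add: c_def divide_right_mono)
    also have "\<dots> \<le> (\<Sum>l=1..N. \<Sum>n=1..N. (if l \<le> n then c l n else 0) + (if n \<le> l then c n l else 0))"
      using c0 csym by (intro sum_mono) auto
    also have "\<dots> = (\<Sum>n=1..N. \<Sum>l=1..N. if l \<le> n then c l n else 0) + (\<Sum>n=1..N. \<Sum>l=1..N. if l \<le> n then c l n else 0)"
      unfolding sum.distrib by (subst sum.swap) simp
    also have "(\<Sum>n=1..N. \<Sum>l=1..N. if l \<le> n then c l n else 0) = (\<Sum>n=1..N. \<Sum>l=1..n. c l n)"
    proof (rule sum.cong[OF refl])
      fix n assume "n \<in> {1..N}"
      then show "(\<Sum>l=1..N. if l \<le> n then c l n else 0) = (\<Sum>l=1..n. c l n)"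
        by (intro sum.mono_neutral_cong_right) auto
    qed
    also have "\<dots> \<le> (\<Sum>n=1..N. C / b * (1 / real n))"
      by (intro sum_mono row) auto
    also have "\<dots> = C / b * harm N"
      unfolding sum_distrib_left[symmetric] sum_inverse_eq_harm ..
    finally show ?thesis by simp
  qed
  \<comment> \<open>sparse enough for \<open>1 / ln (e k)\<close> to be summable, dense enough for \<open>ln (e (Suc k)) / ln (e k)\<close> to tend to \<open>1\<close>\<close>
  define e where "e k = (2::nat) ^ (k\<^sup>2)" for k :: nat
  have e1: "e k \<ge> 1" for k by (simp add: e_def)
  have ln_e: "ln (real (e k)) = (real k)\<^sup>2 * ln 2" for k
    by (simp add: e_def ln_realpow)
  have e_mono: "e k \<le> e (Suc k)" for k by (simp add: e_def power_increasing)
  have harm_e: "harm (e k) \<le> (real k)\<^sup>2 * ln 2 + 1" if "k \<ge> 1" for k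
    using harm_diff_le[of 1 "e k"] e1[of k] ln_e[of k] by (simp add: harm_expand)
  define K where "K = 2 * C / b"
  have "AE x in M. summable (\<lambda>k. (Q (e (Suc k)) x / (real (Suc k))\<^sup>2)\<^sup>2)"
  proof (rule AE_summable_of_summable_expectation)
    show "integrable M (\<lambda>x. (Q (e (Suc k)) x / (real (Suc k))\<^sup>2)\<^sup>2)" for k
      unfolding power_divide by (intro integrable_divide intQ)
    show "summable (\<lambda>k. expectation (\<lambda>x. (Q (e (Suc k)) x / (real (Suc k))\<^sup>2)\<^sup>2))"
    proof (rule summable_comparison_test'[where N=0])
      show "summable (\<lambda>k. K * 3 * (1 / real (Suc k) ^ 2))"
        using inverse_power_summable[of 2, where ?'a=real]
        by (intro summable_mult, subst summable_Suc_iff) (simp add: inverse_eq_divide power_divide)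
      fix k :: nat
      have "expectation (\<lambda>x. (Q (e (Suc k)) x / (real (Suc k))\<^sup>2)\<^sup>2)
          = expectation (\<lambda>x. (Q (e (Suc k)) x)\<^sup>2) / (real (Suc k))^4"
        by (simp add: power_divide flip: power_mult)
      also have "\<dots> \<le> K * harm (e (Suc k)) / (real (Suc k))^4"
        unfolding K_def by (intro divide_right_mono EQ) simp
      also have "\<dots> \<le> K * (3 * (real (Suc k))^2) / (real (Suc k))^4"
      proof (intro divide_right_mono mult_left_mono)
        have "ln 2 \<le> (1::real)" using ln_2_less_1 by simp
        then have "(real (Suc k))\<^sup>2 * ln 2 \<le> (real (Suc k))\<^sup>2 * 1" by (intro mult_left_mono) auto
        moreover have "1 \<le> (real (Suc k))\<^sup>2" by simp
        ultimately show "harm (e (Suc k)) \<le> 3 * (real (Suc k))^2"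
          using harm_e[of "Suc k"] by linarith
        show "0 \<le> K" using b C0 by (simp add: K_def)
      qed simp
      also have "\<dots> = K * 3 * (1 / real (Suc k) ^ 2)"
        by (simp add: power2_eq_square power4_eq_xxxx del: of_nat_Suc)
      finally show "norm (expectation (\<lambda>x. (Q (e (Suc k)) x / (real (Suc k))\<^sup>2)\<^sup>2)) \<le> K * 3 * (1 / real (Suc k) ^ 2)"
        by simp
    qed
  qed simp
  then show ?thesis
  proof eventually_elim
    case (elim x)
    have "(\<lambda>k. (Q (e (Suc k)) x / (real (Suc k))\<^sup>2)\<^sup>2) \<longlonglongrightarrow> 0"
      using elim by (rule summable_LIMSEQ_zero)
    then have "(\<lambda>k. Q (e (Suc k)) x / (real (Suc k))\<^sup>2) \<longlonglongrightarrow> 0"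
      by simp
    then have Q0: "(\<lambda>k. Q (e k) x / (real k)\<^sup>2) \<longlonglongrightarrow> 0"
      by (rule LIMSEQ_imp_Suc)
    define k where "k N = (GREATEST k. e k \<le> N)" for N
    have kN: "e (k N) \<le> N \<and> N < e (Suc (k N))" if "N \<ge> 1" for N
    proof -
      have bound: "j \<le> N" if "e j \<le> N" for j
      proof -
        have "j \<le> j\<^sup>2" by (simp add: power2_eq_square)
        also have "\<dots> < e j" unfolding e_def by (rule less_exp)
        finally show ?thesis using that by simp
      qed
      have "e 0 \<le> N" using that by (simp add: e_def)
      from GreatestI_nat[of "\<lambda>k. e k \<le> N", OF this bound]
      have 1: "e (k N) \<le> N" unfolding k_def by simp
      have "\<not> e (Suc (k N)) \<le> N"
        using Greatest_le_nat[of "\<lambda>k. e k \<le> N" "Suc (k N)" N] bound unfolding k_def by fastforce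
      with 1 show ?thesis by simp
    qed
    have klim: "filterlim k at_top sequentially"
      unfolding filterlim_at_top
    proof
      fix Z
      show "eventually (\<lambda>N. Z \<le> k N) sequentially"
        using eventually_ge_at_top[of "e Z"]
      proof eventually_elim
        case (elim N)
        show ?case
        proof (rule ccontr)
          assume "\<not> Z \<le> k N"
          then have "(Suc (k N))\<^sup>2 \<le> Z\<^sup>2" by (intro power_mono) auto
          then have "e (Suc (k N)) \<le> e Z" unfolding e_def by (intro power_increasing) auto
          moreover have "N < e (Suc (k N))" using kN[of N] elim e1[of Z] by simp
          ultimately show False using elim by simp
        qed
      qed
    qed
    \<comment> \<open>\<open>R (k N)\<close> bounds the average at \<open>N\<close>: the value at \<open>e (k N)\<close> plus the harmonic increment up to \<open>e (Suc (k N))\<close>\<close>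
    define R where "R j = \<bar>Q (e j) x / (real j)\<^sup>2\<bar> / ln 2 + B * (2 * (1 / real j) + 1 / (real j)\<^sup>2)" for j
    have "R \<longlonglongrightarrow> \<bar>0\<bar> / ln 2 + B * (2 * 0 + 0)"
      unfolding R_def using tendsto_power[OF lim_1_over_n[where 'a=real], of 2]
      by (intro tendsto_intros Q0) (simp_all add: power_divide)
    then have "(\<lambda>N. R (k N)) \<longlonglongrightarrow> 0"
      using filterlim_compose[OF _ klim] by simp
    moreover have "eventually (\<lambda>N. norm (log_avg (\<lambda>n. \<xi> n x) N) \<le> R (k N)) sequentially"
      using eventually_ge_at_top[of 1] klim[unfolded filterlim_at_top, rule_format, of 1]
    proof eventually_elim
      case (elim N)
      let ?j = "k N"
      have j: "real ?j \<ge> 1" "e ?j \<le> N" "N \<le> e (Suc ?j)" using kN[of N] elim by auto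
      have "Q N x - Q (e ?j) x = (\<Sum>n\<in>{e ?j<..N}. \<xi> n x / real n)"
        unfolding Q_def using j e1[of ?j]
        by (subst sum_diff[symmetric]) (auto intro!: sum.cong)
      also have "\<bar>\<dots>\<bar> \<le> (\<Sum>n\<in>{e ?j<..N}. B * (1 / real n))"
        by (intro order_trans[OF sum_abs] sum_mono) (simp add: abs_divide divide_right_mono bd)
      also have "\<dots> = B * (harm N - harm (e ?j))"
        unfolding sum_distrib_left[symmetric] sum_inverse_eq_harm[symmetric] using j e1[of ?j]
        by (subst sum_diff[symmetric]) (auto intro!: sum.cong)
      also have "\<dots> \<le> B * (harm (e (Suc ?j)) - harm (e ?j))"
        using B0 j by (intro mult_left_mono diff_right_mono harm_mono)
      also have "\<dots> \<le> B * ln (real (e (Suc ?j)) / real (e ?j))"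
        using B0 e_mono[of ?j] e1[of ?j] by (intro mult_left_mono harm_diff_le) auto
      also have "ln (real (e (Suc ?j)) / real (e ?j)) = (2 * real ?j + 1) * ln 2"
        using e1[of ?j] e1[of "Suc ?j"]
        by (subst ln_div) (simp_all add: ln_e power2_eq_square algebra_simps)
      finally have 1: "\<bar>Q N x\<bar> \<le> \<bar>Q (e ?j) x\<bar> + B * (2 * real ?j + 1) * ln 2" by simp
      have "(real ?j)\<^sup>2 * ln 2 \<le> ln (real N)"
        unfolding ln_e[symmetric] using j e1[of ?j] by (subst ln_le_cancel_iff) auto
      also have "\<dots> \<le> clog (real N)" using elim by (intro ln_le_clog) auto
      finally have 2: "(real ?j)\<^sup>2 * ln 2 \<le> clog (real N)" .
      have "norm (log_avg (\<lambda>n. \<xi> n x) N) = \<bar>Q N x\<bar> / clog (real N)"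
        using clog_pos[of "real N"] by (simp add: log_avg_def Q_def abs_divide)
      also have "\<dots> \<le> \<bar>Q N x\<bar> / ((real ?j)\<^sup>2 * ln 2)"
        using j by (intro divide_left_mono 2) (auto intro!: mult_pos_pos clog_pos)
      also have "\<dots> \<le> (\<bar>Q (e ?j) x\<bar> + B * (2 * real ?j + 1) * ln 2) / ((real ?j)\<^sup>2 * ln 2)"
        by (intro divide_right_mono 1) auto
      also have "\<dots> = R ?j"
        unfolding R_def using j by (simp add: abs_divide field_simps power2_eq_square)
      finally show ?case .
    qed
    ultimately show ?case by (rule Lim_null_comparison[rotated])
  qed
qed

section \<open>Characteristic functions\<close>

text \<open>Only the dependence on \<open>p\<close>, \<open>g\<close> and \<open>C\<close> matters: the bound is the same for all distributions
  that satisfy the hypotheses of \<open>moment_bound\<close>.\<close>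

definition moment_bound_const :: "real \<Rightarrow> real \<Rightarrow> real \<Rightarrow> real" where
  "moment_bound_const p g C =
     1 + 2 powr (1 + p) / (1 - cos 1) * (max C 2 * (2 powr (g - p) / (g - p)))"

lemma cos_1_less_1: "cos 1 < (1::real)"
  using cos_monotone_0_pi[of 0 1] pi_ge_two by simp

text \<open>For \<open>\<bar>z\<bar> > 1\<close> the part \<open>1 \<le> u * \<bar>z\<bar> \<le> 2\<close> of the range of integration, on which
  \<open>cos (u * z)\<close> stays below \<open>cos 1\<close>, already contributes a multiple of \<open>\<bar>z\<bar> powr p\<close>.\<close>

lemma abs_powr_le_integral_cos:
  fixes z p :: real
  assumes p: "0 < p"
  shows "ennreal (\<bar>z\<bar> powr p) \<le> 1 + ennreal (2 powr (1 + p) / (1 - cos 1)) *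
    (\<integral>\<^sup>+u. indicator {0..2} u * ennreal ((1 - cos (u * z)) * u powr (-1 - p)) \<partial>lborel)"
proof (cases "\<bar>z\<bar> \<le> 1")
  case True
  then have "\<bar>z\<bar> powr p \<le> 1" using p by (simp add: powr_le1)
  then have "ennreal (\<bar>z\<bar> powr p) \<le> 1" by (simp add: ennreal_le_1)
  then show ?thesis by (rule order_trans) simp
next
  case False
  define w where "w = \<bar>z\<bar>"
  have w: "w > 1" using False by (simp add: w_def)
  define m where "m = (1 - cos 1) * (2 / w) powr (-1 - p)"
  have m0: "m \<ge> 0" using cos_1_less_1 by (simp add: m_def)
  have "ennreal (m / w) = (\<integral>\<^sup>+u. ennreal m * indicator {1 / w..2 / w} u \<partial>lborel)"
    using w m0 by (subst nn_integral_cmult_indicator)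
      (auto simp: divide_right_mono diff_divide_distrib[symmetric] ennreal_mult'[symmetric])
  also have "\<dots> \<le> (\<integral>\<^sup>+u. indicator {0..2} u * ennreal ((1 - cos (u * z)) * u powr (-1 - p)) \<partial>lborel)"
  proof (rule nn_integral_mono)
    fix u :: real
    show "ennreal m * indicator {1 / w..2 / w} u \<le> indicator {0..2} u * ennreal ((1 - cos (u * z)) * u powr (-1 - p))"
    proof (cases "u \<in> {1 / w..2 / w}")
      case True
      have u: "u > 0" using True w by (smt (verit) atLeastAtMost_iff zero_less_divide_1_iff)
      have "u \<le> 2 / w" using True by simp
      also have "\<dots> \<le> 2" using w by (simp add: divide_simps)
      finally have u2: "u \<le> 2" .
      have uw: "1 \<le> u * w" "u * w \<le> 2" using True w by (auto simp: field_simps)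
      have "cos (u * z) = cos (u * w)"
        unfolding w_def by (cases "z \<ge> 0") (auto simp: abs_if)
      also have "\<dots> \<le> cos 1" using uw pi_ge_two by (intro cos_monotone_0_pi_le) auto
      finally have "1 - cos 1 \<le> 1 - cos (u * z)" by simp
      moreover have "(2 / w) powr (-1 - p) \<le> u powr (-1 - p)"
        using True u p by (intro powr_mono2') auto
      ultimately have "m \<le> (1 - cos (u * z)) * u powr (-1 - p)"
        unfolding m_def by (intro mult_mono) auto
      then show ?thesis using True u u2 by (simp add: ennreal_leI)
    qed simp
  qed
  finally have le: "ennreal (m / w) \<le> (\<integral>\<^sup>+u. indicator {0..2} u * ennreal ((1 - cos (u * z)) * u powr (-1 - p)) \<partial>lborel)" .
  have "w powr p = 2 powr (1 + p) / (1 - cos 1) * (m / w)"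
    unfolding m_def using w cos_1_less_1
    by (simp add: powr_divide powr_diff powr_minus powr_add field_simps)
  then have "ennreal (\<bar>z\<bar> powr p) = ennreal (2 powr (1 + p) / (1 - cos 1)) * ennreal (m / w)"
    using cos_1_less_1 m0 w by (subst ennreal_mult[symmetric]) (auto simp: w_def)
  also have "\<dots> \<le> ennreal (2 powr (1 + p) / (1 - cos 1)) * (\<integral>\<^sup>+u. indicator {0..2} u * ennreal ((1 - cos (u * z)) * u powr (-1 - p)) \<partial>lborel)"
    by (intro mult_left_mono le) simp
  finally show ?thesis by (rule order_trans) simp
qed

text \<open>Integrating the previous bound over \<open>z\<close> turns \<open>1 - cos (u * z)\<close> into the real part of
  \<open>1 - char M u\<close>; so a Hoelder bound of order \<open>g\<close> for the characteristic function at \<open>0\<close> controls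
  all absolute moments of order below \<open>g\<close>, with a constant that depends on nothing else.\<close>

lemma (in real_distribution) moment_bound:
  fixes p g C :: real
  assumes p: "0 < p" "p < g"
    and h: "\<And>u. 0 < u \<Longrightarrow> u \<le> 1 \<Longrightarrow> norm (1 - char M u) \<le> C * u powr g"
  shows "integrable M (\<lambda>x. \<bar>x\<bar> powr p)"
    and "expectation (\<lambda>x. \<bar>x\<bar> powr p) \<le> moment_bound_const p g C"
proof -
  let ?D = "2 powr (1 + p) / (1 - cos 1) :: real"
  define C' where "C' = max C 2"
  have h2: "norm (1 - char M u) \<le> C' * u powr g" if "0 < u" for u
  proof (cases "u \<le> 1")
    case True
    have "C * u powr g \<le> C' * u powr g" by (intro mult_right_mono) (auto simp: C'_def)
    with h[OF that True] show ?thesis by linarith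
  next
    case False
    have "norm (1 - char M u) \<le> norm (1::complex) + norm (char M u)" by (rule norm_triangle_ineq4)
    also have "\<dots> \<le> 2 * 1" using cmod_char_le_1[of u] by simp
    also have "\<dots> \<le> C' * u powr g"
      using False p by (intro mult_mono) (auto simp: C'_def ge_one_powr_ge_zero)
    finally show ?thesis .
  qed
  have cosint: "(\<integral>\<^sup>+z. ennreal (1 - cos (u * z)) \<partial>M) \<le> ennreal (C' * u powr g)" if "0 < u" for u
  proof -
    have i: "integrable M (\<lambda>z. iexp (u * z))" by (rule integrable_iexp) auto
    have "integrable M (\<lambda>z. Re (iexp (u * z)))" by (intro integrable_Re i)
    then have ic: "integrable M (\<lambda>z. cos (u * z))" by (simp add: Re_exp)
    have "(\<integral>\<^sup>+z. ennreal (1 - cos (u * z)) \<partial>M) = ennreal (\<integral>z. (1 - cos (u * z)) \<partial>M)"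
      using ic by (intro nn_integral_eq_integral) auto
    also have "(\<integral>z. (1 - cos (u * z)) \<partial>M) = 1 - (\<integral>z. Re (iexp (u * z)) \<partial>M)"
      using ic by (simp add: Re_exp prob_space del: space_eq_univ)
    also have "(\<integral>z. Re (iexp (u * z)) \<partial>M) = Re (char M u)"
      unfolding char_def by (intro integral_Re i)
    also have "1 - Re (char M u) \<le> norm (1 - char M u)"
      using complex_Re_le_cmod[of "1 - char M u"] by simp
    also have "\<dots> \<le> C' * u powr g" by (rule h2[OF that])
    finally show ?thesis by (simp add: ennreal_leI)
  qed
  interpret P: pair_sigma_finite M lborel ..
  have "(\<integral>\<^sup>+z. (\<integral>\<^sup>+u. indicator {0..2} u * ennreal ((1 - cos (u * z)) * u powr (-1 - p)) \<partial>lborel) \<partial>M)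
      = (\<integral>\<^sup>+u. (\<integral>\<^sup>+z. indicator {0..2} u * ennreal ((1 - cos (u * z)) * u powr (-1 - p)) \<partial>M) \<partial>lborel)"
    by (rule P.Fubini'[symmetric]) measurable
  also have "\<dots> \<le> (\<integral>\<^sup>+u. indicator {0..2} u * ennreal (C' * u powr (g - p - 1)) \<partial>lborel)"
  proof (rule nn_integral_mono)
    fix u :: real
    show "(\<integral>\<^sup>+z. indicator {0..2} u * ennreal ((1 - cos (u * z)) * u powr (-1 - p)) \<partial>M)
      \<le> indicator {0..2} u * ennreal (C' * u powr (g - p - 1))"
    proof (cases "u \<in> {0..2} \<and> u \<noteq> 0")
      case True
      then have u: "u > 0" by auto
      have "(\<integral>\<^sup>+z. indicator {0..2} u * ennreal ((1 - cos (u * z)) * u powr (-1 - p)) \<partial>M)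
          = (\<integral>\<^sup>+z. ennreal (u powr (-1 - p)) * ennreal (1 - cos (u * z)) \<partial>M)"
        using True by (intro nn_integral_cong) (simp add: ennreal_mult'[symmetric] mult.commute)
      also have "\<dots> = ennreal (u powr (-1 - p)) * (\<integral>\<^sup>+z. ennreal (1 - cos (u * z)) \<partial>M)"
        by (rule nn_integral_cmult) measurable
      also have "\<dots> \<le> ennreal (u powr (-1 - p)) * ennreal (C' * u powr g)"
        by (intro mult_left_mono cosint u) simp
      also have "\<dots> = ennreal (C' * u powr (g - p - 1))"
        using u by (subst ennreal_mult'[symmetric]) (auto simp: powr_diff powr_minus field_simps powr_add)
      finally show ?thesis using True by simp
    qed auto
  qed
  also have "\<dots> = (\<integral>\<^sup>+u. ennreal C' * ennreal (indicator {0..2} u * u powr (g - p - 1)) \<partial>lborel)"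
    by (intro nn_integral_cong) (auto simp: indicator_def ennreal_mult' C'_def)
  also have "\<dots> = ennreal C' * (\<integral>\<^sup>+u. ennreal (indicator {0..2} u * u powr (g - p - 1)) \<partial>lborel)"
    by (rule nn_integral_cmult) measurable
  also have "(\<integral>\<^sup>+u. ennreal (indicator {0..2} u * u powr (g - p - 1)) \<partial>lborel) = ennreal (2 powr (g - p) / (g - p))"
    using has_integral_powr_from_0[of "g - p - 1" 2] p
    by (intro nn_integral_has_integral_lborel nn_integral_has_integral_lebesgue) auto
  finally have I: "(\<integral>\<^sup>+z. (\<integral>\<^sup>+u. indicator {0..2} u * ennreal ((1 - cos (u * z)) * u powr (-1 - p)) \<partial>lborel) \<partial>M)
     \<le> ennreal C' * ennreal (2 powr (g - p) / (g - p))" (is "?I \<le> _") .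
  have "(\<integral>\<^sup>+z. ennreal (\<bar>z\<bar> powr p) \<partial>M) \<le> (\<integral>\<^sup>+z. 1 + ennreal ?D *
    (\<integral>\<^sup>+u. indicator {0..2} u * ennreal ((1 - cos (u * z)) * u powr (-1 - p)) \<partial>lborel) \<partial>M)"
    by (intro nn_integral_mono abs_powr_le_integral_cos p)
  also have "\<dots> = (\<integral>\<^sup>+z. 1 \<partial>M) + (\<integral>\<^sup>+z. ennreal ?D * (\<integral>\<^sup>+u. indicator {0..2} u * ennreal ((1 - cos (u * z)) * u powr (-1 - p)) \<partial>lborel) \<partial>M)"
    by (rule nn_integral_add) measurable
  also have "(\<integral>\<^sup>+z. ennreal ?D * (\<integral>\<^sup>+u. indicator {0..2} u * ennreal ((1 - cos (u * z)) * u powr (-1 - p)) \<partial>lborel) \<partial>M) = ennreal ?D * ?I"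
    by (rule nn_integral_cmult) measurable
  also have "(\<integral>\<^sup>+z. 1 \<partial>M) = 1" using emeasure_space_1 by simp
  also have "1 + ennreal ?D * ?I \<le> 1 + ennreal ?D * (ennreal C' * ennreal (2 powr (g - p) / (g - p)))"
    by (intro add_left_mono mult_left_mono I) simp
  also have "\<dots> = ennreal (moment_bound_const p g C)"
    using p cos_1_less_1 unfolding moment_bound_const_def C'_def[symmetric]
    by (subst ennreal_plus) (auto simp: ennreal_mult'[symmetric] ennreal_mult''[symmetric] C'_def)
  finally have fin: "(\<integral>\<^sup>+z. ennreal (\<bar>z\<bar> powr p) \<partial>M) \<le> ennreal (moment_bound_const p g C)" .
  show i: "integrable M (\<lambda>x. \<bar>x\<bar> powr p)"
    using fin by (intro integrableI_nonneg) (auto intro: le_less_trans)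
  have "ennreal (expectation (\<lambda>x. \<bar>x\<bar> powr p)) \<le> ennreal (moment_bound_const p g C)"
    using fin nn_integral_eq_integral[OF i] by simp
  moreover have "moment_bound_const p g C \<ge> 0"
    using p cos_1_less_1 by (simp add: moment_bound_const_def)
  ultimately show "expectation (\<lambda>x. \<bar>x\<bar> powr p) \<le> moment_bound_const p g C"
    by (simp add: ennreal_le_iff)
qed

text \<open>For a Skorohod coupling the differences of the characteristic functions are bounded, uniformly
  for \<open>\<bar>u\<bar> \<le> K\<close>, by the expectation of \<open>min 2 (K * \<bar>Z\<^sub>n - Z\<bar>)\<close>.\<close>

lemma uniform_limit_char:
  assumes "\<And>n. real_distribution (\<mu> n)" "real_distribution M" "weak_conv_m \<mu> M"
  shows "uniform_limit {-K..K} (\<lambda>n. char (\<mu> n)) (char M) sequentially"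
proof -
  obtain \<Omega> :: "real measure" and Z :: "nat \<Rightarrow> real \<Rightarrow> real" and Y :: "real \<Rightarrow> real" where
    \<Omega>: "prob_space \<Omega>" and [measurable]: "\<And>n. Z n \<in> borel_measurable \<Omega>" "Y \<in> borel_measurable \<Omega>"
    and dZ: "\<And>n. distr \<Omega> borel (Z n) = \<mu> n" and dY: "distr \<Omega> borel Y = M"
    and lim: "\<And>x. x \<in> space \<Omega> \<Longrightarrow> (\<lambda>n. Z n x) \<longlonglongrightarrow> Y x"
    using Skorohod[OF assms] by force
  interpret prob_space \<Omega> by fact
  define K' where "K' = \<bar>K\<bar>"
  have cz: "char (\<mu> n) u = (\<integral>x. iexp (u * Z n x) \<partial>\<Omega>)" for n u
    unfolding char_def dZ[symmetric] by (subst integral_distr) auto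
  have cy: "char M u = (\<integral>x. iexp (u * Y x) \<partial>\<Omega>)" for u
    unfolding char_def dY[symmetric] by (subst integral_distr) auto
  have iexp_diff: "norm (iexp x - iexp y) \<le> min 2 \<bar>x - y\<bar>" for x y :: real
  proof -
    have "norm (iexp x - iexp y) \<le> norm (iexp x) + norm (iexp y)" by (rule norm_triangle_ineq4)
    moreover have "iexp x - iexp y = iexp y * (iexp (x - y) - 1)"
      by (simp add: algebra_simps exp_add[symmetric])
    then have "norm (iexp x - iexp y) = norm (iexp (x - y) - 1)" by (simp add: norm_mult)
    moreover have "norm (iexp (x - y) - 1) \<le> \<bar>x - y\<bar>"
      using iexp_approx1[of "x - y" 0] by simp
    ultimately show ?thesis by simp
  qed
  have ii: "integrable \<Omega> (\<lambda>x. iexp (u * f x))" if "f \<in> borel_measurable \<Omega>" for u and f :: "real \<Rightarrow> real"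
    using that by (intro integrable_iexp) auto
  have ib: "integrable \<Omega> (\<lambda>x. min 2 (K' * \<bar>Z n x - Y x\<bar>))" for n
    by (rule integrable_const_bound[of _ 2]) (auto simp: K'_def)
  have bound: "norm (char (\<mu> n) u - char M u) \<le> expectation (\<lambda>x. min 2 (K' * \<bar>Z n x - Y x\<bar>))"
    if "u \<in> {-K..K}" for n u
  proof -
    have "char (\<mu> n) u - char M u = (\<integral>x. iexp (u * Z n x) - iexp (u * Y x) \<partial>\<Omega>)"
      unfolding cz cy by (intro Bochner_Integration.integral_diff[symmetric] ii) auto
    also have "norm \<dots> \<le> expectation (\<lambda>x. min 2 (K' * \<bar>Z n x - Y x\<bar>))"
    proof (rule Bochner_Integration.integral_norm_bound_integral)
      fix x assume "x \<in> space \<Omega>"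
      have "norm (iexp (u * Z n x) - iexp (u * Y x)) \<le> min 2 \<bar>u * Z n x - u * Y x\<bar>"
        by (rule iexp_diff)
      also have "\<bar>u * Z n x - u * Y x\<bar> = \<bar>u\<bar> * \<bar>Z n x - Y x\<bar>"
        by (simp add: right_diff_distrib[symmetric] abs_mult)
      also have "min 2 (\<bar>u\<bar> * \<bar>Z n x - Y x\<bar>) \<le> min 2 (K' * \<bar>Z n x - Y x\<bar>)"
        using that by (intro min.mono mult_right_mono) (auto simp: K'_def)
      finally show "norm (iexp (u * Z n x) - iexp (u * Y x)) \<le> min 2 (K' * \<bar>Z n x - Y x\<bar>)" .
    qed (rule Bochner_Integration.integrable_diff[OF ii ii], measurable, rule ib)
    finally show ?thesis .
  qed
  have "(\<lambda>n. expectation (\<lambda>x. min 2 (K' * \<bar>Z n x - Y x\<bar>))) \<longlonglongrightarrow> expectation (\<lambda>x. 0)"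
  proof (rule integral_dominated_convergence[where w="\<lambda>_. 2"])
    show "AE x in \<Omega>. (\<lambda>n. min 2 (K' * \<bar>Z n x - Y x\<bar>)) \<longlonglongrightarrow> 0"
    proof (rule AE_I2)
      fix x assume "x \<in> space \<Omega>"
      have "(\<lambda>n. min 2 (K' * \<bar>Z n x - Y x\<bar>)) \<longlonglongrightarrow> min 2 (K' * \<bar>Y x - Y x\<bar>)"
        by (intro tendsto_intros lim) fact
      then show "(\<lambda>n. min 2 (K' * \<bar>Z n x - Y x\<bar>)) \<longlonglongrightarrow> 0" by simp
    qed
    show "AE x in \<Omega>. norm (min 2 (K' * \<bar>Z n x - Y x\<bar>)) \<le> 2" for n
      by (auto simp: K'_def)
  qed auto
  then have lim0: "(\<lambda>n. expectation (\<lambda>x. min 2 (K' * \<bar>Z n x - Y x\<bar>))) \<longlonglongrightarrow> 0" by simp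
  show ?thesis
  proof (rule uniform_limitI)
    fix e :: real assume "e > 0"
    with lim0 have "eventually (\<lambda>n. expectation (\<lambda>x. min 2 (K' * \<bar>Z n x - Y x\<bar>)) < e) sequentially"
      by (rule order_tendstoD)
    then show "\<forall>\<^sub>F n in sequentially. \<forall>x\<in>{- K..K}. dist (char (\<mu> n) x) (char M x) < e"
      by eventually_elim (use bound in \<open>fastforce simp: dist_norm intro: le_less_trans\<close>)
  qed
qed

text \<open>The mass of \<open>{x}\<close> is at most the integral of \<open>exp (- (T * (y - x))\<^sup>2 / 2)\<close>, which by Fubini is
  a Gaussian average of the characteristic function at scale \<open>T\<close>; let \<open>T\<close> tend to infinity.\<close>

lemma (in real_distribution) measure_singleton_eq_0:
  assumes lim: "(char M \<longlongrightarrow> 0) at_infinity"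
  shows "measure M {x} = 0"
proof -
  let ?N = std_normal_distribution
  interpret N: real_distribution ?N by (rule real_dist_normal_dist)
  interpret P: pair_prob_space M ?N ..
  have le: "measure M {x} \<le> (\<integral>z. norm (char M (real n * z)) \<partial>?N)" for n
  proof -
    let ?T = "real n"
    have ig: "integrable M (\<lambda>y. exp (- (?T * (y - x))\<^sup>2 / 2))"
      by (rule integrable_const_bound[of _ 1]) auto
    have "measure M {x} = (\<integral>y. indicator {x} y \<partial>M)" by simp
    also have "\<dots> \<le> (\<integral>y. exp (- (?T * (y - x))\<^sup>2 / 2) \<partial>M)"
    proof (rule integral_mono[OF _ ig])
      show "integrable M (indicator {x} :: real \<Rightarrow> real)"
        by (rule integrable_real_indicator) (auto simp: emeasure_eq_measure)
    qed (simp add: indicator_def)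
    also have "\<dots> = Re (\<integral>y. complex_of_real (exp (- (?T * (y - x))\<^sup>2 / 2)) \<partial>M)"
      by (simp add: integral_complex_of_real)
    also have "(\<integral>y. complex_of_real (exp (- (?T * (y - x))\<^sup>2 / 2)) \<partial>M)
        = (\<integral>y. (\<integral>z. iexp (?T * (y - x) * z) \<partial>?N) \<partial>M)"
    proof (rule Bochner_Integration.integral_cong[OF refl])
      fix y
      have "(\<integral>z. iexp (?T * (y - x) * z) \<partial>?N) = char ?N (?T * (y - x))" by (simp add: char_def)
      then show "complex_of_real (exp (- (?T * (y - x))\<^sup>2 / 2)) = (\<integral>z. iexp (?T * (y - x) * z) \<partial>?N)"
        by (simp add: char_std_normal_distribution)
    qed
    also have "\<dots> = (\<integral>z. (\<integral>y. iexp (?T * (y - x) * z) \<partial>M) \<partial>?N)"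
    proof (rule P.Fubini_integral[symmetric])
      show "integrable (M \<Otimes>\<^sub>M ?N) (\<lambda>(y, z). iexp (?T * (y - x) * z))"
        by (rule P.P.integrable_const_bound[of _ 1]) (auto simp: split_beta')
    qed
    also have "\<dots> = (\<integral>z. iexp (- ?T * x * z) * char M (?T * z) \<partial>?N)"
    proof (rule Bochner_Integration.integral_cong[OF refl])
      fix z
      have "(\<integral>y. iexp (?T * (y - x) * z) \<partial>M) = (\<integral>y. iexp (- ?T * x * z) * iexp (?T * z * y) \<partial>M)"
        by (intro Bochner_Integration.integral_cong refl) (simp add: exp_add[symmetric] algebra_simps)
      then show "(\<integral>y. iexp (?T * (y - x) * z) \<partial>M) = iexp (- ?T * x * z) * char M (?T * z)"
        by (simp add: char_def)
    qed
    also have "Re \<dots> \<le> norm \<dots>" by (rule complex_Re_le_cmod)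
    also have "\<dots> \<le> (\<integral>z. norm (iexp (- ?T * x * z) * char M (?T * z)) \<partial>?N)"
      by (rule integral_norm_bound)
    finally show ?thesis by (simp add: norm_mult)
  qed
  have "(\<lambda>n. \<integral>z. norm (char M (real n * z)) \<partial>?N) \<longlonglongrightarrow> (\<integral>z. 0 \<partial>?N)"
  proof (rule integral_dominated_convergence[where w="\<lambda>_. 1"])
    have "AE z in lborel. z \<noteq> (0::real)" by (rule AE_lborel_singleton)
    then have "AE z in ?N. z \<noteq> 0" by (subst AE_density) auto
    then show "AE z in ?N. (\<lambda>n. norm (char M (real n * z))) \<longlonglongrightarrow> 0"
    proof eventually_elim
      case (elim z)
      have "filterlim (\<lambda>n. real n * z) at_infinity sequentially"
        using tendsto_mult_filterlim_at_infinity[OF tendsto_const elim tendsto_of_nat]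
        by (simp add: mult.commute)
      then have "(\<lambda>n. char M (real n * z)) \<longlonglongrightarrow> 0" by (rule filterlim_compose[OF lim])
      then show ?case by (rule tendsto_norm_zero)
    qed
  qed (auto simp: cmod_char_le_1)
  then have "measure M {x} \<le> 0" using le by (intro LIMSEQ_le_const) auto
  then show ?thesis using measure_nonneg[of M "{x}"] by linarith
qed

section \<open>Norming sequences\<close>

text \<open>The hypotheses are those satisfied by the characteristic function \<open>\<phi>\<close> of a summand, a
  norming sequence \<open>a\<close> and the exponent \<open>\<Lambda>\<close> of the limiting stable law.\<close>

locale norming =
  fixes \<phi> :: "real \<Rightarrow> complex" and a :: "nat \<Rightarrow> real" and \<Lambda> :: "real \<Rightarrow> complex" and \<alpha> :: real
  assumes \<alpha>_pos: "0 < \<alpha>"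
    and \<phi>_cont: "\<And>s. isCont \<phi> s" and \<phi>_0: "\<phi> 0 = 1" and \<phi>_le_1: "\<And>s. norm (\<phi> s) \<le> 1"
    and a_pos: "\<And>n. 1 \<le> n \<Longrightarrow> 0 < a n"
    and \<Lambda>_cont: "continuous_on UNIV \<Lambda>"
    and Re_\<Lambda>: "\<And>u. Re (\<Lambda> u) = Re (\<Lambda> 1) * \<bar>u\<bar> powr \<alpha>" and Re_\<Lambda>_pos: "0 < Re (\<Lambda> 1)"
    and norm_\<Lambda>: "\<And>u. norm (\<Lambda> u) = norm (\<Lambda> 1) * \<bar>u\<bar> powr \<alpha>"
    and power_lim: "\<And>K. uniform_limit {-K..K} (\<lambda>n u. \<phi> (u / a n) ^ n) (\<lambda>u. exp (- \<Lambda> u)) sequentially"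
begin

lemma \<Lambda>_0: "\<Lambda> 0 = 0"
  using norm_\<Lambda>[of 0] by simp

lemma norm_\<Lambda>_1_pos: "0 < norm (\<Lambda> 1)"
  using Re_\<Lambda>_pos by auto

lemma norm_exp_\<Lambda>: "norm (exp (- \<Lambda> u)) = exp (- Re (\<Lambda> 1) * \<bar>u\<bar> powr \<alpha>)"
  using Re_\<Lambda>[of u] by simp

lemma norm_exp_\<Lambda>_ge:
  assumes "\<bar>u\<bar> \<le> K"
  shows "exp (- Re (\<Lambda> 1) * K powr \<alpha>) \<le> norm (exp (- \<Lambda> u))"
  unfolding norm_exp_\<Lambda> using assms \<alpha>_pos Re_\<Lambda>_pos
  by (auto intro!: mult_left_mono powr_mono2)

text \<open>If \<open>a\<close> stayed below \<open>A\<close> along a subsequence, then \<open>norm (\<phi> u) ^ n\<close> would stay away from \<open>0\<close>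
  along it for every \<open>u\<close>, so that \<open>\<phi>\<close> would have modulus \<open>1\<close> everywhere; but the limit of the
  powers has modulus below \<open>1\<close>.\<close>

lemma a_at_top: "filterlim a at_top sequentially"
proof (rule ccontr)
  assume "\<not> ?thesis"
  then obtain A where "\<not> eventually (\<lambda>n. A \<le> a n) sequentially"
    unfolding filterlim_at_top by auto
  then have fr: "frequently (\<lambda>n. a n < A) sequentially"
    by (simp add: frequently_def not_less)
  have one: "norm (\<phi> u) = 1" for u
  proof (rule ccontr)
    assume "norm (\<phi> u) \<noteq> 1"
    then have lt: "norm (\<phi> u) < 1" using \<phi>_le_1[of u] by simp
    define K where "K = \<bar>u\<bar> * \<bar>A\<bar>"
    define c where "c = exp (- Re (\<Lambda> 1) * K powr \<alpha>)"
    have c: "c > 0" by (simp add: c_def)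
    have "eventually (\<lambda>n. \<forall>v\<in>{-K..K}. dist (\<phi> (v / a n) ^ n) (exp (- \<Lambda> v)) < c / 2) sequentially"
      using c by (intro uniform_limitD[OF power_lim]) auto
    moreover have "(\<lambda>n. norm (\<phi> u) ^ n) \<longlonglongrightarrow> 0" using lt by (intro LIMSEQ_power_zero) auto
    then have "eventually (\<lambda>n. norm (\<phi> u) ^ n < c / 2) sequentially"
      by (rule order_tendstoD) (use c in auto)
    ultimately have "eventually (\<lambda>n. \<not> a n < A) sequentially"
      using eventually_ge_at_top[of 1]
    proof eventually_elim
      case (elim n)
      show ?case
      proof
        assume A: "a n < A"
        have an: "a n > 0" using a_pos elim by simp
        have uK: "\<bar>u * a n\<bar> \<le> K"
          unfolding K_def abs_mult using A an by (intro mult_left_mono) auto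
        then have "dist (\<phi> u ^ n) (exp (- \<Lambda> (u * a n))) < c / 2"
          using elim(1)[rule_format, of "u * a n"] an by (auto simp: abs_le_iff)
        moreover have "c \<le> norm (exp (- \<Lambda> (u * a n)))"
          unfolding c_def by (rule norm_exp_\<Lambda>_ge[OF uK])
        ultimately have "norm (\<phi> u ^ n) > c / 2"
          unfolding dist_norm by norm
        with elim show False by (simp add: norm_power)
      qed
    qed
    with fr show False by (simp add: frequently_def)
  qed
  have "eventually (\<lambda>n. \<forall>v\<in>{-1..1}. dist (\<phi> (v / a n) ^ n) (exp (- \<Lambda> v)) < 1 - exp (- Re (\<Lambda> 1))) sequentially"
    using Re_\<Lambda>_pos by (intro uniform_limitD[OF power_lim]) auto
  then obtain n where "dist (\<phi> (1 / a n) ^ n) (exp (- \<Lambda> 1)) < 1 - exp (- Re (\<Lambda> 1))"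
    by (force simp: eventually_sequentially)
  moreover have "norm (\<phi> (1 / a n) ^ n) = 1" using one by (simp add: norm_power)
  moreover have "norm (exp (- \<Lambda> 1)) = exp (- Re (\<Lambda> 1))" by simp
  moreover have "norm (\<phi> (1 / a n) ^ n) \<le> norm (\<phi> (1 / a n) ^ n - exp (- \<Lambda> 1)) + norm (exp (- \<Lambda> 1))"
    using norm_triangle_ineq[of "\<phi> (1 / a n) ^ n - exp (- \<Lambda> 1)" "exp (- \<Lambda> 1)"] by simp
  ultimately show False unfolding dist_norm by linarith
qed

text \<open>Logarithms may be taken in the limit relation: the difference \<open>d\<close> between \<open>n * Ln (\<phi> (u / a n))\<close> and
  \<open>- \<Lambda> u\<close> is continuous along the segment from \<open>0\<close> to \<open>u\<close> and vanishes at \<open>0\<close>, while \<open>exp d\<close> is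
  close to \<open>1\<close>; so the imaginary part of \<open>d\<close> never reaches \<open>pi / 2\<close>, and \<open>d\<close> is the principal
  logarithm of a number close to \<open>1\<close>.\<close>

lemma Ln_lim:
  "uniform_limit {-K..K} (\<lambda>n u. of_nat n * Ln (\<phi> (u / a n))) (\<lambda>u. - \<Lambda> u) sequentially"
proof (rule uniform_limitI)
  fix e :: real assume e: "e > 0"
  define c where "c = exp (- Re (\<Lambda> 1) * K powr \<alpha>)"
  have c: "c > 0" by (simp add: c_def)
  \<comment> \<open>\<open>norm d \<le> 2 * norm (exp d - 1)\<close> for \<open>norm (exp d - 1) < 1/2\<close>; this explains both parts of \<open>r\<close>\<close>
  define r where "r = min (e / 2) (1 / 4)"
  have r: "r > 0" using e by (simp add: r_def)
  have "eventually (\<lambda>s. dist (\<phi> s) (\<phi> 0) < 1) (at 0)"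
    using \<phi>_cont[of 0] unfolding isCont_def by (rule tendstoD) simp
  then obtain \<eta> where \<eta>: "\<eta> > 0" "\<And>s. \<bar>s\<bar> < \<eta> \<Longrightarrow> dist (\<phi> s) 1 < 1"
    unfolding eventually_at using \<phi>_0 by (auto simp: dist_real_def) (metis dist_self zero_less_one)
  have "eventually (\<lambda>n. \<forall>v\<in>{-K..K}. dist (\<phi> (v / a n) ^ n) (exp (- \<Lambda> v)) < c * r) sequentially"
    using c r by (intro uniform_limitD[OF power_lim]) auto
  moreover have "eventually (\<lambda>n. a n > K / \<eta>) sequentially"
    using a_at_top by (simp add: filterlim_at_top_dense)
  ultimately show "\<forall>\<^sub>F n in sequentially. \<forall>u\<in>{- K..K}. dist (of_nat n * Ln (\<phi> (u / a n))) (- \<Lambda> u) < e"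
    using eventually_ge_at_top[of 1]
  proof eventually_elim
    case (elim n)
    have an: "a n > 0" using a_pos elim by simp
    show ?case
    proof
      fix u assume u: "u \<in> {-K..K}"
      define d where "d x = of_nat n * Ln (\<phi> (x * u / a n)) + \<Lambda> (x * u)" for x :: real
      have xu: "\<bar>x * u\<bar> \<le> K" if "x \<in> {0..1}" for x
      proof -
        have "\<bar>x\<bar> * \<bar>u\<bar> \<le> 1 * \<bar>u\<bar>" using that by (intro mult_right_mono) auto
        moreover have "\<bar>u\<bar> \<le> K" using u by (auto simp: abs_le_iff)
        ultimately show ?thesis by (simp add: abs_mult)
      qed
      have near: "dist (\<phi> (x * u / a n)) 1 < 1" if "x \<in> {0..1}" for x
      proof (rule \<eta>(2))
        have "\<bar>x * u\<bar> < \<eta> * a n" using xu[OF that] elim(2) \<eta>(1) by (simp add: field_simps)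
        then show "\<bar>x * u / a n\<bar> < \<eta>" using an by (simp add: abs_divide divide_simps)
      qed
      have Re_pos: "Re (\<phi> (x * u / a n)) > 0" if "x \<in> {0..1}" for x
        using near[OF that] complex_Re_le_cmod[of "1 - \<phi> (x * u / a n)"]
        by (simp add: dist_norm norm_minus_commute)
      have cont: "continuous_on {0..1} d"
      proof -
        have "continuous_on UNIV \<phi>" using \<phi>_cont by (simp add: continuous_on_eq_continuous_at)
        then have "continuous_on {0..1} (\<lambda>x. \<phi> (x * u / a n))"
          by (rule continuous_on_compose2) (use an in \<open>auto intro!: continuous_intros\<close>)
        moreover have "continuous_on {0..1} (\<lambda>x. \<Lambda> (x * u))"
          by (rule continuous_on_compose2[OF \<Lambda>_cont]) (auto intro!: continuous_intros)
        ultimately show ?thesis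
          unfolding d_def
        proof (intro continuous_intros continuous_on_Ln)
          fix x :: real assume "x \<in> {0..1}"
          then show "\<phi> (x * u / a n) \<notin> \<real>\<^sub>\<le>\<^sub>0"
            using Re_pos[of x] by (auto simp: complex_nonpos_Reals_iff)
        qed
      qed
      have ed: "norm (exp (d x) - 1) < r" if x: "x \<in> {0..1}" for x
      proof -
        have "\<phi> (x * u / a n) \<noteq> 0" using Re_pos[OF x] by auto
        then have "exp (d x) - 1 = (\<phi> (x * u / a n) ^ n - exp (- \<Lambda> (x * u))) * exp (\<Lambda> (x * u))"
          unfolding d_def by (simp add: exp_add exp_of_nat_mult algebra_simps exp_minus)
        moreover have "norm (exp (\<Lambda> (x * u))) = 1 / norm (exp (- \<Lambda> (x * u)))"
          by (simp only: exp_minus norm_inverse) (simp add: exp_minus[symmetric] divide_inverse)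
        ultimately have "norm (exp (d x) - 1) = norm (\<phi> (x * u / a n) ^ n - exp (- \<Lambda> (x * u))) / norm (exp (- \<Lambda> (x * u)))"
          by (simp only: norm_mult) simp
        also have "\<dots> \<le> norm (\<phi> (x * u / a n) ^ n - exp (- \<Lambda> (x * u))) / c"
          unfolding c_def using xu[OF x] by (intro divide_left_mono norm_exp_\<Lambda>_ge mult_pos_pos) auto
        also have "\<dots> < c * r / c"
          using elim(1)[rule_format, of "x * u"] xu[OF x] c
          by (intro divide_strict_right_mono) (auto simp: dist_norm abs_le_iff)
        finally show ?thesis using c by simp
      qed
      have Im: "\<bar>Im (d 1)\<bar> < pi / 2"
      proof (rule ccontr)
        assume "\<not> ?thesis"
        moreover have "d 0 = 0" by (simp add: d_def \<phi>_0 \<Lambda>_0)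
        ultimately have "\<exists>x. 0 \<le> x \<and> x \<le> 1 \<and> \<bar>Im (d x)\<bar> = pi / 2"
          using cont by (intro IVT') (auto intro!: continuous_on_rabs continuous_on_Im)
        then obtain x where x: "x \<in> {0..1}" "\<bar>Im (d x)\<bar> = pi / 2" by auto
        then have "Im (d x) = pi / 2 \<or> Im (d x) = - (pi / 2)" by linarith
        then have "cos (Im (d x)) = 0" by (elim disjE) (simp_all only: cos_minus cos_pi_half)
        then have "Re (exp (d x)) = 0" by (simp add: Re_exp)
        then have "norm (exp (d x) - 1) \<ge> 1"
          using abs_Re_le_cmod[of "exp (d x) - 1"] by simp
        with ed[OF x(1)] show False by (simp add: r_def)
      qed
      then have "d 1 = Ln (exp (d 1))" using pi_gt_zero by (intro Ln_exp[symmetric]; linarith)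
      also have "\<dots> = Ln (1 + (exp (d 1) - 1))" by simp
      also have "norm \<dots> \<le> 2 * norm (exp (d 1) - 1)"
        using ed[of 1] by (intro norm_Ln_le) (simp add: r_def)
      also have "\<dots> < 2 * r" using ed[of 1] by simp
      also have "\<dots> \<le> e" by (simp add: r_def)
      finally show "dist (of_nat n * Ln (\<phi> (u / a n))) (- \<Lambda> u) < e"
        by (simp add: d_def dist_norm)
    qed
  qed
qed

lemma norm_Ln_lim:
  "uniform_limit {0..K} (\<lambda>n v. real n * norm (Ln (\<phi> (v / a n)))) (\<lambda>v. norm (\<Lambda> 1) * v powr \<alpha>) sequentially"
proof -
  have "uniform_limit {0..K} (\<lambda>n v. of_nat n * Ln (\<phi> (v / a n))) (\<lambda>u. - \<Lambda> u) sequentially"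
    by (rule uniform_limit_on_subset[OF Ln_lim[of K]]) auto
  then have "uniform_limit {0..K} (\<lambda>n v. norm (of_nat n * Ln (\<phi> (v / a n)))) (\<lambda>u. norm (- \<Lambda> u)) sequentially"
    by (rule uniform_limit_norm)
  moreover have "uniform_limit {0..K} (\<lambda>n v. norm (of_nat n * Ln (\<phi> (v / a n)))) (\<lambda>u. norm (- \<Lambda> u)) sequentially
    \<longleftrightarrow> ?thesis"
  proof (rule uniform_limit_cong')
    fix v assume "v \<in> {0..K}"
    then show "norm (- \<Lambda> v) = norm (\<Lambda> 1) * v powr \<alpha>" by (simp add: norm_\<Lambda>[of v])
  qed (simp add: norm_mult)
  ultimately show ?thesis by simp
qed

text \<open>Were \<open>a l\<close> larger than \<open>\<rho> * a n\<close>, then \<open>1 / a l\<close> would be \<open>v / a n\<close> with \<open>v < 1 / \<rho>\<close>, and the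
  limit relations for \<open>l\<close> and for \<open>n\<close> would give contradictory sizes for \<open>Ln (\<phi> (1 / a l))\<close>.\<close>

lemma eventually_a_le:
  assumes \<theta>: "0 < \<theta>" and \<rho>: "0 < \<rho>" "\<theta> < \<rho> powr \<alpha>"
  shows "\<exists>N0\<ge>1. \<forall>l\<ge>N0. \<forall>n\<ge>N0. real l \<le> \<theta> * real n \<longrightarrow> a l \<le> \<rho> * a n"
proof -
  define c where "c = norm (\<Lambda> 1)"
  have c: "c > 0" using norm_\<Lambda>_1_pos by (simp add: c_def)
  define G where "G s = norm (Ln (\<phi> s))" for s
  define q where "q = \<theta> * (1 / \<rho>) powr \<alpha>"
  have q: "q < 1" using \<rho> by (simp add: q_def powr_divide)
  \<comment> \<open>a tolerance for which \<open>c - e \<le> \<theta> * (c * (1 / \<rho>) powr \<alpha> + e)\<close> is impossible\<close>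
  define e where "e = c * (1 - q) / (2 * (1 + \<theta>))"
  have e: "e > 0" using c q \<theta> by (simp add: e_def)
  have "(1 + \<theta>) * e = c * (1 - q) / 2" 
  proof -
    have "1 + \<theta> \<noteq> 0" using \<theta> by linarith
    then have "(1 + \<theta>) * (x / (2 * (1 + \<theta>))) = x / 2" for x by (simp add: divide_simps)
    then show ?thesis by (simp only: e_def)
  qed
  moreover have "c * (1 - q) > 0" using c q by simp
  ultimately have e2: "(1 + \<theta>) * e < c * (1 - q)" by linarith
  define K where "K = max 1 (1 / \<rho>)"
  have "eventually (\<lambda>n. \<forall>v\<in>{0..K}. dist (real n * G (v / a n)) (c * v powr \<alpha>) < e) sequentially"
    unfolding G_def c_def by (rule uniform_limitD[OF norm_Ln_lim e])
  then obtain N where N: "\<And>n v. n \<ge> N \<Longrightarrow> v \<in> {0..K} \<Longrightarrow> \<bar>real n * G (v / a n) - c * v powr \<alpha>\<bar> < e"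
    unfolding eventually_sequentially dist_real_def by blast
  have "a l \<le> \<rho> * a n" if ln: "l \<ge> max 1 N" "n \<ge> max 1 N" "real l \<le> \<theta> * real n" for l n
  proof (rule ccontr)
    assume gt: "\<not> a l \<le> \<rho> * a n"
    have pos: "a l > 0" "a n > 0" using ln by (auto intro: a_pos)
    define v where "v = a n / a l"
    have v: "0 \<le> v" "v \<le> 1 / \<rho>" using gt pos \<rho> by (auto simp: v_def field_simps)
    have "v / a n = 1 / a l" using pos by (simp add: v_def)
    then have "real n * G (1 / a l) \<le> c * v powr \<alpha> + e"
      using N[of n v] ln v by (auto simp: K_def le_max_iff_disj)
    also have "\<dots> \<le> c * (1 / \<rho>) powr \<alpha> + e"
      using v c \<alpha>_pos by (intro add_right_mono mult_left_mono powr_mono2) auto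
    finally have 1: "real n * G (1 / a l) \<le> c * (1 / \<rho>) powr \<alpha> + e" .
    have "c - e < real l * G (1 / a l)"
      using N[of l 1] ln by (auto simp: K_def)
    also have "\<dots> \<le> \<theta> * real n * G (1 / a l)"
      using ln by (intro mult_right_mono) (auto simp: G_def)
    also have "\<dots> \<le> \<theta> * (c * (1 / \<rho>) powr \<alpha> + e)"
      using mult_left_mono[OF 1, of \<theta>] \<theta> by (simp add: mult.assoc)
    also have "\<dots> = c * q + \<theta> * e" by (simp add: q_def algebra_simps)
    finally show False using e2 by (simp add: algebra_simps)
  qed
  then show ?thesis by (intro exI[of _ "max 1 N"]) auto
qed

lemma dyadic_block:
  assumes "1 \<le> l" "l \<le> (n::nat)"
  obtains j where "2 ^ j * l \<le> n" "n < 2 ^ (j + 1) * l"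
proof -
  have "1 \<le> n div l" using assms by (simp add: div_greater_zero_iff Suc_le_eq)
  then obtain j where j: "2 ^ j \<le> n div l" "n div l < 2 ^ (j + 1)"
    using ex_power_ivl1[of 2 "n div l"] by auto
  have "2 ^ j * l \<le> n div l * l" using j by (intro mult_right_mono) auto
  also have "\<dots> \<le> n" by simp
  finally have 1: "2 ^ j * l \<le> n" .
  have "n < 2 ^ (j + 1) * l" using j assms by (simp add: div_less_iff_less_mult)
  with 1 show ?thesis using that by blast
qed

text \<open>Doubling the index multiplies \<open>a\<close> by at least \<open>2 powr \<beta>\<close> from some index on; iterate along
  \<open>l, 2 l, 4 l, \<dots>\<close> up to the last of these numbers that does not exceed \<open>n\<close>.\<close>

lemma potter_lower:
  assumes \<beta>: "0 < \<beta>" "\<beta> * \<alpha> < 1"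
  obtains C where "C > 0" "\<And>l n. 1 \<le> l \<Longrightarrow> l \<le> n \<Longrightarrow> a l \<le> C * (real l / real n) powr \<beta> * a n"
proof -
  have "2 powr (-1) < (2::real) powr (- \<beta> * \<alpha>)" using \<beta> by (intro powr_less_mono) auto
  then have "1 / 2 < (2 powr (-\<beta>)) powr \<alpha>" 
    by (simp only: powr_powr) (simp add: powr_minus_divide)
  with eventually_a_le[of "1/2" "2 powr (-\<beta>)"] obtain N1 where
    N1: "\<And>l n. l \<ge> N1 \<Longrightarrow> n \<ge> N1 \<Longrightarrow> real l \<le> 1 / 2 * real n \<Longrightarrow> a l \<le> 2 powr (-\<beta>) * a n"
    by (metis half_gt_zero powr_gt_zero zero_less_numeral zero_less_one zero_neq_numeral)
  have "1 < 2 powr \<alpha>" using \<alpha>_pos by (simp add: gr_one_powr)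
  with eventually_a_le[of 1 2] obtain N2 where
    N2: "\<And>l n. l \<ge> N2 \<Longrightarrow> n \<ge> N2 \<Longrightarrow> real l \<le> real n \<Longrightarrow> a l \<le> 2 * a n"
    by (metis mult_1 zero_less_numeral zero_less_one)
  define N where "N = max 1 (max N1 N2)"
  have N: "N \<ge> 1" "N \<ge> N1" "N \<ge> N2" by (auto simp: N_def)
  define C1 where "C1 = 2 * 2 powr \<beta>"
  have large: "a l \<le> C1 * (real l / real n) powr \<beta> * a n" if ln: "N \<le> l" "l \<le> n" for l n
  proof -
    have l1: "l \<ge> 1" using ln N by simp
    obtain j where j: "2 ^ j * l \<le> n" "n < 2 ^ (j + 1) * l"
      using dyadic_block[OF l1 ln(2)] by blast
    have dy: "a l \<le> (2 powr (-\<beta>)) ^ i * a (2 ^ i * l)" for i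
    proof (induction i)
      case (Suc i)
      have "l \<le> 2 ^ i * l" "l \<le> 2 ^ Suc i * l" by simp_all
      moreover have "real (2 ^ i * l) \<le> 1 / 2 * real (2 ^ Suc i * l)" by simp
      ultimately have "a (2 ^ i * l) \<le> 2 powr (-\<beta>) * a (2 ^ Suc i * l)"
        using ln N by (intro N1; linarith)
      then have "(2 powr (-\<beta>)) ^ i * a (2 ^ i * l) \<le> (2 powr (-\<beta>)) ^ i * (2 powr (-\<beta>) * a (2 ^ Suc i * l))"
        by (intro mult_left_mono) auto
      with Suc show ?case by (simp only: power_Suc mult_ac)
    qed simp
    have "a (2 ^ j * l) \<le> 2 * a n"
    proof (rule N2)
      have "l \<le> 2 ^ j * l" by simp
      then show "N2 \<le> 2 ^ j * l" using that N by linarith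
    qed (use j that N in \<open>auto simp del: of_nat_mult\<close>)
    then have "a l \<le> (2 powr (-\<beta>)) ^ j * (2 * a n)"
      using dy[of j] by (smt (verit) mult_left_mono zero_le_power powr_ge_zero)
    moreover have "(2 powr (-\<beta>)) ^ j \<le> 2 powr \<beta> * (real l / real n) powr \<beta>"
    proof -
      have "real n \<le> real (2 ^ (j + 1) * l)" using j(2) by (simp only: of_nat_le_iff)
      then have "(1 / 2) ^ j \<le> 2 * (real l / real n)"
        using l1 ln by (simp add: divide_simps power_divide mult_ac)
      then have "((1 / 2) ^ j) powr \<beta> \<le> (2 * (real l / real n)) powr \<beta>"
        using \<beta> by (intro powr_mono2) auto
      also have "\<dots> = 2 powr \<beta> * (real l / real n) powr \<beta>" by (rule powr_mult)
      also have "((1 / 2) ^ j) powr \<beta> = (2 powr (-\<beta>)) ^ j"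
        by (simp add: powr_realpow[symmetric] powr_powr powr_divide powr_minus_divide mult.commute)
      finally show ?thesis .
    qed
    then have "(2 powr (-\<beta>)) ^ j * (2 * a n) \<le> 2 powr \<beta> * (real l / real n) powr \<beta> * (2 * a n)"
      using a_pos[of n] l1 that by (intro mult_right_mono) auto
    ultimately show ?thesis by (simp add: C1_def mult_ac)
  qed
  define A where "A = Max (a ` {1..N})"
  define m where "m = Min (a ` {1..N})"
  have Am: "a l \<le> A" "m \<le> a l" if "1 \<le> l" "l \<le> N" for l
    using that by (auto simp: A_def m_def)
  have m: "m > 0" unfolding m_def using N by (subst Min_gr_iff) (auto intro: a_pos)
  have A: "A > 0" using Am[of 1] N a_pos[of 1] by simp
  have C1: "C1 \<ge> 1" using \<beta> ge_one_powr_ge_zero[of 2 \<beta>] by (simp add: C1_def)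
  have Am1: "A / m \<ge> 1" using Am[of 1] N m by (simp add: divide_simps)
  \<comment> \<open>the factor \<open>A / m\<close> takes care of the finitely many indices below \<open>N\<close>\<close>
  define C where "C = C1 * (A / m) * real N powr \<beta>"
  have NB: "real N powr \<beta> \<ge> 1" using N \<beta> by (intro ge_one_powr_ge_zero) auto
  have "a l \<le> C * (real l / real n) powr \<beta> * a n" if ln: "1 \<le> l" "l \<le> n" for l n
  proof -
    have an: "a n > 0" using ln by (intro a_pos) auto
    consider "N \<le> l" | "l < N" "N \<le> n" | "n < N" using ln by linarith
    then show ?thesis
    proof cases
      case 1
      have "C1 * 1 * 1 \<le> C1 * (A / m) * real N powr \<beta>"
        using C1 NB Am1 A m by (intro mult_mono mult_nonneg_nonneg) auto
      then have "C1 * (real l / real n) powr \<beta> * a n \<le> C * (real l / real n) powr \<beta> * a n"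
        using an unfolding C_def by (intro mult_right_mono) auto
      with large[OF 1 ln(2)] show ?thesis by linarith
    next
      case 2
      have "a l \<le> A" using Am ln 2 by simp
      also have "A = A / m * m" using m by simp
      also have "\<dots> \<le> A / m * a N" using Am[of N] N A m by (intro mult_left_mono) auto
      also have "\<dots> \<le> A / m * (C1 * (real N / real n) powr \<beta> * a n)"
        using large[of N n] 2 A m by (intro mult_left_mono) auto
      also have "\<dots> \<le> A / m * (C1 * (real N * (real l / real n)) powr \<beta> * a n)"
      proof (intro mult_left_mono mult_right_mono powr_mono2)
        have "real N * 1 \<le> real N * real l" using ln by (intro mult_left_mono) auto
        then show "real N / real n \<le> real N * (real l / real n)" using ln by (simp add: divide_right_mono)
      qed (use \<beta> C1 A m an in auto)
      also have "\<dots> = C * (real l / real n) powr \<beta> * a n" using powr_mult[of "real N" "real l / real n" \<beta>] by (simp add: C_def)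
      finally show ?thesis .
    next
      case 3
      have "a l \<le> A" using Am ln 3 by simp
      also have "A = A / m * m" using m by simp
      also have "\<dots> \<le> A / m * a n" using Am[of n] 3 ln A m by (intro mult_left_mono) auto
      also have "\<dots> = C1 * 0 + 1 * (A / m) * 1 * a n" by simp
      also have "\<dots> \<le> C1 * (A / m) * (real N * (real l / real n)) powr \<beta> * a n"
      proof -
        have "real n * 1 \<le> real N * real l" using 3 ln by (intro mult_mono) auto
        then have "1 \<le> real N * (real l / real n)" using ln by (simp add: divide_simps)
        then have "1 \<le> (real N * (real l / real n)) powr \<beta>" using \<beta> by (intro ge_one_powr_ge_zero) auto
        then have "1 * (A / m) * 1 * a n \<le> C1 * (A / m) * (real N * (real l / real n)) powr \<beta> * a n"
          using C1 A m an by (intro mult_right_mono mult_mono) auto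
        then show ?thesis by simp
      qed
      also have "\<dots> = C * (real l / real n) powr \<beta> * a n" using powr_mult[of "real N" "real l / real n" \<beta>] by (simp add: C_def)
      finally show ?thesis .
    qed
  qed
  moreover have "C > 0" unfolding C_def using C1 A m N by (intro mult_pos_pos divide_pos_pos) auto
  ultimately show ?thesis using that by blast
qed

text \<open>The same iteration, with the upper bound \<open>2 powr g\<close> for the effect of doubling the index. The
  last clause controls a single step, and is used where the first \<open>l\<close> with \<open>a l\<close> above a given level
  must not overshoot it by more than a constant factor.\<close>

lemma potter_upper:
  assumes g: "1 < g * \<alpha>"
  obtains C N where "C > 0" "N \<ge> 1" "\<And>l n. N \<le> n \<Longrightarrow> n \<le> l \<Longrightarrow> a l \<le> C * (real l / real n) powr g * a n"
    "\<And>l. N \<le> l \<Longrightarrow> a (Suc l) \<le> C * a l"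
proof -
  have g0: "g > 0" using g \<alpha>_pos by (metis less_trans zero_less_mult_pos2 zero_less_one)
  have "2 powr 1 < (2::real) powr (g * \<alpha>)" using g by (intro powr_less_mono) auto
  then have "2 < (2 powr g) powr \<alpha>" by (simp add: powr_powr)
  with eventually_a_le[of 2 "2 powr g"] obtain N1 where
    N1: "\<And>l n. l \<ge> N1 \<Longrightarrow> n \<ge> N1 \<Longrightarrow> real l \<le> 2 * real n \<Longrightarrow> a l \<le> 2 powr g * a n" by auto
  have "1 < 2 powr \<alpha>" using \<alpha>_pos by (simp add: gr_one_powr)
  with eventually_a_le[of 1 2] obtain N2 where
    N2: "\<And>l n. l \<ge> N2 \<Longrightarrow> n \<ge> N2 \<Longrightarrow> real l \<le> real n \<Longrightarrow> a l \<le> 2 * a n"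
    by (metis mult_1 zero_less_numeral zero_less_one)
  define N where "N = max 1 (max N1 N2)"
  have N: "N \<ge> 1" "N \<ge> N1" "N \<ge> N2" by (auto simp: N_def)
  define C where "C = 2 * 2 powr g"
  have "a l \<le> C * (real l / real n) powr g * a n" if ln: "N \<le> n" "n \<le> l" for l n
  proof -
    have n1: "n \<ge> 1" using ln N by simp
    obtain j where j: "2 ^ j * n \<le> l" "l < 2 ^ (j + 1) * n"
      using dyadic_block[OF n1 ln(2)] by blast
    have dy: "a (2 ^ i * n) \<le> (2 powr g) ^ i * a n" for i
    proof (induction i)
      case (Suc i)
      have "n \<le> 2 ^ i * n" "n \<le> 2 ^ Suc i * n" by simp_all
      moreover have "real (2 ^ Suc i * n) \<le> 2 * real (2 ^ i * n)" by simp
      ultimately have "a (2 ^ Suc i * n) \<le> 2 powr g * a (2 ^ i * n)"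
        using ln N by (intro N1; linarith)
      also have "\<dots> \<le> 2 powr g * ((2 powr g) ^ i * a n)"
        using Suc by (intro mult_left_mono) auto
      finally show ?case by (simp add: mult_ac)
    qed simp
    have "a l \<le> 2 * a (2 ^ (j + 1) * n)"
    proof (rule N2)
      have "n \<le> 2 ^ (j + 1) * n" by simp
      then show "N2 \<le> 2 ^ (j + 1) * n" using that N by linarith
    qed (use j that N in \<open>auto simp del: of_nat_mult power_Suc simp: less_imp_le\<close>)
    also have "\<dots> \<le> 2 * ((2 powr g) ^ (j + 1) * a n)" using dy[of "j + 1"] by simp
    also have "\<dots> = C * (2 powr g) ^ j * a n" by (simp add: C_def)
    also have "(2 powr g) ^ j = (2 ^ j) powr g"
      by (simp add: powr_realpow[symmetric] powr_powr mult.commute)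
    also have "C * \<dots> * a n \<le> C * (real l / real n) powr g * a n"
    proof (intro mult_right_mono mult_left_mono powr_mono2)
      have "real (2 ^ j * n) \<le> real l" using j(1) by (simp only: of_nat_le_iff)
      then show "2 ^ j \<le> real l / real n" using n1 by (simp add: divide_simps)
    qed (use g0 a_pos[OF n1] in \<open>auto simp: C_def\<close>)
    finally show ?thesis .
  qed
  moreover have "a (Suc l) \<le> C * a l" if "N \<le> l" for l
  proof -
    have "a (Suc l) \<le> 2 powr g * a l" using that N by (intro N1) auto
    also have "\<dots> \<le> C * a l" using a_pos[of l] that N by (intro mult_right_mono) (auto simp: C_def)
    finally show ?thesis .
  qed
  moreover have "C > 0" by (simp add: C_def)
  ultimately show ?thesis using that N(1) by blast
qed

lemma a_le_powr:
  assumes g: "1 < g * \<alpha>"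
  obtains C where "C > 0" "\<And>n. 1 \<le> n \<Longrightarrow> a n \<le> C * real n powr g"
proof -
  have g0: "g > 0" using g \<alpha>_pos by (metis less_trans zero_less_mult_pos2 zero_less_one)
  obtain C N where C: "C > 0" "N \<ge> 1" "\<And>l n. N \<le> n \<Longrightarrow> n \<le> l \<Longrightarrow> a l \<le> C * (real l / real n) powr g * a n"
    using potter_upper[OF g] by metis
  define A where "A = Max (a ` {1..N})"
  have A: "a l \<le> A" if "1 \<le> l" "l \<le> N" for l using that by (auto simp: A_def)
  have A0: "A > 0" using A[of 1] C a_pos[of 1] by simp
  have "a n \<le> (C + 1) * A * real n powr g" if n: "1 \<le> n" for n
  proof (cases "n \<le> N")
    case True
    have "a n \<le> 1 * A * 1" using A True n by simp
    also have "\<dots> \<le> (C + 1) * A * real n powr g"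
      using C A0 n g0 by (intro mult_mono) (auto intro: ge_one_powr_ge_zero)
    finally show ?thesis .
  next
    case False
    then have "a n \<le> C * (real n / real N) powr g * a N" using C by auto
    also have "\<dots> \<le> (C + 1) * real n powr g * A"
    proof (intro mult_mono powr_mono2)
      show "real n / real N \<le> real n" using C n by (simp add: divide_simps mult_left_mono)
    qed (use C A[of N] g0 a_pos[of N] in auto)
    finally show ?thesis by (simp add: mult_ac)
  qed
  then show ?thesis using that[of "(C + 1) * A"] C A0 by auto
qed

text \<open>For \<open>0 < u \<le> 1\<close> pick the first \<open>l \<ge> n\<close> with \<open>a l \<ge> a n / u\<close>. Then \<open>u / a n = v / a l\<close> with \<open>v\<close>
  bounded, so \<open>l * norm (1 - \<phi> (u / a n))\<close> is bounded, and the growth of \<open>a\<close> bounds \<open>n / l\<close> by a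
  multiple of \<open>u powr g\<close>.\<close>

lemma one_minus_char_le:
  assumes g: "0 < g" "g < \<alpha>"
  obtains C where "C > 0"
    "\<And>n u. 1 \<le> n \<Longrightarrow> 0 < u \<Longrightarrow> u \<le> 1 \<Longrightarrow> real n * norm (1 - \<phi> (u / a n)) \<le> C * u powr g"
proof -
  have "1 < 1 / g * \<alpha>" using g by (simp add: divide_simps)
  then obtain C1 N1 where C1: "C1 > 0" "N1 \<ge> 1"
    "\<And>l n. N1 \<le> n \<Longrightarrow> n \<le> l \<Longrightarrow> a l \<le> C1 * (real l / real n) powr (1 / g) * a n"
    "\<And>l. N1 \<le> l \<Longrightarrow> a (Suc l) \<le> C1 * a l"
    using potter_upper[of "1 / g"] by metis
  define K where "K = max 1 C1"
  define C2 where "C2 = norm (\<Lambda> 1) * K powr \<alpha> + 1"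
  have C2: "C2 \<ge> 1" by (simp add: C2_def)
  have "eventually (\<lambda>n. \<forall>v\<in>{0..K}. dist (real n * norm (Ln (\<phi> (v / a n)))) (norm (\<Lambda> 1) * v powr \<alpha>) < 1) sequentially"
    by (rule uniform_limitD[OF norm_Ln_lim]) simp
  moreover have "eventually (\<lambda>n. \<forall>v\<in>{-K..K}. dist (\<phi> (v / a n) ^ n) (exp (- \<Lambda> v)) < exp (- Re (\<Lambda> 1) * K powr \<alpha>)) sequentially"
    by (rule uniform_limitD[OF power_lim]) simp
  moreover have "eventually (\<lambda>n. real n \<ge> C2) sequentially"
    using filterlim_real_sequentially by (simp add: filterlim_at_top)
  ultimately have "eventually (\<lambda>n. \<forall>v\<in>{0..K}. real n * norm (1 - \<phi> (v / a n)) \<le> 3 * C2) sequentially"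
    using eventually_ge_at_top[of 1]
  proof eventually_elim
    case (elim n)
    show ?case
    proof
      fix v assume v: "v \<in> {0..K}"
      define z where "z = Ln (\<phi> (v / a n))"
      have "\<phi> (v / a n) \<noteq> 0"
      proof
        assume "\<phi> (v / a n) = 0"
        then have "norm (exp (- \<Lambda> v)) < exp (- Re (\<Lambda> 1) * K powr \<alpha>)"
          using elim(2)[rule_format, of v] v elim(4) by (simp add: power_0_left dist_norm)
        then show False using norm_exp_\<Lambda>_ge[of v K] v by auto
      qed
      then have ez: "\<phi> (v / a n) = exp z" by (simp add: z_def)
      have "real n * norm z \<le> norm (\<Lambda> 1) * v powr \<alpha> + 1"
        using elim(1)[rule_format, of v] v by (simp add: dist_real_def z_def)
      also have "\<dots> \<le> C2"
        unfolding C2_def using v \<alpha>_pos by (intro add_right_mono mult_left_mono powr_mono2) auto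
      finally have nz: "real n * norm z \<le> C2" .
      then have "real n * norm z \<le> real n * 1" using elim(3) by simp
      then have z1: "norm z \<le> 1" using elim(4) by simp
      have "norm (exp z - exp 0) \<le> 3 * norm (z - 0)"
      proof (rule field_differentiable_bound[of "cball 0 1"])
        fix w :: complex assume "w \<in> cball 0 1"
        then have "exp (Re w) \<le> exp 1" using complex_Re_le_cmod[of w] by simp
        also have "exp 1 \<le> (3::real)" by (rule exp_le)
        finally show "norm (exp w) \<le> 3" by simp
      qed (use z1 in \<open>auto intro!: derivative_eq_intros\<close>)
      then have "norm (1 - \<phi> (v / a n)) \<le> norm z * 3" by (simp add: ez norm_minus_commute)
     
      then have "real n * norm (1 - \<phi> (v / a n)) \<le> real n * (norm z * 3)" by (intro mult_left_mono) auto
      also have "\<dots> \<le> 3 * C2" using nz by simp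
      finally show "real n * norm (1 - \<phi> (v / a n)) \<le> 3 * C2" .
    qed
  qed
  then obtain N2 where N2: "\<And>n v. n \<ge> N2 \<Longrightarrow> v \<in> {0..K} \<Longrightarrow> real n * norm (1 - \<phi> (v / a n)) \<le> 3 * C2"
    unfolding eventually_sequentially by blast
  define N where "N = max N1 N2"
  have N: "N \<ge> N1" "N \<ge> N2" "N \<ge> 1" using C1 by (auto simp: N_def)
  define C3 where "C3 = max 2 (3 * C2 * C1 powr g)"
  have large: "real n * norm (1 - \<phi> (u / a n)) \<le> C3 * u powr g" if n: "N \<le> n" and u: "0 < u" "u \<le> 1" for n u
  proof -
    have an: "a n > 0" using n N by (intro a_pos) auto
    have ex: "\<exists>l. n \<le> l \<and> a n / u \<le> a l"
      using a_at_top unfolding filterlim_at_top eventually_sequentially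
      by (meson le_cases order_trans)
    define l where "l = (LEAST l. n \<le> l \<and> a n / u \<le> a l)"
    have l: "n \<le> l" "a n / u \<le> a l" using LeastI_ex[OF ex] by (auto simp: l_def)
    have al: "a l > 0" using n N l by (intro a_pos) auto
    define v where "v = u * a l / a n"
    have vK: "v \<le> K"
    proof (cases "l = n")
      case True then show ?thesis using u an by (simp add: v_def K_def)
    next
      case False
      then obtain k where k: "l = Suc k" "n \<le> k" using l by (cases l) auto
      have "\<not> (n \<le> k \<and> a n / u \<le> a k)"
        using not_less_Least[of k "\<lambda>l. n \<le> l \<and> a n / u \<le> a l"] k unfolding l_def by simp
      then have "a k < a n / u" using k by simp
      moreover have "a l \<le> C1 * a k" unfolding k using k n N by (intro C1) auto
      ultimately have "a l \<le> C1 * (a n / u)" using C1(1) by (meson less_imp_le mult_left_mono order_trans)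
      then have "v \<le> C1" using u an by (simp add: v_def field_simps)
      then show ?thesis by (simp add: K_def)
    qed
    have "v / a l = u / a n" using al an by (simp add: v_def)
    moreover have "v \<ge> 0" using u al an by (simp add: v_def)
    ultimately have lb: "real l * norm (1 - \<phi> (u / a n)) \<le> 3 * C2"
      using N2[of l v] vK l n N by auto
    have nl: "real n > 0" "real l > 0" using n N l by auto
    have anu: "a n / u \<le> C1 * (real l / real n) powr (1 / g) * a n"
      using l C1(3)[of n l] n N by linarith
    then have "1 / u \<le> C1 * (real l / real n) powr (1 / g)"
    proof -
      have "1 / u * a n \<le> C1 * (real l / real n) powr (1 / g) * a n"
        using anu by simp
      then show ?thesis using an by (rule mult_right_le_imp_le)
    qed
    then have "(real n / real l) powr (1 / g) \<le> C1 * u"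
      using u nl by (simp add: powr_divide field_simps)
    then have "((real n / real l) powr (1 / g)) powr g \<le> (C1 * u) powr g"
      using g by (intro powr_mono2) auto
    then have nl2: "real n / real l \<le> C1 powr g * u powr g"
      using g nl C1 u by (simp add: powr_powr powr_mult)
    have "real n * norm (1 - \<phi> (u / a n)) = real n / real l * (real l * norm (1 - \<phi> (u / a n)))"
      using nl by simp
    also have "\<dots> \<le> C1 powr g * u powr g * (3 * C2)"
      using nl C2 by (intro mult_mono nl2 lb) auto
    also have "\<dots> = (3 * C2 * C1 powr g) * u powr g" by simp
    also have "\<dots> \<le> C3 * u powr g" by (intro mult_right_mono) (auto simp: C3_def)
    finally show ?thesis .
  qed
  define m where "m = Min (a ` {1..N})"
  have m: "m > 0" unfolding m_def using N by (subst Min_gr_iff) (auto intro: a_pos)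
  have ma: "m \<le> a l" if "1 \<le> l" "l \<le> N" for l using that by (auto simp: m_def)
  define C where "C = C3 * real N * (a N / m) powr g"
  have C3: "C3 \<ge> 2" by (simp add: C3_def)
  have aN: "a N > 0" using N a_pos by auto
  \<comment> \<open>for small \<open>n\<close> use the bound for the index \<open>N\<close> at the argument \<open>s * a N\<close>, where \<open>s = u / a n\<close>\<close>
  have small: "real n * norm (1 - \<phi> (u / a n)) \<le> C * u powr g" if n: "1 \<le> n" "n \<le> N" and u: "0 < u" "u \<le> 1" for n u
  proof -
    have an: "a n > 0" using n by (intro a_pos) auto
    define s where "s = u / a n"
    have s: "s > 0" using an u by (simp add: s_def)
    have "norm (1 - \<phi> s) \<le> C3 * (s * a N) powr g"
    proof (cases "s * a N \<le> 1")
      case True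
      have "1 * norm (1 - \<phi> s) \<le> real N * norm (1 - \<phi> s)" using N by (intro mult_right_mono) auto
      also have "\<dots> = real N * norm (1 - \<phi> ((s * a N) / a N))" using aN by simp
      also have "\<dots> \<le> C3 * (s * a N) powr g" using True s aN by (intro large) auto
      finally show ?thesis by simp
    next
      case False
      have "norm (1 - \<phi> s) \<le> norm (1::complex) + norm (\<phi> s)" by (rule norm_triangle_ineq4)
      also have "\<dots> \<le> 2 * 1" using \<phi>_le_1[of s] by simp
      also have "\<dots> \<le> C3 * (s * a N) powr g"
        using False C3 g by (intro mult_mono) (auto intro: ge_one_powr_ge_zero)
      finally show ?thesis .
    qed
    also have "\<dots> \<le> C3 * (u * (a N / m)) powr g"
    proof (intro mult_left_mono powr_mono2)
      show "s * a N \<le> u * (a N / m)"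
        using ma[OF n] m an u aN by (simp add: s_def field_simps mult_left_mono)
    qed (use g s aN C3 in auto)
    also have "\<dots> = C3 * (a N / m) powr g * u powr g" using powr_mult[of u "a N / m" g] u m aN by simp
    finally have "real n * norm (1 - \<phi> s) \<le> real N * (C3 * (a N / m) powr g * u powr g)"
      using n by (intro mult_mono) auto
    then show ?thesis by (simp add: s_def C_def mult_ac)
  qed
  have "C > 0" using C3 N m aN by (auto simp: C_def intro!: mult_pos_pos)
  moreover have "real n * norm (1 - \<phi> (u / a n)) \<le> (C + C3) * u powr g"
    if "1 \<le> n" and u: "0 < u" "u \<le> 1" for n u
  proof (cases "n \<le> N")
    case True
    have "C * u powr g \<le> (C + C3) * u powr g" using C3 by (intro mult_right_mono) auto
    with small[OF that(1) True u] show ?thesis by linarith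
  next
    case False
    have "C3 * u powr g \<le> (C + C3) * u powr g" using \<open>C > 0\<close> by (intro mult_right_mono) auto
    with large[of n u] False u show ?thesis by linarith
  qed
  ultimately show ?thesis using that[of "C + C3"] C3 by auto
qed

end

section \<open>The stable exponent\<close>

definition stable_exponent :: "real \<Rightarrow> real \<Rightarrow> complex" where
  "stable_exponent \<alpha> u =
     (if \<alpha> = 2 then complex_of_real (u\<^sup>2 / 2)
      else complex_of_real (\<bar>u\<bar> powr \<alpha>) * (1 - \<i> * complex_of_real (sgn u * tan (pi * \<alpha> / 2))))"

lemma stable_char_eq_exp: "stable_char \<alpha> u = exp (- stable_exponent \<alpha> u)"
  by (simp add: stable_char_def stable_exponent_def)

lemma abs_powr_2: "\<bar>u\<bar> powr 2 = (u::real)\<^sup>2"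
  by (cases "u = 0") (simp_all add: powr_numeral)

lemma Re_stable_exponent:
  "Re (stable_exponent \<alpha> u) = Re (stable_exponent \<alpha> 1) * \<bar>u\<bar> powr \<alpha>"
  by (simp add: stable_exponent_def abs_powr_2)

lemma Re_stable_exponent_1_pos: "0 < Re (stable_exponent \<alpha> 1)"
  by (simp add: stable_exponent_def)

lemma norm_stable_exponent:
  "norm (stable_exponent \<alpha> u) = norm (stable_exponent \<alpha> 1) * \<bar>u\<bar> powr \<alpha>"
proof (cases "\<alpha> = 2 \<or> u = 0")
  case True
  then show ?thesis by (auto simp: stable_exponent_def abs_powr_2 norm_divide norm_power)
next
  case False
  have "norm (1 - \<i> * complex_of_real (sgn u * c)) = norm (1 - \<i> * complex_of_real c)" for c
    using False by (cases "u > 0") (auto simp: cmod_def)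
  then show ?thesis using False by (simp add: stable_exponent_def norm_mult)
qed

lemma stable_exponent_scale:
  assumes "0 \<le> c"
  shows "stable_exponent \<alpha> (c * u) = complex_of_real (c powr \<alpha>) * stable_exponent \<alpha> u"
proof (cases "c = 0")
  case False
  then show ?thesis using assms
    by (auto simp: stable_exponent_def powr_numeral power_mult_distrib sgn_mult abs_mult powr_mult)
qed (simp add: stable_exponent_def)

lemma continuous_on_stable_exponent:
  assumes "0 < \<alpha>"
  shows "continuous_on UNIV (stable_exponent \<alpha>)"
proof (cases "\<alpha> = 2")
  case True
  then show ?thesis by (auto simp: stable_exponent_def[abs_def] intro!: continuous_intros)
next
  case False
  have "(max u 0) powr \<alpha> - (max (-u) 0) powr \<alpha> = \<bar>u\<bar> powr \<alpha> * sgn u" for u :: real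
    using assms by (cases u "0::real" rule: linorder_cases) auto
  then have *: "stable_exponent \<alpha> = (\<lambda>u. complex_of_real (\<bar>u\<bar> powr \<alpha>)
      - \<i> * complex_of_real (((max u 0) powr \<alpha> - (max (-u) 0) powr \<alpha>) * tan (pi * \<alpha> / 2)))"
    using False by (simp only: stable_exponent_def fun_eq_iff) (simp add: algebra_simps)
  show ?thesis
    unfolding * using assms by (intro continuous_intros continuous_on_powr') auto
qed

lemma stable_exponent_0: "stable_exponent \<alpha> 0 = 0"
  by (simp add: stable_exponent_def)

section \<open>Centred sums in the domain of attraction\<close>

locale attracted_sums = prob_space M
  for M :: "'a measure" +
  fixes X :: "nat \<Rightarrow> 'a \<Rightarrow> real" and a :: "nat \<Rightarrow> real" and L :: "real measure" and \<alpha> \<mu> :: real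
  assumes \<alpha>_gt_1: "1 < \<alpha>" and \<alpha>_le_2: "\<alpha> \<le> 2"
    and stable_L: "stable_law \<alpha> L"
    and iid_X: "iid M X"
    and X_pos: "\<And>n. n \<ge> 1 \<Longrightarrow> AE \<omega> in M. X n \<omega> > 0"
    and integrable_X1: "integrable M (X 1)" and mean_X1: "expectation (X 1) = \<mu>"
    and a_pos: "\<And>n. n \<ge> 1 \<Longrightarrow> a n > 0"
    and weak_conv: "weak_conv_m (\<lambda>n. distr M borel (\<lambda>\<omega>. (partial_sum X n \<omega> - \<mu> * real n) / a n)) L"
begin

abbreviation \<Lambda> :: "real \<Rightarrow> complex" where "\<Lambda> \<equiv> stable_exponent \<alpha>"

definition D :: "nat \<Rightarrow> 'a \<Rightarrow> real" where "D i \<omega> = X i \<omega> - \<mu>"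

definition S :: "nat \<Rightarrow> 'a \<Rightarrow> real" where "S n \<omega> = (\<Sum>i=1..n. D i \<omega>)"

definition \<phi> :: "real \<Rightarrow> complex" where "\<phi> = char (distr M borel (D 1))"

lemma indep_X: "indep_vars (\<lambda>_. borel) X {1..}"
  using iid_X by (simp add: iid_def)

lemma measurable_X: "i \<ge> 1 \<Longrightarrow> random_variable borel (X i)"
  using indep_X unfolding indep_vars_def2 by blast

lemma measurable_D: "i \<ge> 1 \<Longrightarrow> random_variable borel (D i)"
  unfolding D_def[abs_def] by (intro borel_measurable_diff measurable_X borel_measurable_const)

lemma measurable_sum_D: "I \<subseteq> {1..} \<Longrightarrow> random_variable borel (\<lambda>\<omega>. \<Sum>i\<in>I. w i * D i \<omega>)"
  by (intro borel_measurable_sum borel_measurable_times borel_measurable_const measurable_D) auto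

lemma measurable_S [measurable]: "random_variable borel (S n)"
  unfolding S_def[abs_def] by (intro borel_measurable_sum measurable_D) auto

lemma indep_D: "indep_vars (\<lambda>_. borel) D {1..}"
  unfolding D_def[abs_def] by (rule indep_vars_compose2[OF indep_X]) auto

lemma distr_X: "i \<ge> 1 \<Longrightarrow> distr M borel (X i) = distr M borel (X 1)"
  using iid_X unfolding iid_def by blast

lemma integrable_X:
  assumes "i \<ge> 1"
  shows "integrable M (X i)"
proof -
  have "integrable (distr M borel (X 1)) (\<lambda>x. x)"
    using integrable_X1 by (subst integrable_distr_eq) (auto intro: measurable_X)
  then have "integrable (distr M borel (X i)) (\<lambda>x. x)" unfolding distr_X[OF assms] .
  then show ?thesis using assms by (subst (asm) integrable_distr_eq) (auto intro: measurable_X)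
qed

lemma integrable_D: "i \<ge> 1 \<Longrightarrow> integrable M (D i)"
  unfolding D_def[abs_def] by (intro Bochner_Integration.integrable_diff integrable_X) auto

lemma integrable_sum_D: "I \<subseteq> {1..} \<Longrightarrow> integrable M (\<lambda>\<omega>. \<Sum>i\<in>I. D i \<omega>)"
  by (intro Bochner_Integration.integrable_sum integrable_D) auto

lemma integrable_S: "integrable M (S n)"
  unfolding S_def[abs_def] by (intro integrable_sum_D) auto

lemma S_eq: "S n \<omega> = partial_sum X n \<omega> - \<mu> * real n"
  by (simp add: S_def D_def partial_sum_def sum_subtractf)

lemma S_diff: "k \<le> l \<Longrightarrow> S l \<omega> - S k \<omega> = (\<Sum>i\<in>{k<..l}. D i \<omega>)"
  unfolding S_def by (subst sum_diff[symmetric]) (auto intro!: sum.cong)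

lemma char_scaled_D:
  assumes "i \<ge> 1"
  shows "char (distr M borel (\<lambda>\<omega>. w * D i \<omega>)) u = \<phi> (u * w)"
proof -
  have "distr M borel (D i) = distr (distr M borel (X i)) borel (\<lambda>x. x - \<mu>)"
    using measurable_X[OF assms] by (subst distr_distr) (auto simp: D_def[abs_def] comp_def)
  also have "\<dots> = distr (distr M borel (X 1)) borel (\<lambda>x. x - \<mu>)" using distr_X[OF assms] by simp
  also have "\<dots> = distr M borel (D 1)"
    using measurable_X[of 1] by (subst distr_distr) (auto simp: D_def[abs_def] comp_def)
  finally have "\<phi> (u * w) = char (distr M borel (D i)) (u * w)" by (simp add: \<phi>_def)
  then show ?thesis using measurable_D[OF assms]
    unfolding char_def by (subst (asm) integral_distr, simp, simp, subst integral_distr) (auto simp: mult.assoc)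
qed

lemma char_sum_D:
  assumes "I \<subseteq> {1..}"
  shows "char (distr M borel (\<lambda>\<omega>. \<Sum>i\<in>I. w i * D i \<omega>)) u = (\<Prod>i\<in>I. \<phi> (u * w i))"
proof -
  have "indep_vars (\<lambda>_. borel) (\<lambda>i \<omega>. w i * D i \<omega>) I"
    by (rule indep_vars_compose2[OF indep_vars_subset[OF indep_D assms]]) auto
  then have "char (distr M borel (\<lambda>\<omega>. \<Sum>i\<in>I. w i * D i \<omega>)) u
      = (\<Prod>i\<in>I. char (distr M borel (\<lambda>\<omega>. w i * D i \<omega>)) u)"
    by (rule char_distr_sum)
  also have "\<dots> = (\<Prod>i\<in>I. \<phi> (u * w i))"
    using assms by (intro prod.cong refl char_scaled_D) auto
  finally show ?thesis .
qed

lemma real_distribution_D: "real_distribution (distr M borel (D 1))"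
  by (intro real_distribution_distr measurable_D) simp

sublocale N: norming \<phi> a \<Lambda> \<alpha>
proof
  interpret d: real_distribution "distr M borel (D 1)" by (rule real_distribution_D)
  show "isCont \<phi> s" for s unfolding \<phi>_def by (rule d.isCont_char)
  show "\<phi> 0 = 1" unfolding \<phi>_def by (rule d.char_zero)
  show "norm (\<phi> s) \<le> 1" for s unfolding \<phi>_def by (rule d.cmod_char_le_1)
  fix K :: real
  have rd: "real_distribution (distr M borel (\<lambda>\<omega>. (partial_sum X n \<omega> - \<mu> * real n) / a n))" for n
    unfolding S_eq[symmetric] by (intro real_distribution_distr) simp
  have ch: "char (distr M borel (\<lambda>\<omega>. (partial_sum X n \<omega> - \<mu> * real n) / a n)) u = \<phi> (u / a n) ^ n" for n u
    using char_sum_D[of "{1..n}" "\<lambda>_. 1 / a n" u]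
    by (simp add: S_eq[symmetric] S_def sum_divide_distrib)
  have "uniform_limit {-K..K} (\<lambda>n. char (distr M borel (\<lambda>\<omega>. (partial_sum X n \<omega> - \<mu> * real n) / a n)))
      (char L) sequentially"
    using stable_L by (intro uniform_limit_char rd weak_conv) (simp add: stable_law_def)
  moreover have "char (distr M borel (\<lambda>\<omega>. (partial_sum X n \<omega> - \<mu> * real n) / a n)) = (\<lambda>u. \<phi> (u / a n) ^ n)" for n
    by (rule ext) (rule ch)
  moreover have "char L = (\<lambda>u. exp (- \<Lambda> u))"
    using stable_L by (auto simp: stable_law_def stable_char_eq_exp)
  ultimately show "uniform_limit {-K..K} (\<lambda>n u. \<phi> (u / a n) ^ n) (\<lambda>u. exp (- \<Lambda> u)) sequentially"
    by simp
qed (use \<alpha>_gt_1 a_pos in \<open>auto simp: Re_stable_exponent_1_pos intro!: continuous_on_stable_exponent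
      Re_stable_exponent norm_stable_exponent\<close>)

text \<open>The sum over \<open>I\<close> divided by \<open>a (card I)\<close> has characteristic function
  \<open>\<phi> (u / a n) ^ n\<close> with \<open>n = card I\<close>, and \<open>norm (1 - z ^ n) \<le> n * norm (1 - z)\<close> on the unit
  disc; so the bound for \<open>1 - \<phi>\<close> near \<open>0\<close> controls its moments of every order below \<open>\<alpha>\<close>.\<close>

lemma moment_sum_D:
  obtains p C where "1 < p" "p \<le> 2" "0 < C"
    "\<And>I. finite I \<Longrightarrow> I \<subseteq> {1..} \<Longrightarrow> I \<noteq> {} \<Longrightarrow>
      integrable M (\<lambda>\<omega>. \<bar>\<Sum>i\<in>I. D i \<omega>\<bar> powr p)"
    "\<And>I. finite I \<Longrightarrow> I \<subseteq> {1..} \<Longrightarrow> I \<noteq> {} \<Longrightarrow>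
      expectation (\<lambda>\<omega>. \<bar>\<Sum>i\<in>I. D i \<omega>\<bar> powr p) \<le> C * a (card I) powr p"
proof -
  \<comment> \<open>any numbers with \<open>1 < p < g < \<alpha>\<close> would do\<close>
  define p where "p = (2 + \<alpha>) / 3"
  define g where "g = (1 + 2 * \<alpha>) / 3"
  have p: "1 < p" "p \<le> 2" "p < g" "0 < g" "g < \<alpha>" using \<alpha>_gt_1 \<alpha>_le_2 by (auto simp: p_def g_def)
  obtain C where C: "C > 0"
    "\<And>n u. 1 \<le> n \<Longrightarrow> 0 < u \<Longrightarrow> u \<le> 1 \<Longrightarrow> real n * norm (1 - \<phi> (u / a n)) \<le> C * u powr g"
    using N.one_minus_char_le[OF p(4,5)] by blast
  define B where "B = moment_bound_const p g C"
  have B: "B > 0"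
    using p cos_1_less_1 by (auto simp: B_def moment_bound_const_def intro!: add_pos_nonneg mult_nonneg_nonneg)
  have "integrable M (\<lambda>\<omega>. \<bar>\<Sum>i\<in>I. D i \<omega>\<bar> powr p) \<and>
      expectation (\<lambda>\<omega>. \<bar>\<Sum>i\<in>I. D i \<omega>\<bar> powr p) \<le> B * a (card I) powr p"
    if I: "finite I" "I \<subseteq> {1..}" "I \<noteq> {}" for I
  proof -
    define n where "n = card I"
    have n: "n \<ge> 1" using I by (auto simp: n_def Suc_le_eq card_gt_0_iff)
    then have an: "a n > 0" by (rule a_pos)
    define Z where "Z \<omega> = (\<Sum>i\<in>I. 1 / a n * D i \<omega>)" for \<omega>
    have Z[measurable]: "random_variable borel Z" unfolding Z_def by (rule measurable_sum_D[OF I(2)])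
    have Zsum: "Z \<omega> = (\<Sum>i\<in>I. D i \<omega>) / a n" for \<omega> by (simp add: Z_def sum_divide_distrib)
    interpret d: real_distribution "distr M borel Z" by (intro real_distribution_distr) simp
    have "norm (1 - char (distr M borel Z) u) \<le> C * u powr g" if u: "0 < u" "u \<le> 1" for u
    proof -
      have "char (distr M borel Z) u = \<phi> (u / a n) ^ n"
        unfolding Z_def using char_sum_D[OF I(2), of "\<lambda>_. 1 / a n" u] by (simp add: n_def)
      then have "norm (1 - char (distr M borel Z) u) = norm (1 ^ n - \<phi> (u / a n) ^ n)" by simp
      also have "\<dots> \<le> real n * norm (1 - \<phi> (u / a n))"
        by (intro norm_power_diff N.\<phi>_le_1) auto
      also have "\<dots> \<le> C * u powr g" by (rule C(2)[OF n u])
      finally show ?thesis .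
    qed
    then have "integrable (distr M borel Z) (\<lambda>x. \<bar>x\<bar> powr p)"
      "integral\<^sup>L (distr M borel Z) (\<lambda>x. \<bar>x\<bar> powr p) \<le> B"
      unfolding B_def using d.moment_bound[of p g C] p by auto
    then have "integrable M (\<lambda>\<omega>. \<bar>Z \<omega>\<bar> powr p)" "expectation (\<lambda>\<omega>. \<bar>Z \<omega>\<bar> powr p) \<le> B"
      by (auto simp: integrable_distr_eq integral_distr)
    moreover have "\<bar>\<Sum>i\<in>I. D i \<omega>\<bar> powr p = a n powr p * \<bar>Z \<omega>\<bar> powr p" for \<omega>
      using an by (simp add: Zsum powr_mult[symmetric])
    ultimately show ?thesis
      using mult_left_mono[of "expectation (\<lambda>\<omega>. \<bar>Z \<omega>\<bar> powr p)" B "a n powr p"]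
      by (simp add: n_def mult.commute)
  qed
  then show ?thesis using that[of p B] p B by blast
qed

text \<open>The exponent \<open>1/4\<close> stands for any number in \<open>(0, 1 / \<alpha>)\<close>; since \<open>\<alpha> \<le> 2\<close> it serves for all \<open>\<alpha>\<close>.\<close>

lemma expectation_abs_sum_D_le:
  obtains C where "C > 0"
    "\<And>I n. finite I \<Longrightarrow> I \<subseteq> {1..} \<Longrightarrow> 1 \<le> n \<Longrightarrow> card I \<le> n \<Longrightarrow>
      expectation (\<lambda>\<omega>. \<bar>\<Sum>i\<in>I. D i \<omega>\<bar>) \<le> C * (real (card I) / real n) powr (1 / 4) * a n"
proof -
  obtain p C where C: "1 < p" "0 < C"
    "\<And>I. finite I \<Longrightarrow> I \<subseteq> {1..} \<Longrightarrow> I \<noteq> {} \<Longrightarrow> integrable M (\<lambda>\<omega>. \<bar>\<Sum>i\<in>I. D i \<omega>\<bar> powr p)"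
    "\<And>I. finite I \<Longrightarrow> I \<subseteq> {1..} \<Longrightarrow> I \<noteq> {} \<Longrightarrow>
      expectation (\<lambda>\<omega>. \<bar>\<Sum>i\<in>I. D i \<omega>\<bar> powr p) \<le> C * a (card I) powr p"
    using moment_sum_D by metis
  obtain C1 where C1: "C1 > 0" "\<And>l n. 1 \<le> l \<Longrightarrow> l \<le> n \<Longrightarrow> a l \<le> C1 * (real l / real n) powr (1 / 4) * a n"
    using N.potter_lower[of "1/4"] \<alpha>_le_2 by auto
  have "expectation (\<lambda>\<omega>. \<bar>\<Sum>i\<in>I. D i \<omega>\<bar>) \<le> (1 + C) * C1 * (real (card I) / real n) powr (1 / 4) * a n"
    if I: "finite I" "I \<subseteq> {1..}" and n: "1 \<le> n" "card I \<le> n" for I n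
  proof (cases "I = {}")
    case False
    define l where "l = card I"
    have l: "1 \<le> l" using I False by (auto simp: l_def Suc_le_eq card_gt_0_iff)
    have al: "a l > 0" by (rule a_pos[OF l])
    have i: "integrable M (\<lambda>\<omega>. \<bar>\<Sum>i\<in>I. D i \<omega>\<bar>)" by (intro integrable_abs integrable_sum_D I)
    have "expectation (\<lambda>\<omega>. \<bar>\<Sum>i\<in>I. D i \<omega>\<bar>)
        \<le> expectation (\<lambda>\<omega>. a l + a l powr (1 - p) * \<bar>\<Sum>i\<in>I. D i \<omega>\<bar> powr p)"
    proof (rule integral_mono[OF i])
      show "integrable M (\<lambda>\<omega>. a l + a l powr (1 - p) * \<bar>\<Sum>i\<in>I. D i \<omega>\<bar> powr p)"
        using C(3)[OF I False] by simp
      fix \<omega>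
      define z where "z = \<bar>\<Sum>i\<in>I. D i \<omega>\<bar>"
      show "\<bar>\<Sum>i\<in>I. D i \<omega>\<bar> \<le> a l + a l powr (1 - p) * \<bar>\<Sum>i\<in>I. D i \<omega>\<bar> powr p"
      proof (cases "z \<le> a l")
        case True
        have "z + 0 \<le> a l + a l powr (1 - p) * z powr p" using True by (intro add_mono) auto
        then show ?thesis by (simp add: z_def)
      next
        case False
        have "z = z powr (1 - p) * z powr p" using False al by (simp add: powr_add[symmetric])
        also have "\<dots> \<le> a l powr (1 - p) * z powr p"
          using False C(1) al by (intro mult_right_mono powr_mono2') auto
        also have "\<dots> \<le> a l + a l powr (1 - p) * z powr p" using al by simp
        finally show ?thesis by (simp add: z_def)
      qed
    qed
    also have "\<dots> = a l + a l powr (1 - p) * expectation (\<lambda>\<omega>. \<bar>\<Sum>i\<in>I. D i \<omega>\<bar> powr p)"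
      using C(3)[OF I False] prob_space by simp
    also have "\<dots> \<le> a l + a l powr (1 - p) * (C * a l powr p)"
      unfolding l_def by (intro add_left_mono mult_left_mono C(4) I False) auto
    also have "\<dots> = (1 + C) * a l"
    proof -
      have "a l powr (1 - p) * a l powr p = a l" using al by (simp add: powr_add[symmetric])
      then show ?thesis by (simp add: algebra_simps)
    qed
    also have "\<dots> \<le> (1 + C) * (C1 * (real l / real n) powr (1 / 4) * a n)"
      using C(2) C1(2)[OF l, of n] n by (intro mult_left_mono) (auto simp: l_def)
    finally show ?thesis by (simp add: l_def mult.assoc)
  qed (use C C1 n in simp)
  then show ?thesis using that[of "(1 + C) * C1"] C C1 by auto
qed

end

section \<open>Harmonically weighted sums of the centred walk\<close>

context attracted_sums
begin

text \<open>With \<open>m = [n t]\<close>, the linear part of the logarithm of \<open>sum_product X \<mu> a n t\<close>.\<close>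

definition T :: "nat \<Rightarrow> nat \<Rightarrow> 'a \<Rightarrow> real" where
  "T n m \<omega> = (\<Sum>k=1..m. S k \<omega> / real k) / a n"

text \<open>The part of \<open>T n m\<close> that depends only on the summands after time \<open>l\<close>.\<close>

definition T_after :: "nat \<Rightarrow> nat \<Rightarrow> nat \<Rightarrow> 'a \<Rightarrow> real" where
  "T_after l n m \<omega> = (\<Sum>k=1..m. (S k \<omega> - S (min k l) \<omega>) / real k) / a n"

lemma measurable_T [measurable]: "random_variable borel (T n m)"
  unfolding T_def[abs_def] by measurable

lemma measurable_T_after [measurable]: "random_variable borel (T_after l n m)"
  unfolding T_after_def[abs_def] by measurable

lemma integrable_T: "integrable M (T n m)"
  unfolding T_def[abs_def]
  by (intro integrable_divide Bochner_Integration.integrable_sum integrable_S)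

lemma integrable_T_minus_T_after: "integrable M (\<lambda>\<omega>. \<bar>T n m \<omega> - T_after l n m \<omega>\<bar>)"
  unfolding T_after_def
  by (intro integrable_abs Bochner_Integration.integrable_diff Bochner_Integration.integrable_sum
      integrable_divide integrable_S integrable_T)

lemma expectation_S_diff_le:
  obtains C where "C > 0"
    "\<And>k l n. k \<le> l \<Longrightarrow> l \<le> n \<Longrightarrow> 1 \<le> n \<Longrightarrow>
      expectation (\<lambda>\<omega>. \<bar>S l \<omega> - S k \<omega>\<bar>) \<le> C * (real (l - k) / real n) powr (1 / 4) * a n"
    "\<And>k n. k \<le> n \<Longrightarrow> 1 \<le> n \<Longrightarrow>
      expectation (\<lambda>\<omega>. \<bar>S k \<omega>\<bar>) \<le> C * (real k / real n) powr (1 / 4) * a n"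
proof -
  obtain C where C: "C > 0" "\<And>I n. finite I \<Longrightarrow> I \<subseteq> {1..} \<Longrightarrow> 1 \<le> n \<Longrightarrow> card I \<le> n \<Longrightarrow>
      expectation (\<lambda>\<omega>. \<bar>\<Sum>i\<in>I. D i \<omega>\<bar>) \<le> C * (real (card I) / real n) powr (1 / 4) * a n"
    using expectation_abs_sum_D_le by blast
  have 1: "expectation (\<lambda>\<omega>. \<bar>S l \<omega> - S k \<omega>\<bar>) \<le> C * (real (l - k) / real n) powr (1 / 4) * a n"
    if "k \<le> l" "l \<le> n" "1 \<le> n" for k l n
  proof -
    have "{k<..l} \<subseteq> {1..}" by auto
    then show ?thesis using C(2)[of "{k<..l}" n] that by (simp add: S_diff)
  qed
  have 2: "expectation (\<lambda>\<omega>. \<bar>S k \<omega>\<bar>) \<le> C * (real k / real n) powr (1 / 4) * a n"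
    if "k \<le> n" "1 \<le> n" for k n
    using C(2)[of "{1..k}" n] that by (auto simp: S_def)
  show ?thesis using that[OF C(1) 1 2] by blast
qed

text \<open>The difference is the weighted sum of \<open>S (min k l)\<close>, whose expected modulus is at most of order
  \<open>(min k l / n) powr (1/4) * a n\<close>; bounding \<open>min k l\<close> by the geometric mean of \<open>k\<close> and \<open>l\<close> makes the
  sum over \<open>k\<close> a plain sum of powers.\<close>

lemma expectation_T_minus_T_after_le:
  obtains C where "C > 0"
    "\<And>l n m. 1 \<le> l \<Longrightarrow> l \<le> n \<Longrightarrow> m \<le> n \<Longrightarrow>
      expectation (\<lambda>\<omega>. \<bar>T n m \<omega> - T_after l n m \<omega>\<bar>) \<le> C * (real l / real n) powr (1 / 8)"
proof -
  obtain C where C: "C > 0" "\<And>k n. k \<le> n \<Longrightarrow> 1 \<le> n \<Longrightarrow>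
      expectation (\<lambda>\<omega>. \<bar>S k \<omega>\<bar>) \<le> C * (real k / real n) powr (1 / 4) * a n"
    using expectation_S_diff_le by metis
  have "expectation (\<lambda>\<omega>. \<bar>T n m \<omega> - T_after l n m \<omega>\<bar>) \<le> 8 * C * (real l / real n) powr (1 / 8)"
    if l: "1 \<le> l" "l \<le> n" "m \<le> n" for l n m
  proof -
    have an: "a n > 0" using l by (intro a_pos) auto
    have eq: "T n m \<omega> - T_after l n m \<omega> = (\<Sum>k=1..m. S (min k l) \<omega> / real k) / a n" for \<omega>
      by (simp add: T_def T_after_def diff_divide_distrib[symmetric] sum_subtractf[symmetric])
    have "expectation (\<lambda>\<omega>. \<bar>T n m \<omega> - T_after l n m \<omega>\<bar>)
        \<le> expectation (\<lambda>\<omega>. (\<Sum>k=1..m. \<bar>S (min k l) \<omega>\<bar> / real k) / a n)"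
    proof (rule integral_mono[OF integrable_T_minus_T_after])
      show "integrable M (\<lambda>\<omega>. (\<Sum>k=1..m. \<bar>S (min k l) \<omega>\<bar> / real k) / a n)"
        by (intro integrable_divide Bochner_Integration.integrable_sum integrable_abs integrable_S)
      fix \<omega>
      have "\<bar>\<Sum>k=1..m. S (min k l) \<omega> / real k\<bar> \<le> (\<Sum>k=1..m. \<bar>S (min k l) \<omega>\<bar> / real k)"
        by (rule order_trans[OF sum_abs]) simp
      then show "\<bar>T n m \<omega> - T_after l n m \<omega>\<bar> \<le> (\<Sum>k=1..m. \<bar>S (min k l) \<omega>\<bar> / real k) / a n"
        unfolding eq using an by (simp add: abs_divide divide_right_mono)
    qed
    also have "\<dots> = (\<Sum>k=1..m. expectation (\<lambda>\<omega>. \<bar>S (min k l) \<omega>\<bar>) / real k) / a n"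
      by (simp add: integrable_S)
    also have "\<dots> \<le> (\<Sum>k=1..m. C * real l powr (1/8) * real n powr (-1/4) * a n * real k powr (1/8 - 1)) / a n"
    proof (intro divide_right_mono sum_mono)
      fix k assume k: "k \<in> {1..m}"
      have "expectation (\<lambda>\<omega>. \<bar>S (min k l) \<omega>\<bar>) \<le> C * (real (min k l) / real n) powr (1 / 4) * a n"
        using l by (intro C(2)) auto
      moreover have "(real (min k l) / real n) powr (1 / 4) = real (min k l) powr (1/8) * real (min k l) powr (1/8) * real n powr (-1/4)"
        by (simp add: powr_divide powr_add[symmetric] powr_minus_divide)
      moreover have "real (min k l) powr (1/8) * real (min k l) powr (1/8) \<le> real k powr (1/8) * real l powr (1/8)"
        by (intro mult_mono powr_mono2) auto
      then have "C * (real (min k l) powr (1/8) * real (min k l) powr (1/8) * real n powr (-1/4)) * a n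
          \<le> C * (real k powr (1/8) * real l powr (1/8) * real n powr (-1/4)) * a n"
        using an C by (intro mult_right_mono mult_left_mono) auto
      ultimately have "expectation (\<lambda>\<omega>. \<bar>S (min k l) \<omega>\<bar>) \<le> C * (real k powr (1/8) * real l powr (1/8) * real n powr (-1/4)) * a n"
        by simp
      then have "expectation (\<lambda>\<omega>. \<bar>S (min k l) \<omega>\<bar>) / real k \<le> C * (real k powr (1/8) * real l powr (1/8) * real n powr (-1/4)) * a n / real k"
        by (intro divide_right_mono) auto
      also have "\<dots> = C * real l powr (1/8) * real n powr (-1/4) * a n * real k powr (1/8 - 1)"
        unfolding powr_diff using k by simp
      finally show "expectation (\<lambda>\<omega>. \<bar>S (min k l) \<omega>\<bar>) / real k \<le> C * real l powr (1/8) * real n powr (-1/4) * a n * real k powr (1/8 - 1)" .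
    qed (use an in simp)
    also have "\<dots> \<le> C * real l powr (1/8) * real n powr (-1/4) * (\<Sum>k=1..m. real k powr (1/8 - 1))"
      unfolding sum_distrib_left[symmetric] using an by simp
    also have "\<dots> \<le> C * real l powr (1/8) * real n powr (-1/4) * (real n powr (1/8) / (1/8))"
    proof (rule mult_left_mono)
      have "(\<Sum>k=1..m. real k powr (1/8 - 1)) \<le> (\<Sum>k=1..n. real k powr (1/8 - 1))"
        using l by (intro sum_mono2) auto
      also have "\<dots> \<le> real n powr (1/8) / (1/8)" by (rule sum_powr_le) auto
      finally show "(\<Sum>k=1..m. real k powr (1/8 - 1)) \<le> real n powr (1/8) / (1/8)" .
    qed (use C in simp)
    also have "\<dots> = 8 * C * real l powr (1/8) * (real n powr (-1/4) * real n powr (1/8))" by simp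
    also have "real n powr (-1/4) * real n powr (1/8) = real n powr (-1/8)"
      by (simp add: powr_add[symmetric])
    also have "8 * C * real l powr (1/8) * real n powr (-1/8) = 8 * C * (real l / real n) powr (1 / 8)"
      by (simp add: powr_divide powr_minus_divide)
    finally show ?thesis .
  qed
  then show ?thesis using that[of "8 * C"] C by auto
qed

lemma indep_T_T_after:
  assumes "m \<le> l" "m' \<le> n'"
  shows "indep_var borel (T n m) borel (T_after l n' m')"
proof -
  define F where "F x = (\<Sum>k=1..m. (\<Sum>i=1..k. x i) / real k) / a n" for x :: "nat \<Rightarrow> real"
  define G where "G x = (\<Sum>k=1..m'. (\<Sum>i\<in>{l<..k}. x i) / real k) / a n'" for x :: "nat \<Rightarrow> real"
  have "indep_var (PiM {1..l} (\<lambda>_. borel)) (\<lambda>\<omega>. restrict (\<lambda>i. D i \<omega>) {1..l})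
      (PiM {l<..n'} (\<lambda>_. borel)) (\<lambda>\<omega>. restrict (\<lambda>i. D i \<omega>) {l<..n'})"
    by (rule indep_var_restrict[OF indep_D]) auto
  moreover have "F \<in> borel_measurable (PiM {1..l} (\<lambda>_. borel))"
    unfolding F_def using assms
    by (intro borel_measurable_divide borel_measurable_sum borel_measurable_const measurable_component_singleton) auto
  moreover have "G \<in> borel_measurable (PiM {l<..n'} (\<lambda>_. borel))"
    unfolding G_def using assms
    by (intro borel_measurable_divide borel_measurable_sum borel_measurable_const measurable_component_singleton) auto
  ultimately have "indep_var borel (F \<circ> (\<lambda>\<omega>. restrict (\<lambda>i. D i \<omega>) {1..l}))
      borel (G \<circ> (\<lambda>\<omega>. restrict (\<lambda>i. D i \<omega>) {l<..n'}))"
    by (rule indep_var_compose)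
  moreover have "F \<circ> (\<lambda>\<omega>. restrict (\<lambda>i. D i \<omega>) {1..l}) = T n m"
  proof
    fix \<omega>
    show "(F \<circ> (\<lambda>\<omega>. restrict (\<lambda>i. D i \<omega>) {1..l})) \<omega> = T n m \<omega>"
      unfolding F_def T_def S_def comp_def using assms
      by (intro arg_cong2[where f="(/)"] sum.cong refl) auto
  qed
  moreover have "G \<circ> (\<lambda>\<omega>. restrict (\<lambda>i. D i \<omega>) {l<..n'}) = T_after l n' m'"
  proof
    fix \<omega>
    have "(\<Sum>i\<in>{l<..k}. restrict (\<lambda>i. D i \<omega>) {l<..n'} i) = S k \<omega> - S (min k l) \<omega>" if "k \<in> {1..m'}" for k
    proof -
      have "S k \<omega> - S (min k l) \<omega> = (\<Sum>i\<in>{min k l<..k}. D i \<omega>)" by (rule S_diff) simp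
      also have "{min k l<..k} = {l<..k}" by auto
      also have "(\<Sum>i\<in>{l<..k}. D i \<omega>) = (\<Sum>i\<in>{l<..k}. restrict (\<lambda>i. D i \<omega>) {l<..n'} i)"
        using that assms by (intro sum.cong) auto
      finally show ?thesis by simp
    qed
    then show "(G \<circ> (\<lambda>\<omega>. restrict (\<lambda>i. D i \<omega>) {l<..n'})) \<omega> = T_after l n' m' \<omega>"
      by (simp add: G_def T_after_def)
  qed
  ultimately show ?thesis by simp
qed

text \<open>Since \<open>T_after l n (m n)\<close> is independent of \<open>T l (m l)\<close>, only the difference
  between \<open>T n (m n)\<close> and \<open>T_after l n (m n)\<close> contributes to the covariance.\<close>

lemma AE_log_avg_centred:
  fixes g :: "real \<Rightarrow> real" and m :: "nat \<Rightarrow> nat"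
  assumes m: "\<And>n. m n \<le> n" and g1: "\<And>x. \<bar>g x\<bar> \<le> 1" and lip: "\<And>x y. \<bar>g x - g y\<bar> \<le> K * \<bar>x - y\<bar>"
    and [measurable]: "g \<in> borel_measurable borel"
  shows "AE \<omega> in M. log_avg (\<lambda>n. g (T n (m n) \<omega>) - expectation (\<lambda>\<omega>. g (T n (m n) \<omega>))) \<longlonglongrightarrow> 0"
proof -
  define e where "e n = expectation (\<lambda>\<omega>. g (T n (m n) \<omega>))" for n
  define \<xi> where "\<xi> n \<omega> = g (T n (m n) \<omega>) - e n" for n \<omega>
  have K: "K \<ge> 0" using lip[of 0 1] by (smt (verit) abs_ge_zero mult_nonneg_nonneg mult_neg_pos)
  have ig: "integrable M (\<lambda>\<omega>. g (f \<omega>))" if [measurable]: "random_variable borel f" for f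
    by (rule integrable_const_bound[of _ 1]) (auto simp: g1)
  have e1: "\<bar>e n\<bar> \<le> 1" for n
  proof -
    have "\<bar>e n\<bar> \<le> expectation (\<lambda>\<omega>. \<bar>g (T n (m n) \<omega>)\<bar>)" unfolding e_def by (rule integral_abs_bound)
    also have "\<dots> \<le> expectation (\<lambda>\<omega>. 1)" by (intro integral_mono integrable_abs ig g1) auto
    finally show ?thesis using prob_space by simp
  qed
  have \<xi>2: "\<bar>\<xi> n \<omega>\<bar> \<le> 2" for n \<omega>
    using g1[of "T n (m n) \<omega>"] e1[of n] by (simp add: \<xi>_def)
  have [measurable]: "random_variable borel (\<xi> n)" for n unfolding \<xi>_def by measurable
  have i\<xi>: "integrable M (\<xi> n)" for n
    by (rule integrable_const_bound[of _ 2]) (auto simp: \<xi>2)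
  have E\<xi>: "expectation (\<xi> n) = 0" for n
    unfolding \<xi>_def using prob_space by (simp add: ig e_def)
  obtain C where C: "C > 0"
    "\<And>l n m. 1 \<le> l \<Longrightarrow> l \<le> n \<Longrightarrow> m \<le> n \<Longrightarrow>
      expectation (\<lambda>\<omega>. \<bar>T n m \<omega> - T_after l n m \<omega>\<bar>) \<le> C * (real l / real n) powr (1 / 8)"
    using expectation_T_minus_T_after_le by blast
  have "AE \<omega> in M. log_avg (\<lambda>n. \<xi> n \<omega>) \<longlonglongrightarrow> 0"
  proof (rule AE_log_avg_tendsto_0[of \<xi> 2 "1/8" "2 * K * C"])
    fix l n :: nat assume ln: "1 \<le> l" "l \<le> n"
    define U where "U = T_after l n (m n)"
    have [measurable]: "random_variable borel U" by (simp add: U_def)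
    define V where "V = T n (m n)"
    have [measurable]: "random_variable borel V" by (simp add: V_def)
    have iprod: "integrable M (\<lambda>\<omega>. \<xi> l \<omega> * h \<omega>)"
      if [measurable]: "random_variable borel h" and "\<And>\<omega>. \<bar>h \<omega>\<bar> \<le> 2" for h
    proof (rule integrable_const_bound[of _ "2 * 2"])
      show "AE \<omega> in M. norm (\<xi> l \<omega> * h \<omega>) \<le> 2 * 2"
        unfolding real_norm_def abs_mult by (intro AE_I2 mult_mono \<xi>2 that) auto
    qed measurable
    have ind: "indep_var borel (\<xi> l) borel (\<lambda>\<omega>. g (U \<omega>))"
    proof -
      have "indep_var borel ((\<lambda>x. g x - e l) \<circ> T l (m l)) borel (g \<circ> U)"
        unfolding U_def by (rule indep_var_compose[OF indep_T_T_after]) (auto simp: m)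
      then show ?thesis by (simp add: comp_def \<xi>_def[abs_def])
    qed
    have g2: "\<bar>g x\<bar> \<le> 2" for x using g1[of x] by simp
    have "expectation (\<lambda>\<omega>. \<xi> l \<omega> * g (U \<omega>)) = 0"
      using indep_var_lebesgue_integral[OF ind i\<xi> ig] E\<xi> by simp
    then have "expectation (\<lambda>\<omega>. \<xi> l \<omega> * \<xi> n \<omega>) = expectation (\<lambda>\<omega>. \<xi> l \<omega> * g (V \<omega>)) - e n * expectation (\<xi> l)
        - expectation (\<lambda>\<omega>. \<xi> l \<omega> * g (U \<omega>))"
      using iprod[of "\<lambda>\<omega>. g (V \<omega>)"] i\<xi> g2
      by (simp add: \<xi>_def[of n] V_def[symmetric] right_diff_distrib mult.commute[of _ "e n"])
    also have "\<dots> = expectation (\<lambda>\<omega>. \<xi> l \<omega> * (g (V \<omega>) - g (U \<omega>)))"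
      using iprod[of "\<lambda>\<omega>. g (V \<omega>)"] iprod[of "\<lambda>\<omega>. g (U \<omega>)"] g2
      by (simp add: E\<xi> right_diff_distrib)
    also have "\<bar>\<dots>\<bar> \<le> expectation (\<lambda>\<omega>. \<bar>\<xi> l \<omega> * (g (V \<omega>) - g (U \<omega>))\<bar>)"
      by (rule integral_abs_bound)
    also have "\<dots> \<le> expectation (\<lambda>\<omega>. 2 * K * \<bar>V \<omega> - U \<omega>\<bar>)"
    proof (rule integral_mono)
      show "integrable M (\<lambda>\<omega>. \<bar>\<xi> l \<omega> * (g (V \<omega>) - g (U \<omega>))\<bar>)"
      proof (intro integrable_abs iprod)
        fix \<omega> show "\<bar>g (V \<omega>) - g (U \<omega>)\<bar> \<le> 2"
          using g1[of "V \<omega>"] g1[of "U \<omega>"] by simp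
      qed measurable
      show "integrable M (\<lambda>\<omega>. 2 * K * \<bar>V \<omega> - U \<omega>\<bar>)"
        unfolding U_def V_def by (intro integrable_mult_right integrable_T_minus_T_after)
      fix \<omega>
      have "\<bar>\<xi> l \<omega> * (g (V \<omega>) - g (U \<omega>))\<bar> \<le> 2 * (K * \<bar>V \<omega> - U \<omega>\<bar>)"
        unfolding abs_mult by (intro mult_mono \<xi>2 lip) auto
      then show "\<bar>\<xi> l \<omega> * (g (V \<omega>) - g (U \<omega>))\<bar> \<le> 2 * K * \<bar>V \<omega> - U \<omega>\<bar>" by simp
    qed
    also have "\<dots> = 2 * K * expectation (\<lambda>\<omega>. \<bar>V \<omega> - U \<omega>\<bar>)" by simp
    also have "\<dots> \<le> 2 * K * (C * (real l / real n) powr (1 / 8))"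
      unfolding U_def V_def using K ln m by (intro mult_left_mono C(2)) auto
    finally show "\<bar>expectation (\<lambda>\<omega>. \<xi> l \<omega> * \<xi> n \<omega>)\<bar> \<le> 2 * K * C * (real l / real n) powr (1 / 8)" by simp
  qed (auto simp: \<xi>2)
  then show ?thesis by (simp add: \<xi>_def e_def)
qed

section \<open>Linearization of the logarithm of the product\<close>

text \<open>On \<open>[-3/4, 1]\<close> the error is quadratic, and a square is at most the \<open>p\<close>th power there; beyond \<open>1\<close> the
  error is at most \<open>x\<close>, which the \<open>p\<close>th power dominates as well.\<close>

lemma abs_ln_one_plus_minus_le:
  fixes x p :: real
  assumes x: "- 3 / 4 \<le> x" and p: "1 \<le> p" "p \<le> 2"
  shows "\<bar>ln (1 + x) - x\<bar> \<le> 4 * \<bar>x\<bar> powr p"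
proof -
  have up: "ln (1 + x) \<le> x" using x ln_add_one_self_le_self2[of x] by simp
  show ?thesis
  proof (cases "x \<le> 1")
    case True
    have "ln (1 / (1 + x)) \<le> 1 / (1 + x) - 1" using x by (intro ln_le_minus_one) auto
    then have "x - ln (1 + x) \<le> x + (1 / (1 + x) - 1)" using x by (simp add: ln_div)
    also have "\<dots> = x\<^sup>2 / (1 + x)" using x by (simp add: field_simps power2_eq_square)
    also have "\<dots> \<le> x\<^sup>2 / (1 / 4)" using x by (intro divide_left_mono) auto
    also have "\<dots> = 4 * \<bar>x\<bar> powr 2" by (simp add: abs_powr_2)
    also have "\<bar>x\<bar> powr 2 \<le> \<bar>x\<bar> powr p" using True x p by (intro powr_mono') auto
    finally show ?thesis using up by simp
  next
    case False
    have "x - ln (1 + x) \<le> x powr 1" using False by simp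
    also have "x powr 1 \<le> x powr p" using False p by (intro powr_mono) auto
    also have "\<dots> \<le> 4 * \<bar>x\<bar> powr p" using False by simp
    finally show ?thesis using up by simp
  qed
qed

lemma mean_pos: "\<mu> > 0"
proof -
  have nn: "AE \<omega> in M. 0 \<le> X 1 \<omega>" using X_pos[of 1] by (auto elim: eventually_mono)
  then have "\<mu> \<ge> 0" unfolding mean_X1[symmetric] by (rule integral_nonneg_AE)
  moreover have "\<mu> \<noteq> 0"
  proof
    assume "\<mu> = 0"
    then have "AE \<omega> in M. X 1 \<omega> = 0"
      using integral_nonneg_eq_0_iff_AE[OF integrable_X1 nn] mean_X1 by simp
    with X_pos[OF le_refl] have "AE \<omega> in M. False" by eventually_elim simp
    then show False by simp
  qed
  ultimately show ?thesis by simp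
qed

text \<open>Along powers of \<open>2\<close> the expected moduli of \<open>S k / k\<close> are summable, because \<open>a k\<close> grows
  like a power of exponent below \<open>1\<close>; positivity of the summands fills the gaps at the cost of a
  factor \<open>1/2\<close>.\<close>

lemma AE_eventually_partial_sum_ge:
  "AE \<omega> in M. \<exists>K. \<forall>k\<ge>K. \<mu> * real k / 4 \<le> partial_sum X k \<omega>"
proof -
  obtain C where C: "C > 0" "\<And>k n. k \<le> n \<Longrightarrow> 1 \<le> n \<Longrightarrow>
      expectation (\<lambda>\<omega>. \<bar>S k \<omega>\<bar>) \<le> C * (real k / real n) powr (1 / 4) * a n"
    using expectation_S_diff_le by metis
  define g where "g = (1 + 1 / \<alpha>) / 2"
  have g: "1 < g * \<alpha>" "g < 1" using \<alpha>_gt_1 by (auto simp: g_def field_simps)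
  obtain C2 where C2: "C2 > 0" "\<And>n. 1 \<le> n \<Longrightarrow> a n \<le> C2 * real n powr g"
    using N.a_le_powr[OF g(1)] by blast
  have "AE \<omega> in M. summable (\<lambda>i. \<bar>S (2 ^ i) \<omega>\<bar> / 2 ^ i)"
  proof (rule AE_summable_of_summable_expectation)
    show "integrable M (\<lambda>\<omega>. \<bar>S (2 ^ i) \<omega>\<bar> / 2 ^ i)" for i
      by (intro integrable_divide integrable_abs integrable_S)
    show "summable (\<lambda>i. expectation (\<lambda>\<omega>. \<bar>S (2 ^ i) \<omega>\<bar> / 2 ^ i))"
    proof (rule summable_comparison_test'[where N=0])
      have "(2::real) powr (g - 1) < 1" using g powr_less_mono[of "g - 1" 0 2] by simp
      then show "summable (\<lambda>i. C * C2 * (2 powr (g - 1)) ^ i)"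
        by (intro summable_mult summable_geometric) simp
      fix i :: nat
      have "expectation (\<lambda>\<omega>. \<bar>S (2 ^ i) \<omega>\<bar>) \<le> C * a (2 ^ i)" using C(2)[of "2 ^ i" "2 ^ i"] by simp
      also have "\<dots> \<le> C * (C2 * real (2 ^ i) powr g)" using C by (intro mult_left_mono C2) auto
      finally have "expectation (\<lambda>\<omega>. \<bar>S (2 ^ i) \<omega>\<bar>) / 2 ^ i \<le> C * (C2 * real (2 ^ i) powr g) / 2 ^ i"
        by (intro divide_right_mono) auto
      also have "\<dots> = C * C2 * (2 ^ i) powr (g - 1)" by (simp add: powr_diff)
      also have "((2::real) ^ i) powr (g - 1) = (2 powr (g - 1)) ^ i"
        by (simp add: powr_realpow[symmetric] powr_powr mult.commute)
      finally show "norm (expectation (\<lambda>\<omega>. \<bar>S (2 ^ i) \<omega>\<bar> / 2 ^ i)) \<le> C * C2 * (2 powr (g - 1)) ^ i"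
        by simp
    qed
  qed simp
  moreover have "AE \<omega> in M. \<forall>n\<in>{1..}. X n \<omega> > 0"
    by (subst AE_ball_countable) (auto intro: X_pos)
  ultimately show ?thesis
  proof eventually_elim
    case (elim \<omega>)
    have mono: "partial_sum X k \<omega> \<le> partial_sum X l \<omega>" if "k \<le> l" for k l
      unfolding partial_sum_def using that elim(2) by (intro sum_mono2) (auto intro: less_imp_le)
    have "(\<lambda>i. \<bar>S (2 ^ i) \<omega>\<bar> / 2 ^ i) \<longlonglongrightarrow> 0" using elim(1) by (rule summable_LIMSEQ_zero)
    then have "eventually (\<lambda>i. \<bar>S (2 ^ i) \<omega>\<bar> / 2 ^ i < \<mu> / 2) sequentially"
      by (rule order_tendstoD) (use mean_pos in simp)
    then obtain J where J: "\<And>i. i \<ge> J \<Longrightarrow> \<bar>S (2 ^ i) \<omega>\<bar> / 2 ^ i < \<mu> / 2"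
      by (auto simp: eventually_sequentially)
    have "\<mu> * real k / 4 \<le> partial_sum X k \<omega>" if k: "2 ^ J \<le> k" for k
    proof -
      have k1: "1 \<le> k" using k by (meson le_trans one_le_numeral one_le_power)
      obtain i where i: "2 ^ i * 1 \<le> k" "k < 2 ^ (i + 1) * 1"
        using N.dyadic_block[of 1 k] k1 by blast
      have "J \<le> i"
      proof (rule ccontr)
        assume "\<not> J \<le> i"
        then have "(2::nat) ^ (i + 1) \<le> 2 ^ J" by (intro power_increasing) auto
        with i k show False by simp
      qed
      then have "\<bar>S (2 ^ i) \<omega>\<bar> < \<mu> / 2 * 2 ^ i" using J[of i] by (simp add: field_simps)
      then have "\<mu> * 2 ^ i / 2 \<le> partial_sum X (2 ^ i) \<omega>"
        unfolding S_eq by (simp add: abs_if split: if_splits)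
      also have "\<dots> \<le> partial_sum X k \<omega>" using i by (intro mono) simp
      finally have "\<mu> * 2 ^ i / 2 \<le> partial_sum X k \<omega>" .
      moreover have "real k \<le> real (2 ^ (i + 1))" using i by (simp only: of_nat_le_iff)
      then have "\<mu> * real k \<le> \<mu> * 2 ^ (i + 1)" using mean_pos by (intro mult_left_mono) auto
      ultimately show ?thesis by simp
    qed
    then show ?case by blast
  qed
qed

text \<open>The error of the linearization: \<open>T n m + R n m\<close> is the logarithm of the normalized product.\<close>

definition R :: "nat \<Rightarrow> nat \<Rightarrow> 'a \<Rightarrow> real" where
  "R n m \<omega> = \<mu> / a n * (\<Sum>k=1..m. ln (partial_sum X k \<omega> / (\<mu> * real k)) - S k \<omega> / (\<mu> * real k))"

lemma sum_product_eq_exp: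
  assumes "1 \<le> n" "\<And>k. 1 \<le> k \<Longrightarrow> X k \<omega> > 0"
  shows "sum_product X \<mu> a n t \<omega> = exp (T n (nat \<lfloor>real n * t\<rfloor>) \<omega> + R n (nat \<lfloor>real n * t\<rfloor>) \<omega>)"
proof -
  define m where "m = nat \<lfloor>real n * t\<rfloor>"
  have pos: "partial_sum X k \<omega> / (\<mu> * real k) > 0" if "k \<in> {1..m}" for k
    using that mean_pos assms(2) unfolding partial_sum_def
    by (intro divide_pos_pos mult_pos_pos sum_pos) auto
  have "T n m \<omega> + R n m \<omega> = \<mu> / a n * (\<Sum>k=1..m. ln (partial_sum X k \<omega> / (\<mu> * real k)))"
    using mean_pos a_pos[OF assms(1)]
    by (simp add: T_def R_def sum_subtractf right_diff_distrib sum_distrib_left sum_divide_distrib mult.commute)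
  also have "(\<Sum>k=1..m. ln (partial_sum X k \<omega> / (\<mu> * real k))) = ln (\<Prod>k=1..m. partial_sum X k \<omega> / (\<mu> * real k))"
  proof (rule ln_prod[symmetric])
    fix i assume "i \<in> {1..m}"
    from pos[OF this] show "partial_sum X i \<omega> / (\<mu> * real i) \<noteq> 0" by (metis less_irrefl)
  qed simp
  finally have eq: "T n m \<omega> + R n m \<omega> = \<mu> / a n * ln (\<Prod>k=1..m. partial_sum X k \<omega> / (\<mu> * real k))" .
  have "(\<Prod>k=1..m. partial_sum X k \<omega> / (\<mu> * real k)) > 0" by (rule prod_pos) (use pos in blast)
  then have "(\<Prod>k=1..m. partial_sum X k \<omega> / (\<mu> * real k)) \<noteq> 0" by linarith
  then show ?thesis
    unfolding sum_product_def m_def[symmetric] eq powr_def by (simp only: if_False)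
qed

text \<open>By the previous bound the logarithm may be replaced by its linear part with an error of order
  \<open>\<bar>S k / k\<bar> powr p\<close>, and the expectations of the normalized sums of these errors decay
  like a power of \<open>n\<close>, which makes them summable with weights \<open>1 / n\<close>.\<close>

lemma AE_log_avg_R:
  assumes m: "\<And>n. m n \<le> n"
  shows "AE \<omega> in M. log_avg (\<lambda>n. \<bar>R n (m n) \<omega>\<bar>) \<longlonglongrightarrow> 0"
proof -
  obtain p C where C: "1 < p" "p \<le> 2" "0 < C"
    "\<And>I. finite I \<Longrightarrow> I \<subseteq> {1..} \<Longrightarrow> I \<noteq> {} \<Longrightarrow> integrable M (\<lambda>\<omega>. \<bar>\<Sum>i\<in>I. D i \<omega>\<bar> powr p)"
    "\<And>I. finite I \<Longrightarrow> I \<subseteq> {1..} \<Longrightarrow> I \<noteq> {} \<Longrightarrow>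
      expectation (\<lambda>\<omega>. \<bar>\<Sum>i\<in>I. D i \<omega>\<bar> powr p) \<le> C * a (card I) powr p"
    using moment_sum_D by metis
  obtain C1 where C1: "C1 > 0" "\<And>l n. 1 \<le> l \<Longrightarrow> l \<le> n \<Longrightarrow> a l \<le> C1 * (real l / real n) powr (1 / 4) * a n"
    using N.potter_lower[of "1/4"] \<alpha>_le_2 by auto
  define g where "g = (1 + 1 / \<alpha>) / 2"
  have g: "1 < g * \<alpha>" "g < 1" using \<alpha>_gt_1 by (auto simp: g_def field_simps)
  obtain C2 where C2: "C2 > 0" "\<And>n. 1 \<le> n \<Longrightarrow> a n \<le> C2 * real n powr g"
    using N.a_le_powr[OF g(1)] by blast
  \<comment> \<open>\<open>(a k / k) powr (p - 1)\<close> gives the decay \<open>k powr - ((1 - g) * (p - 1))\<close>; the cap at \<open>1/8\<close> keeps the exponents of the sum over \<open>k\<close> positive\<close>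
  define \<eta> where "\<eta> = min ((1 - g) * (p - 1)) (1 / 8)"
  have \<eta>: "\<eta> > 0" "\<eta> \<le> 1 / 8" "\<eta> \<le> (1 - g) * (p - 1)" using g C by (auto simp: \<eta>_def)
  define B where "B n \<omega> = (\<Sum>k=1..n. \<bar>S k \<omega>\<bar> powr p / real k powr p) / a n" for n \<omega>
  have iS: "integrable M (\<lambda>\<omega>. \<bar>S k \<omega>\<bar> powr p)" if "k \<ge> 1" for k
    unfolding S_def using that by (intro C(4)) auto
  have ES: "expectation (\<lambda>\<omega>. \<bar>S k \<omega>\<bar> powr p) \<le> C * a k powr p" if "k \<ge> 1" for k
    unfolding S_def using that C(5)[of "{1..k}"] by auto
  have iB: "integrable M (B n)" for n
    unfolding B_def[abs_def] by (intro integrable_divide Bochner_Integration.integrable_sum iS) auto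
  define C3 where "C3 = C * C2 powr (p - 1) * C1 * 8"
  have EB: "expectation (B n) \<le> C3 * real n powr (-\<eta>)" if n: "n \<ge> 1" for n
  proof -
    have an: "a n > 0" by (rule a_pos[OF n])
    have "expectation (B n) = (\<Sum>k=1..n. expectation (\<lambda>\<omega>. \<bar>S k \<omega>\<bar> powr p) / real k powr p) / a n"
      unfolding B_def[abs_def]
      by (simp, subst Bochner_Integration.integral_sum) (auto intro!: integrable_divide iS)
    also have "\<dots> \<le> (\<Sum>k=1..n. C * C2 powr (p - 1) * C1 * real n powr (-1/4) * a n * real k powr (1/4 - \<eta> - 1)) / a n"
    proof (intro divide_right_mono sum_mono)
      fix k assume "k \<in> {1..n}"
      then have k: "1 \<le> k" "k \<le> n" by auto
      have ak: "a k > 0" by (rule a_pos[OF k(1)])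
      have "expectation (\<lambda>\<omega>. \<bar>S k \<omega>\<bar> powr p) \<le> C * (a k powr (p - 1) * a k)"
        using ES[OF k(1)] ak by (simp add: powr_diff)
      also have "\<dots> \<le> C * ((C2 * real k powr g) powr (p - 1) * (C1 * (real k / real n) powr (1 / 4) * a n))"
        using C(1,3) ak C2 C1 k
        by (intro mult_left_mono mult_mono powr_mono2) auto
      also have "\<dots> = C * C2 powr (p - 1) * C1 * real n powr (-1/4) * a n * (real k powr (g * (p - 1)) * real k powr (1/4))"
        by (simp add: powr_mult powr_powr powr_divide powr_minus_divide)
      finally have "expectation (\<lambda>\<omega>. \<bar>S k \<omega>\<bar> powr p) / real k powr p
        \<le> C * C2 powr (p - 1) * C1 * real n powr (-1/4) * a n * (real k powr (g * (p - 1)) * real k powr (1/4)) / real k powr p"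
        by (intro divide_right_mono) auto
      also have "\<dots> = C * C2 powr (p - 1) * C1 * real n powr (-1/4) * a n * real k powr (g * (p - 1) + 1/4 - p)"
        using k by (simp add: powr_diff powr_add)
      also have "\<dots> \<le> C * C2 powr (p - 1) * C1 * real n powr (-1/4) * a n * real k powr (1/4 - \<eta> - 1)"
        using C C1 an k \<eta>(3) by (intro mult_left_mono powr_mono) (auto simp: algebra_simps)
      finally show "expectation (\<lambda>\<omega>. \<bar>S k \<omega>\<bar> powr p) / real k powr p
        \<le> C * C2 powr (p - 1) * C1 * real n powr (-1/4) * a n * real k powr (1/4 - \<eta> - 1)" .
    qed (use an in simp)
    also have "\<dots> = C * C2 powr (p - 1) * C1 * real n powr (-1/4) * (\<Sum>k=1..n. real k powr (1/4 - \<eta> - 1))"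
      unfolding sum_distrib_left[symmetric] using an by simp
    also have "\<dots> \<le> C * C2 powr (p - 1) * C1 * real n powr (-1/4) * (real n powr (1/4 - \<eta>) / (1/4 - \<eta>))"
      using C C1 \<eta> by (intro mult_left_mono sum_powr_le) auto
    also have "\<dots> \<le> C * C2 powr (p - 1) * C1 * real n powr (-1/4) * (real n powr (1/4 - \<eta>) / (1/8))"
      using C C1 \<eta> by (intro mult_left_mono divide_left_mono) auto
    also have "\<dots> = C3 * (real n powr (-1/4) * real n powr (1/4 - \<eta>))" by (simp add: C3_def)
    also have "real n powr (-1/4) * real n powr (1/4 - \<eta>) = real n powr (-\<eta>)"
      by (simp add: powr_add[symmetric])
    finally show ?thesis .
  qed
  have B0: "B n \<omega> \<ge> 0" if "n \<ge> 1" for n \<omega>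
    using a_pos[OF that] by (auto simp: B_def intro!: divide_nonneg_pos sum_nonneg)
  have "AE \<omega> in M. summable (\<lambda>n. B n \<omega> / real n)"
  proof (rule AE_summable_of_summable_expectation)
    show "integrable M (\<lambda>\<omega>. B n \<omega> / real n)" for n by (intro integrable_divide iB)
    show "AE \<omega> in M. 0 \<le> B n \<omega> / real n" for n
      using B0[of n] by (cases "n = 0") auto
    show "summable (\<lambda>n. expectation (\<lambda>\<omega>. B n \<omega> / real n))"
    proof (rule summable_comparison_test'[where N=1])
      show "summable (\<lambda>n. C3 * real n powr (-1 - \<eta>))"
        using \<eta> by (intro summable_mult) (simp add: summable_real_powr_iff)
      fix n :: nat assume n: "1 \<le> n"
      have "expectation (\<lambda>\<omega>. B n \<omega> / real n) \<le> C3 * real n powr (-\<eta>) / real n"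
        using EB[OF n] by (simp add: divide_right_mono)
      also have "\<dots> = C3 * real n powr (-1 - \<eta>)" using n by (simp add: powr_diff powr_minus field_simps)
      finally have "expectation (\<lambda>\<omega>. B n \<omega> / real n) \<le> C3 * real n powr (-1 - \<eta>)" .
      moreover have "0 \<le> expectation (\<lambda>\<omega>. B n \<omega> / real n)"
        by (intro Bochner_Integration.integral_nonneg divide_nonneg_nonneg B0[OF n]) auto
      ultimately show "norm (expectation (\<lambda>\<omega>. B n \<omega> / real n)) \<le> C3 * real n powr (-1 - \<eta>)" by simp
    qed
  qed
  with AE_eventually_partial_sum_ge show ?thesis
  proof eventually_elim
    case (elim \<omega>)
    define y where "y k = ln (partial_sum X k \<omega> / (\<mu> * real k)) - S k \<omega> / (\<mu> * real k)" for k
    obtain K where K: "\<And>k. k \<ge> K \<Longrightarrow> \<mu> * real k / 4 \<le> partial_sum X k \<omega>" using elim(1) by blast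
    define c where "c = (\<Sum>k<K. \<bar>y k\<bar>)"
    define b where "b = 4 / \<mu> powr p"
    have yk: "\<bar>y k\<bar> \<le> b * (\<bar>S k \<omega>\<bar> powr p / real k powr p)" if k: "K \<le> k" "1 \<le> k" for k
    proof -
      define x where "x = S k \<omega> / (\<mu> * real k)"
      have mk: "\<mu> * real k > 0" using mean_pos k by simp
      have "partial_sum X k \<omega> / (\<mu> * real k) = 1 + x"
        using mk mean_pos k unfolding x_def S_eq by (simp add: field_simps)
      moreover have "- 3 / 4 \<le> x"
        using K[OF k(1)] mk unfolding x_def S_eq by (simp add: field_simps)
      ultimately have "\<bar>y k\<bar> \<le> 4 * \<bar>x\<bar> powr p"
        unfolding y_def x_def[symmetric] using abs_ln_one_plus_minus_le[of x p] C by simp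
      also have "\<dots> = b * (\<bar>S k \<omega>\<bar> powr p / real k powr p)"
        using mean_pos by (simp add: x_def b_def abs_divide abs_mult powr_divide powr_mult)
      finally show ?thesis .
    qed
    have bound: "\<bar>R n (m n) \<omega>\<bar> \<le> \<mu> * c / a n + \<mu> * b * B n \<omega>" if n: "1 \<le> n" for n
    proof -
      have an: "a n > 0" by (rule a_pos[OF n])
      have b0: "b \<ge> 0" by (simp add: b_def)
      have "\<bar>\<Sum>k=1..m n. y k\<bar> \<le> (\<Sum>k=1..m n. \<bar>y k\<bar>)" by (rule sum_abs)
      also have "\<dots> \<le> (\<Sum>k=1..n. \<bar>y k\<bar>)" using m[of n] by (intro sum_mono2) auto
      also have "\<dots> \<le> (\<Sum>k=1..n. (if k < K then \<bar>y k\<bar> else 0) + b * (\<bar>S k \<omega>\<bar> powr p / real k powr p))"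
        using yk b0 by (intro sum_mono) auto
      also have "\<dots> = (\<Sum>k\<in>{1..n} \<inter> {..<K}. \<bar>y k\<bar>) + b * (\<Sum>k=1..n. \<bar>S k \<omega>\<bar> powr p / real k powr p)"
        by (subst sum.inter_restrict) (simp_all add: sum.distrib sum_distrib_left)
      also have "(\<Sum>k\<in>{1..n} \<inter> {..<K}. \<bar>y k\<bar>) \<le> c"
        unfolding c_def by (intro sum_mono2) auto
      finally have "\<bar>\<Sum>k=1..m n. y k\<bar> \<le> c + b * (\<Sum>k=1..n. \<bar>S k \<omega>\<bar> powr p / real k powr p)" by simp
      then have "\<mu> / a n * \<bar>\<Sum>k=1..m n. y k\<bar> \<le> \<mu> / a n * (c + b * (\<Sum>k=1..n. \<bar>S k \<omega>\<bar> powr p / real k powr p))"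
        using mean_pos an by (intro mult_left_mono) auto
      then show ?thesis
        unfolding R_def y_def[symmetric] B_def using mean_pos an
        by (simp add: abs_mult abs_divide distrib_left)
    qed
    have "(\<lambda>n. \<mu> * c / a n) \<longlonglongrightarrow> 0"
      by (rule real_tendsto_divide_at_top[OF tendsto_const N.a_at_top])
    then have "log_avg (\<lambda>n. \<mu> * c / a n) \<longlonglongrightarrow> 0" by (rule log_avg_tendsto_0)
    moreover have "log_avg (\<lambda>n. B n \<omega>) \<longlonglongrightarrow> 0" using elim(2) by (rule log_avg_summable)
    ultimately have "(\<lambda>N. log_avg (\<lambda>n. \<mu> * c / a n) N + \<mu> * b * log_avg (\<lambda>n. B n \<omega>) N) \<longlonglongrightarrow> 0 + \<mu> * b * 0"
      by (intro tendsto_intros)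
    then have lim: "(\<lambda>N. log_avg (\<lambda>n. \<mu> * c / a n + \<mu> * b * B n \<omega>) N) \<longlonglongrightarrow> 0"
      by (simp add: log_avg_add log_avg_cmult)
    show ?case
    proof (rule tendsto_sandwich[OF _ _ tendsto_const lim])
      show "eventually (\<lambda>N. 0 \<le> log_avg (\<lambda>n. \<bar>R n (m n) \<omega>\<bar>) N) sequentially"
        by (intro always_eventually allI)
          (auto simp: log_avg_def intro!: divide_nonneg_pos sum_nonneg clog_pos)
      show "eventually (\<lambda>N. log_avg (\<lambda>n. \<bar>R n (m n) \<omega>\<bar>) N \<le> log_avg (\<lambda>n. \<mu> * c / a n + \<mu> * b * B n \<omega>) N) sequentially"
        by (intro always_eventually allI log_avg_mono bound)
    qed
  qed
qed

end

section \<open>Comparison with a fixed number of blocks\<close>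

text \<open>This bounds the expected change of \<open>Z k / k\<close> when \<open>k\<close> is moved to a grid point \<open>b\<close> at distance at
  most \<open>h\<close>, for a process \<open>Z\<close> whose increments over a distance \<open>x\<close> have first absolute moments of order
  \<open>x powr (2 * \<theta>)\<close>. Both terms lose half of the exponent so that the bound stays summable in \<open>k\<close> near \<open>0\<close>.\<close>

lemma increment_quotient_le:
  fixes k b h \<theta> :: real
  assumes "0 < k" "k \<le> b" "b - k \<le> h" "h \<le> b" "0 < h" "0 < \<theta>" "\<theta> \<le> 1"
  shows "(b - k) powr (2 * \<theta>) / b + k powr (2 * \<theta>) * (1 / k - 1 / b) \<le> 2 * (h powr \<theta> * k powr (\<theta> - 1))"
proof -
  have b: "b > 0" using assms by simp
  have "(b - k) powr (2 * \<theta>) / b \<le> h powr (2 * \<theta>) / b"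
    using assms b by (intro divide_right_mono powr_mono2) auto
  also have "h powr (2 * \<theta>) / b = h powr (2 * \<theta>) * (b powr (\<theta> - 1) * b powr (- \<theta>))"
    using b by (simp only: powr_add[symmetric]) (simp add: powr_minus_divide)
  also have "\<dots> \<le> h powr (2 * \<theta>) * (k powr (\<theta> - 1) * h powr (- \<theta>))"
    using assms by (intro mult_left_mono mult_mono powr_mono2') auto
  also have "\<dots> = (h powr (2 * \<theta>) * h powr (- \<theta>)) * k powr (\<theta> - 1)" by simp
  also have "h powr (2 * \<theta>) * h powr (- \<theta>) = h powr \<theta>" using assms by (simp add: powr_add[symmetric])
  finally have 1: "(b - k) powr (2 * \<theta>) / b \<le> h powr \<theta> * k powr (\<theta> - 1)" .
  have q: "(b - k) / b \<le> (h / k) powr \<theta>"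
  proof (cases "h \<le> k")
    case True
    have "(b - k) / b \<le> h / k" using assms by (intro frac_le) auto
    also have "\<dots> = (h / k) powr 1" using assms by simp
    also have "\<dots> \<le> (h / k) powr \<theta>" using True assms by (intro powr_mono') auto
    finally show ?thesis .
  next
    case False
    have "(b - k) / b \<le> 1" using assms b by (simp add: divide_simps)
    also have "\<dots> \<le> (h / k) powr \<theta>" using False assms by (intro ge_one_powr_ge_zero) auto
    finally show ?thesis .
  qed
  have "k powr (2 * \<theta>) * (1 / k - 1 / b) = k powr (2 * \<theta>) / k * ((b - k) / b)"
    using assms b by (simp add: field_simps)
  also have "\<dots> \<le> k powr (2 * \<theta>) / k * (h / k) powr \<theta>"
    using assms q by (intro mult_left_mono) auto
  also have "\<dots> = h powr \<theta> * (k powr (2 * \<theta>) * k powr (- 1) * k powr (- \<theta>))"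
    using assms by (simp add: powr_divide powr_minus_divide)
  also have "k powr (2 * \<theta>) * k powr (- 1) * k powr (- \<theta>) = k powr (\<theta> - 1)"
    by (simp only: powr_add[symmetric]) (simp add: algebra_simps)
  finally show ?thesis using 1 by simp
qed

text \<open>The positive integers are cut into blocks of length \<open>h\<close>, numbered from \<open>1\<close>, so that the block
  with number \<open>i\<close> ends at \<open>i * h\<close>.\<close>

definition block :: "nat \<Rightarrow> nat \<Rightarrow> nat" where "block h k = (k - 1) div h + 1"

lemma block_le_iff:
  assumes "1 \<le> k" "1 \<le> h" "1 \<le> i"
  shows "block h k \<le> i \<longleftrightarrow> k \<le> i * h"
proof -
  have "block h k \<le> i \<longleftrightarrow> (k - 1) div h < i" by (auto simp: block_def)
  also have "\<dots> \<longleftrightarrow> k - 1 < i * h" using assms by (simp add: div_less_iff_less_mult)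
  also have "\<dots> \<longleftrightarrow> k \<le> i * h" using assms by auto
  finally show ?thesis .
qed

lemma block_ge:
  assumes "1 \<le> k" "1 \<le> h"
  shows "k \<le> block h k * h"
  using block_le_iff[of k h "block h k"] assms by (simp add: block_def)

lemma block_less:
  assumes "1 \<le> k"
  shows "block h k * h < k + h"
proof -
  have "(k - 1) div h * h \<le> k - 1" by simp
  moreover have "block h k * h = (k - 1) div h * h + h" by (simp add: block_def)
  ultimately show ?thesis using assms by linarith
qed

lemma block_eq:
  assumes "r * h < k" "k \<le> r * h + h"
  shows "block h k = Suc r"
proof -
  have "(k - 1) div h = r"
  proof (rule div_nat_eqI)
    have "h * r = r * h" "h * Suc r = r * h + h" by simp_all
    then show "h * r \<le> k - 1" "k - 1 < h * Suc r" using assms by linarith+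
  qed
  then show ?thesis by (simp add: block_def)
qed

lemma sum_block: "(\<Sum>k=1..r * h. F (block h k)) = (\<Sum>i=1..r. real h * F i)"
proof (induction r)
  case (Suc r)
  have "{1..Suc r * h} = {1..r * h} \<union> {r * h<..r * h + h}" by auto
  then have "(\<Sum>k=1..Suc r * h. F (block h k)) = (\<Sum>k=1..r * h. F (block h k)) + (\<Sum>k\<in>{r * h<..r * h + h}. F (block h k))"
    by (simp only:) (rule sum.union_disjoint, auto)
  also have "(\<Sum>k\<in>{r * h<..r * h + h}. F (block h k)) = (\<Sum>k\<in>{r * h<..r * h + h}. F (Suc r))"
    by (intro sum.cong refl) (use block_eq[of r h] in auto)
  finally show ?case using Suc by simp
qed simp

lemma prod_block: "(\<Prod>k=1..r * h. F (block h k)) = (\<Prod>i=1..r. F i ^ h)"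
proof (induction r)
  case (Suc r)
  have "{1..Suc r * h} = {1..r * h} \<union> {r * h<..r * h + h}" by auto
  then have "(\<Prod>k=1..Suc r * h. F (block h k)) = (\<Prod>k=1..r * h. F (block h k)) * (\<Prod>k\<in>{r * h<..r * h + h}. F (block h k))"
    by (simp only:) (rule prod.union_disjoint, auto)
  also have "(\<Prod>k\<in>{r * h<..r * h + h}. F (block h k)) = (\<Prod>k\<in>{r * h<..r * h + h}. F (Suc r))"
    by (intro prod.cong refl) (use block_eq[of r h] in auto)
  finally show ?case using Suc by simp
qed simp

text \<open>The weight of the \<open>i\<close>th increment in \<open>\<Sum>i=1..r. Z i / i\<close>.\<close>

definition harm_tail :: "nat \<Rightarrow> nat \<Rightarrow> real" where
  "harm_tail r i = (\<Sum>k=i..r. 1 / real k)"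

context attracted_sums
begin

text \<open>What becomes of \<open>T n (r * h)\<close> when \<open>S k / k\<close> is replaced by its value at the end of the block of \<open>k\<close>: the
  \<open>h\<close> equal terms \<open>S (i * h) / (i * h)\<close> add up to \<open>S (i * h) / i\<close>.\<close>

definition block_sum :: "nat \<Rightarrow> nat \<Rightarrow> nat \<Rightarrow> 'a \<Rightarrow> real" where
  "block_sum r h n \<omega> = (\<Sum>i=1..r. S (i * h) \<omega> / real i) / a n"

lemma measurable_block_sum [measurable]: "random_variable borel (block_sum r h n)"
  unfolding block_sum_def[abs_def] by measurable

lemma integrable_T_minus_block_sum: "integrable M (\<lambda>\<omega>. \<bar>T n m \<omega> - block_sum r h n \<omega>\<bar>)"
  unfolding block_sum_def
  by (intro integrable_abs Bochner_Integration.integrable_diff Bochner_Integration.integrable_sum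
      integrable_divide integrable_S integrable_T)

lemma expectation_T_minus_block_sum_le:
  obtains C where "C > 0"
    "\<And>n r h m. 1 \<le> n \<Longrightarrow> 1 \<le> r \<Longrightarrow> 1 \<le> h \<Longrightarrow> r * h \<le> m \<Longrightarrow> m \<le> r * h + r \<Longrightarrow> m \<le> n \<Longrightarrow>
      expectation (\<lambda>\<omega>. \<bar>T n m \<omega> - block_sum r h n \<omega>\<bar>) \<le> C * real r powr (-1/8) + C * real r * real n powr (-1/4)"
proof -
  obtain C where C: "C > 0"
    "\<And>k l n. k \<le> l \<Longrightarrow> l \<le> n \<Longrightarrow> 1 \<le> n \<Longrightarrow>
      expectation (\<lambda>\<omega>. \<bar>S l \<omega> - S k \<omega>\<bar>) \<le> C * (real (l - k) / real n) powr (1 / 4) * a n"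
    "\<And>k n. k \<le> n \<Longrightarrow> 1 \<le> n \<Longrightarrow>
      expectation (\<lambda>\<omega>. \<bar>S k \<omega>\<bar>) \<le> C * (real k / real n) powr (1 / 4) * a n"
    using expectation_S_diff_le by blast
  have "expectation (\<lambda>\<omega>. \<bar>T n m \<omega> - block_sum r h n \<omega>\<bar>) \<le> 16 * C * real r powr (-1/8) + 16 * C * real r * real n powr (-1/4)"
    if as: "1 \<le> n" "1 \<le> r" "1 \<le> h" "r * h \<le> m" "m \<le> r * h + r" "m \<le> n" for n r h m
  proof -
    have an: "a n > 0" by (rule a_pos[OF as(1)])
    define b where "b k = block h k * h" for k
    have b: "k \<le> b k" "b k - k \<le> h" "h \<le> b k" if "1 \<le> k" for k
      using block_ge[of k h] block_less[of k h] that as by (auto simp: b_def block_def)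
    have bn: "b k \<le> n" if "k \<in> {1..r * h}" for k
    proof -
      have "block h k \<le> r" using that as by (subst block_le_iff) auto
      then have "b k \<le> r * h" unfolding b_def by (rule mult_right_mono) simp
      with as show ?thesis by simp
    qed
    have Vb: "(\<Sum>k=1..r * h. S (b k) \<omega> / real (b k)) = (\<Sum>i=1..r. S (i * h) \<omega> / real i)" for \<omega>
    proof -
      have "(\<Sum>k=1..r * h. S (b k) \<omega> / real (b k)) = (\<Sum>i=1..r. real h * (S (i * h) \<omega> / real (i * h)))"
        unfolding b_def by (rule sum_block)
      then show ?thesis using as by simp
    qed
    have "{1..m} = {1..r * h} \<union> {r * h<..m}" using as by auto
    then have "(\<Sum>k=1..m. S k \<omega> / real k) = (\<Sum>k=1..r * h. S k \<omega> / real k) + (\<Sum>k\<in>{r * h<..m}. S k \<omega> / real k)" for \<omega>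
      by (simp only:) (rule sum.union_disjoint, auto)
    then have eq: "T n m \<omega> - block_sum r h n \<omega> =
        ((\<Sum>k=1..r * h. S k \<omega> / real k - S (b k) \<omega> / real (b k)) + (\<Sum>k\<in>{r * h<..m}. S k \<omega> / real k)) / a n" for \<omega>
      unfolding T_def block_sum_def Vb[symmetric] by (simp add: sum_subtractf diff_divide_distrib add_divide_distrib)
    let ?err = "\<lambda>k \<omega>. \<bar>S (b k) \<omega> - S k \<omega>\<bar> / real (b k) + \<bar>S k \<omega>\<bar> * (1 / real k - 1 / real (b k))"
    let ?Eerr = "\<lambda>k. expectation (\<lambda>\<omega>. \<bar>S (b k) \<omega> - S k \<omega>\<bar>) / real (b k) + expectation (\<lambda>\<omega>. \<bar>S k \<omega>\<bar>) * (1 / real k - 1 / real (b k))"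
    have step: "\<bar>S k \<omega> / real k - S (b k) \<omega> / real (b k)\<bar>
      \<le> ?err k \<omega>" if "1 \<le> k" for k \<omega>
    proof -
      have kb: "0 < real k" "real k \<le> real (b k)" using b[OF that] that by auto
      have "S k \<omega> / real k - S (b k) \<omega> / real (b k) = (S k \<omega> - S (b k) \<omega>) / real (b k) + S k \<omega> * (1 / real k - 1 / real (b k))"
        using kb by (simp add: field_simps)
      also have "\<bar>\<dots>\<bar> \<le> \<bar>(S k \<omega> - S (b k) \<omega>) / real (b k)\<bar> + \<bar>S k \<omega> * (1 / real k - 1 / real (b k))\<bar>"
        by (rule abs_triangle_ineq)
      also have "\<dots> = ?err k \<omega>"
        using kb by (simp add: abs_mult abs_divide abs_minus_commute divide_left_mono)
      finally show ?thesis .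
    qed
    have "expectation (\<lambda>\<omega>. \<bar>T n m \<omega> - block_sum r h n \<omega>\<bar>) \<le> expectation (\<lambda>\<omega>.
        ((\<Sum>k=1..r * h. ?err k \<omega>)
        + (\<Sum>k\<in>{r * h<..m}. \<bar>S k \<omega>\<bar> / real k)) / a n)"
    proof (rule integral_mono[OF integrable_T_minus_block_sum])
      show "integrable M (\<lambda>\<omega>.
        ((\<Sum>k=1..r * h. ?err k \<omega>)
        + (\<Sum>k\<in>{r * h<..m}. \<bar>S k \<omega>\<bar> / real k)) / a n)"
        by (intro integrable_divide Bochner_Integration.integrable_add Bochner_Integration.integrable_sum
            integrable_mult_left integrable_abs Bochner_Integration.integrable_diff integrable_S)
      fix \<omega>
      have "\<bar>(\<Sum>k=1..r * h. S k \<omega> / real k - S (b k) \<omega> / real (b k)) + (\<Sum>k\<in>{r * h<..m}. S k \<omega> / real k)\<bar>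
        \<le> (\<Sum>k=1..r * h. \<bar>S k \<omega> / real k - S (b k) \<omega> / real (b k)\<bar>) + (\<Sum>k\<in>{r * h<..m}. \<bar>S k \<omega> / real k\<bar>)"
        by (intro order_trans[OF abs_triangle_ineq] add_mono sum_abs)
      also have "\<dots> \<le> (\<Sum>k=1..r * h. ?err k \<omega>)
        + (\<Sum>k\<in>{r * h<..m}. \<bar>S k \<omega>\<bar> / real k)"
        by (intro add_mono sum_mono step) auto
      finally show "\<bar>T n m \<omega> - block_sum r h n \<omega>\<bar> \<le>
        ((\<Sum>k=1..r * h. ?err k \<omega>)
        + (\<Sum>k\<in>{r * h<..m}. \<bar>S k \<omega>\<bar> / real k)) / a n"
        unfolding eq abs_divide abs_of_pos[OF an] by (rule divide_right_mono) (use an in simp)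
    qed
    also have "\<dots> = ((\<Sum>k=1..r * h. ?Eerr k)
        + (\<Sum>k\<in>{r * h<..m}. expectation (\<lambda>\<omega>. \<bar>S k \<omega>\<bar>) / real k)) / a n"
      by (simp add: integrable_S)
    also have "\<dots> \<le> ((\<Sum>k=1..r * h. C * real n powr (-1/4) * a n * (2 * real h powr (1/8)) * real k powr (1/8 - 1))
        + (\<Sum>k\<in>{r * h<..m}. C * real n powr (-1/4) * a n)) / a n"
    proof (intro divide_right_mono add_mono sum_mono)
      fix k assume k: "k \<in> {1..r * h}"
      then have k1: "1 \<le> k" and kn: "k \<le> n" using as by auto
      note bk = b[OF k1]
      have kb: "0 < real k" "real k \<le> real (b k)" using bk k1 by auto
      have "?Eerr k
         \<le> (C * (real (b k - k) / real n) powr (1 / 4) * a n) / real (b k)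
          + (C * (real k / real n) powr (1 / 4) * a n) * (1 / real k - 1 / real (b k))"
        using kb bk kn as bn[OF k]
        by (intro add_mono divide_right_mono mult_right_mono C) (auto simp: divide_left_mono)
      also have "\<dots> = C * real n powr (-1/4) * a n *
          ((real (b k) - real k) powr (2 * (1/8)) / real (b k) + real k powr (2 * (1/8)) * (1 / real k - 1 / real (b k)))"
        using bk by (simp add: powr_divide powr_minus_divide of_nat_diff distrib_left mult_ac)
      also have "\<dots> \<le> C * real n powr (-1/4) * a n * (2 * (real h powr (1/8) * real k powr (1/8 - 1)))"
        using kb bk as an C(1) by (intro mult_left_mono increment_quotient_le) auto
      finally show "?Eerr k
        \<le> C * real n powr (-1/4) * a n * (2 * real h powr (1/8)) * real k powr (1/8 - 1)" by (simp add: mult_ac)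
    next
      fix k assume k: "k \<in> {r * h<..m}"
      then have k1: "1 \<le> k" and kn: "k \<le> n" using as by auto
      have "expectation (\<lambda>\<omega>. \<bar>S k \<omega>\<bar>) / real k \<le> C * (real k / real n) powr (1 / 4) * a n / real k"
        using kn as by (intro divide_right_mono C) auto
      also have "\<dots> = C * real n powr (-1/4) * a n * (real k powr (1/4) / real k)"
        by (simp add: powr_divide powr_minus_divide)
      also have "real k powr (1/4) / real k = real k powr (1/4 - 1)"
        using k1 powr_diff[of "real k" "1/4" 1] by simp
      also have "C * real n powr (-1/4) * a n * \<dots> \<le> C * real n powr (-1/4) * a n * 1"
      proof (intro mult_left_mono)
        have "real k powr (1/4 - 1) \<le> real k powr 0" using k1 by (intro powr_mono) auto
        then show "real k powr (1/4 - 1) \<le> 1" using k1 by simp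
      qed (use an C in auto)
      finally show "expectation (\<lambda>\<omega>. \<bar>S k \<omega>\<bar>) / real k \<le> C * real n powr (-1/4) * a n" by simp
    qed (use an in simp)
    also have "\<dots> = C * real n powr (-1/4) * (2 * real h powr (1/8)) * (\<Sum>k=1..r * h. real k powr (1/8 - 1))
        + C * real n powr (-1/4) * real (m - r * h)"
      unfolding sum_distrib_left[symmetric] using an by (simp add: add_divide_distrib)
    also have "\<dots> \<le> C * real n powr (-1/4) * (2 * real h powr (1/8)) * (real (r * h) powr (1/8) / (1/8))
        + C * real n powr (-1/4) * real r"
    proof (intro add_mono mult_left_mono sum_powr_le)
      have "m - r * h \<le> r" using as by linarith
      then show "real (m - r * h) \<le> real r" by (rule of_nat_mono)
    qed (use C(1) in auto)
    also have "\<dots> \<le> 16 * C * real r powr (-1/8) + 16 * C * real r * real n powr (-1/4)"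
    proof (intro add_mono)
      have rhn: "real (r * h) \<le> real n" using as by linarith
      then have hn: "real h \<le> real n * (1 / real r)" using as by (simp add: field_simps)
      have "C * real n powr (-1/4) * (2 * real h powr (1/8)) * (real (r * h) powr (1/8) / (1/8))
          \<le> C * real n powr (-1/4) * (2 * (real n * (1 / real r)) powr (1/8)) * (real n powr (1/8) / (1/8))"
        using C(1) hn rhn by (intro mult_left_mono mult_mono divide_right_mono powr_mono2) auto
      also have "\<dots> = 16 * C * real r powr (-1/8) * (real n powr (-1/4) * real n powr (1/8) * real n powr (1/8))"
        unfolding powr_mult by (simp add: powr_divide powr_minus_divide mult_ac)
      also have "real n powr (-1/4) * real n powr (1/8) * real n powr (1/8) = 1"
        using as by (simp add: powr_add[symmetric])
      finally show "C * real n powr (-1/4) * (2 * real h powr (1/8)) * (real (r * h) powr (1/8) / (1/8))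
          \<le> 16 * C * real r powr (-1/8)" by simp
      show "C * real n powr (-1/4) * real r \<le> 16 * C * real r * real n powr (-1/4)"
        using C(1) by (simp add: mult_ac)
    qed
    finally show ?thesis .
  qed
  then show ?thesis using that[of "16 * C"] C by auto
qed

text \<open>Written as a weighted sum of the summands, all members of the \<open>i\<close>th block have weight
  \<open>harm_tail r i\<close>.\<close>

lemma char_block_sum:
  assumes "1 \<le> h"
  shows "char (distr M borel (block_sum r h n)) u = (\<Prod>i=1..r. \<phi> (u * harm_tail r i / a n) ^ h)"
proof -
  have "block_sum r h n \<omega> = (\<Sum>j=1..r * h. harm_tail r (block h j) / a n * D j \<omega>)" for \<omega>
  proof -
    have "(\<Sum>i=1..r. S (i * h) \<omega> / real i) = (\<Sum>i=1..r. \<Sum>j=1..r * h. if j \<le> i * h then D j \<omega> / real i else 0)"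
    proof (intro sum.cong refl)
      fix i assume i: "i \<in> {1..r}"
      then have "i * h \<le> r * h" by (intro mult_right_mono) auto
      moreover have "{1..r * h} \<inter> {j. j \<le> q} = {1..q}" if "q \<le> r * h" for q using that by auto
      ultimately have "{1..r * h} \<inter> {j. j \<le> i * h} = {1..i * h}" by blast
      then show "S (i * h) \<omega> / real i = (\<Sum>j=1..r * h. if j \<le> i * h then D j \<omega> / real i else 0)"
        by (simp add: S_def sum_divide_distrib sum.If_cases)
    qed
    also have "\<dots> = (\<Sum>j=1..r * h. \<Sum>i=1..r. if j \<le> i * h then D j \<omega> / real i else 0)"
      by (rule sum.swap)
    also have "\<dots> = (\<Sum>j=1..r * h. harm_tail r (block h j) * D j \<omega>)"
    proof (intro sum.cong refl)
      fix j assume j: "j \<in> {1..r * h}"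
      have "(\<Sum>i=1..r. if j \<le> i * h then D j \<omega> / real i else 0) = (\<Sum>i=1..r. if block h j \<le> i then D j \<omega> / real i else 0)"
        using j assms by (intro sum.cong refl) (simp add: block_le_iff)
      also have "\<dots> = (\<Sum>i=block h j..r. D j \<omega> / real i)"
        by (intro sum.mono_neutral_cong_right) (auto simp: block_def)
      finally show "(\<Sum>i=1..r. if j \<le> i * h then D j \<omega> / real i else 0) = harm_tail r (block h j) * D j \<omega>"
        by (simp add: harm_tail_def sum_distrib_right)
    qed
    finally show ?thesis by (simp add: block_sum_def sum_divide_distrib)
  qed
  then have "block_sum r h n = (\<lambda>\<omega>. \<Sum>j=1..r * h. harm_tail r (block h j) / a n * D j \<omega>)" ..
  then have "char (distr M borel (block_sum r h n)) u = (\<Prod>j=1..r * h. \<phi> (u * (harm_tail r (block h j) / a n)))"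
    using char_sum_D[of "{1..r * h}" "\<lambda>j. harm_tail r (block h j) / a n" u] by auto
  also have "\<dots> = (\<Prod>i=1..r. \<phi> (u * harm_tail r i / a n) ^ h)"
    using prod_block[of "\<lambda>i. \<phi> (u * (harm_tail r i / a n))" h r] by simp
  finally show ?thesis .
qed

text \<open>Fractional powers of \<open>\<phi> (v / a n) ^ n\<close> make sense through the logarithm, which is why the limit
  relation is needed for \<open>n * Ln (\<phi> (v / a n))\<close> and not only for the powers.\<close>

lemma phi_power_tendsto:
  assumes h: "(\<lambda>n. real (h n) / real n) \<longlonglongrightarrow> s"
  shows "(\<lambda>n. \<phi> (v / a n) ^ h n) \<longlonglongrightarrow> exp (- (complex_of_real s * \<Lambda> v))"
proof -
  have "(\<lambda>n. of_nat n * Ln (\<phi> (v / a n))) \<longlonglongrightarrow> - \<Lambda> v"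
    by (rule tendsto_uniform_limitI[OF N.Ln_lim[of "\<bar>v\<bar>"]]) auto
  then have "(\<lambda>n. exp (complex_of_real (real (h n) / real n) * (of_nat n * Ln (\<phi> (v / a n))))) \<longlonglongrightarrow> exp (complex_of_real s * - \<Lambda> v)"
    by (intro tendsto_intros h)
  moreover have "eventually (\<lambda>n. exp (complex_of_real (real (h n) / real n) * (of_nat n * Ln (\<phi> (v / a n)))) = \<phi> (v / a n) ^ h n) sequentially"
  proof -
    have "(\<lambda>n. v / a n) \<longlonglongrightarrow> 0" by (rule real_tendsto_divide_at_top[OF tendsto_const N.a_at_top])
    then have "(\<lambda>n. \<phi> (v / a n)) \<longlonglongrightarrow> \<phi> 0" by (rule isCont_tendsto_compose[OF N.\<phi>_cont])
    then have "eventually (\<lambda>n. \<phi> (v / a n) \<noteq> 0) sequentially"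
      by (rule tendsto_imp_eventually_ne) (simp add: N.\<phi>_0)
    then show ?thesis using eventually_ge_at_top[of 1]
    proof eventually_elim
      case (elim n)
      have "complex_of_real (real (h n) / real n) * (of_nat n * Ln (\<phi> (v / a n))) = of_nat (h n) * Ln (\<phi> (v / a n))"
        using elim by simp
      then show ?case using elim by (simp add: exp_of_nat_mult)
    qed
  qed
  ultimately show ?thesis by (simp add: tendsto_cong)
qed

text \<open>For a fixed number \<open>r\<close> of blocks the law of \<open>block_sum\<close> converges to the law of
  \<open>\<Sum>i=1..r. Z i / i\<close>, where \<open>Z\<close> has independent increments with the law of the stable process at
  time \<open>t / r\<close>; and \<open>T\<close> differs from \<open>block_sum\<close> by an error that vanishes as \<open>r\<close> grows.\<close>

lemma expectation_T_tendsto: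
  fixes g :: "real \<Rightarrow> real" and \<nu> :: "nat \<Rightarrow> real measure"
  assumes t: "0 < t" "t \<le> 1"
    and \<nu>: "\<And>r. 1 \<le> r \<Longrightarrow> real_distribution (\<nu> r)"
    and char_\<nu>: "\<And>r u. 1 \<le> r \<Longrightarrow> char (\<nu> r) u = exp (- (\<Sum>i=1..r. complex_of_real (t / real r) * \<Lambda> (u * harm_tail r i)))"
    and lim: "(\<lambda>r. integral\<^sup>L (\<nu> r) g) \<longlonglongrightarrow> e"
    and g1: "\<And>x. \<bar>g x\<bar> \<le> 1" and lip: "\<And>x y. \<bar>g x - g y\<bar> \<le> K * \<bar>x - y\<bar>"
  shows "(\<lambda>n. expectation (\<lambda>\<omega>. g (T n (nat \<lfloor>real n * t\<rfloor>) \<omega>))) \<longlonglongrightarrow> e"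
proof (rule LIMSEQ_I)
  fix \<epsilon> :: real assume \<epsilon>: "\<epsilon> > 0"
  define m where "m n = nat \<lfloor>real n * t\<rfloor>" for n
  have K: "K \<ge> 0" using lip[of 0 1] by (smt (verit) abs_ge_zero mult_nonneg_nonneg mult_neg_pos)
  have contg: "isCont g x" for x
  proof (rule isCont_iff[THEN iffD2], rule LIM_I)
    fix d :: real assume d: "d > 0"
    show "\<exists>s>0. \<forall>y. y \<noteq> 0 \<and> norm (y - 0) < s \<longrightarrow> norm (g (x + y) - g x) < d"
    proof (intro exI[of _ "d / (K + 1)"] conjI allI impI)
      fix y :: real assume y: "y \<noteq> 0 \<and> norm (y - 0) < d / (K + 1)"
      have "\<bar>g (x + y) - g x\<bar> \<le> K * \<bar>y\<bar>" using lip[of "x + y" x] by simp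
      also have "\<dots> \<le> (K + 1) * \<bar>y\<bar>" by (intro mult_right_mono) auto
      also have "\<dots> < d" using y K by (simp add: field_simps)
      finally show "norm (g (x + y) - g x) < d" by simp
    qed (use d K in simp)
  qed
  have gm[measurable]: "g \<in> borel_measurable borel"
    using contg by (intro borel_measurable_continuous_onI) (simp add: continuous_on_eq_continuous_at)
  obtain C where C: "C > 0"
    "\<And>n r h m. 1 \<le> n \<Longrightarrow> 1 \<le> r \<Longrightarrow> 1 \<le> h \<Longrightarrow> r * h \<le> m \<Longrightarrow> m \<le> r * h + r \<Longrightarrow> m \<le> n \<Longrightarrow>
      expectation (\<lambda>\<omega>. \<bar>T n m \<omega> - block_sum r h n \<omega>\<bar>) \<le> C * real r powr (-1/8) + C * real r * real n powr (-1/4)"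
    using expectation_T_minus_block_sum_le by blast
  have "(\<lambda>r. K * (C * real r powr (-1/8))) \<longlonglongrightarrow> K * (C * 0)"
    by (intro tendsto_intros tendsto_neg_powr filterlim_real_sequentially) auto
  then have "eventually (\<lambda>r. K * (C * real r powr (-1/8)) < \<epsilon> / 4) sequentially"
    by (rule order_tendstoD) (use \<epsilon> in simp)
  moreover have "eventually (\<lambda>r. \<bar>integral\<^sup>L (\<nu> r) g - e\<bar> < \<epsilon> / 4) sequentially"
    using tendstoD[OF lim, of "\<epsilon> / 4"] \<epsilon> by (simp add: dist_real_def)
  ultimately have "eventually (\<lambda>r. K * (C * real r powr (-1/8)) < \<epsilon> / 4 \<and> \<bar>integral\<^sup>L (\<nu> r) g - e\<bar> < \<epsilon> / 4 \<and> 1 \<le> r) sequentially"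
    using eventually_ge_at_top[of 1] by eventually_elim simp
  then obtain r where r: "K * (C * real r powr (-1/8)) < \<epsilon> / 4" "\<bar>integral\<^sup>L (\<nu> r) g - e\<bar> < \<epsilon> / 4" "1 \<le> r"
    by (auto simp: eventually_sequentially)
  \<comment> \<open>blocks of equal length; fewer than \<open>r\<close> indices are left over at the end\<close>
  define h where "h n = m n div r" for n
  have m_lim: "(\<lambda>n. real (m n) / real n) \<longlonglongrightarrow> t"
  proof -
    have "(\<lambda>n. t - 1 / real n) \<longlonglongrightarrow> t - 0" by (intro tendsto_intros)
    moreover have "eventually (\<lambda>n. t - 1 / real n \<le> real (m n) / real n) sequentially"
      using eventually_ge_at_top[of 1]
    proof eventually_elim
      case (elim n)
      have "real n * t - 1 \<le> real (m n)" unfolding m_def by linarith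
      then have "(real n * t - 1) / real n \<le> real (m n) / real n" by (intro divide_right_mono) auto
      then show ?case using elim by (simp add: diff_divide_distrib)
    qed
    moreover have "eventually (\<lambda>n. real (m n) / real n \<le> t) sequentially"
      using eventually_ge_at_top[of 1]
    proof eventually_elim
      case (elim n)
      have "real n * t \<ge> 0" using t by simp
      then have "real (m n) \<le> real n * t" unfolding m_def by linarith
      then have "real (m n) / real n \<le> real n * t / real n" by (intro divide_right_mono) auto
      then show ?case using elim by simp
    qed
    ultimately show ?thesis using tendsto_sandwich[OF _ _ _ tendsto_const] by fastforce
  qed
  have h_lim: "(\<lambda>n. real (h n) / real n) \<longlonglongrightarrow> t / real r"
  proof -
    have lim1: "(\<lambda>n. real (m n) / real n / real r - 1 / real n) \<longlonglongrightarrow> t / real r - 0"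
      using r by (intro tendsto_intros m_lim) auto
    have lim2: "(\<lambda>n. real (m n) / real n / real r) \<longlonglongrightarrow> t / real r"
      using r by (intro tendsto_intros m_lim) auto
    have hb: "real (m n) / real r - 1 \<le> real (h n)" "real (h n) \<le> real (m n) / real r" for n
    proof -
      have "real (m n mod r) < real r" using r by simp
      moreover have "m n = r * h n + m n mod r" by (simp add: h_def)
      then have "real (m n) = real r * real (h n) + real (m n mod r)" by (metis of_nat_add of_nat_mult)
      ultimately have "real (m n) / real r = real (h n) + real (m n mod r) / real r" "real (m n mod r) / real r \<le> 1"
        using r by (simp_all add: add_divide_distrib)
      then show "real (m n) / real r - 1 \<le> real (h n)" "real (h n) \<le> real (m n) / real r"
        using divide_nonneg_nonneg[of "real (m n mod r)" "real r"] by linarith+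
    qed
    have le1: "real (m n) / real n / real r - 1 / real n \<le> real (h n) / real n" for n
      using divide_right_mono[OF hb(1)[of n], of "real n"] by (simp add: diff_divide_distrib mult.commute)
    have le2: "real (h n) / real n \<le> real (m n) / real n / real r" for n
      using divide_right_mono[OF hb(2)[of n], of "real n"] by (simp add: mult.commute)
    show ?thesis
      by (rule tendsto_sandwich[OF always_eventually always_eventually lim1[simplified] lim2]) (use le1 le2 in auto)
  qed
  have h1: "eventually (\<lambda>n. 1 \<le> h n) sequentially"
  proof -
    have "eventually (\<lambda>n. 0 < real (h n) / real n) sequentially"
      using h_lim by (rule order_tendstoD) (use t r in simp)
    then show ?thesis by eventually_elim (simp add: zero_less_divide_iff Suc_le_eq)
  qed
  interpret \<nu>r: real_distribution "\<nu> r" by (rule \<nu>[OF r(3)])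
  have "weak_conv_m (\<lambda>n. distr M borel (block_sum r (h n) n)) (\<nu> r)"
  proof (rule levy_continuity)
    show "real_distribution (distr M borel (block_sum r (h n) n))" for n by (intro real_distribution_distr) simp
    show "real_distribution (\<nu> r)" by (rule \<nu>[OF r(3)])
    fix u
    have "(\<lambda>n. \<Prod>i=1..r. \<phi> (u * harm_tail r i / a n) ^ h n) \<longlonglongrightarrow> (\<Prod>i=1..r. exp (- (complex_of_real (t / real r) * \<Lambda> (u * harm_tail r i))))"
      by (intro tendsto_prod phi_power_tendsto h_lim)
    also have "(\<Prod>i=1..r. exp (- (complex_of_real (t / real r) * \<Lambda> (u * harm_tail r i)))) = char (\<nu> r) u"
      unfolding char_\<nu>[OF r(3)] by (simp add: exp_sum[symmetric] sum_negf)
    finally show "(\<lambda>n. char (distr M borel (block_sum r (h n) n)) u) \<longlonglongrightarrow> char (\<nu> r) u"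
      by (rule Lim_transform_eventually) (use h1 in eventually_elim, simp add: char_block_sum)
  qed
  then have "(\<lambda>n. integral\<^sup>L (distr M borel (block_sum r (h n) n)) g) \<longlonglongrightarrow> integral\<^sup>L (\<nu> r) g"
    by (intro weak_conv_imp_integral_bdd_continuous_conv[where B=1] real_distribution_distr \<nu> r contg)
      (auto simp: g1)
  then have "(\<lambda>n. expectation (\<lambda>\<omega>. g (block_sum r (h n) n \<omega>))) \<longlonglongrightarrow> integral\<^sup>L (\<nu> r) g"
    by (simp add: integral_distr)
  then have "eventually (\<lambda>n. \<bar>expectation (\<lambda>\<omega>. g (block_sum r (h n) n \<omega>)) - integral\<^sup>L (\<nu> r) g\<bar> < \<epsilon> / 4) sequentially"
    using tendstoD[of _ _ _ "\<epsilon> / 4"] \<epsilon> by (fastforce simp: dist_real_def)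
  moreover have "(\<lambda>n. K * (C * real r * real n powr (-1/4))) \<longlonglongrightarrow> K * (C * real r * 0)"
    by (intro tendsto_intros tendsto_neg_powr filterlim_real_sequentially) auto
  then have "eventually (\<lambda>n. K * (C * real r * real n powr (-1/4)) < \<epsilon> / 4) sequentially"
    by (rule order_tendstoD) (use \<epsilon> in simp)
  ultimately have "eventually (\<lambda>n. norm (expectation (\<lambda>\<omega>. g (T n (m n) \<omega>)) - e) < \<epsilon>) sequentially"
    using h1 eventually_ge_at_top[of 1]
  proof eventually_elim
    case (elim n)
    have mn: "m n \<le> n"
    proof -
      have "real n * t \<le> real n * 1" using t by (intro mult_left_mono) auto
      then show ?thesis unfolding m_def by linarith
    qed
    have rh: "r * h n \<le> m n" "m n \<le> r * h n + r"
    proof -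
      have "m n = r * h n + m n mod r" by (simp add: h_def)
      moreover have "m n mod r < r" using r by simp
      ultimately show "r * h n \<le> m n" "m n \<le> r * h n + r" by linarith+
    qed
    have ig: "integrable M (\<lambda>\<omega>. g (f \<omega>))" if [measurable]: "random_variable borel f" for f
      by (rule integrable_const_bound[of _ 1]) (auto simp: g1)
    have "\<bar>expectation (\<lambda>\<omega>. g (T n (m n) \<omega>)) - expectation (\<lambda>\<omega>. g (block_sum r (h n) n \<omega>))\<bar>
        = \<bar>expectation (\<lambda>\<omega>. g (T n (m n) \<omega>) - g (block_sum r (h n) n \<omega>))\<bar>"
      by (simp add: ig)
    also have "\<dots> \<le> expectation (\<lambda>\<omega>. \<bar>g (T n (m n) \<omega>) - g (block_sum r (h n) n \<omega>)\<bar>)" by (rule integral_abs_bound)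
    also have "\<dots> \<le> expectation (\<lambda>\<omega>. K * \<bar>T n (m n) \<omega> - block_sum r (h n) n \<omega>\<bar>)"
      by (intro integral_mono integrable_abs Bochner_Integration.integrable_diff ig integrable_mult_right
          integrable_T_minus_block_sum lip) auto
    also have "\<dots> = K * expectation (\<lambda>\<omega>. \<bar>T n (m n) \<omega> - block_sum r (h n) n \<omega>\<bar>)" by simp
    also have "\<dots> \<le> K * (C * real r powr (-1/8) + C * real r * real n powr (-1/4))"
      using elim(3,4) r(3) rh mn by (intro mult_left_mono C(2) K) auto
    also have "\<dots> < \<epsilon> / 4 + \<epsilon> / 4" using elim(2) r(1) by (simp add: distrib_left)
    finally show ?case using elim(1) r(2) by (simp add: abs_if split: if_splits)
  qed
  then show "\<exists>no. \<forall>n\<ge>no. norm (expectation (\<lambda>\<omega>. g (T n (nat \<lfloor>real n * t\<rfloor>) \<omega>)) - e) < \<epsilon>"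
    by (simp add: m_def eventually_sequentially)
qed

end

section \<open>The stable Levy process\<close>

text \<open>The first grid point of mesh \<open>d\<close> strictly after \<open>s\<close>; strictness matters because the paths are
  only continuous from the right.\<close>

definition next_grid :: "real \<Rightarrow> real \<Rightarrow> real" where
  "next_grid d s = d * (real (nat \<lfloor>s / d\<rfloor>) + 1)"

lemma next_grid_bounds:
  assumes "0 < d" "0 \<le> s"
  shows "s < next_grid d s" "next_grid d s \<le> s + d" "d \<le> next_grid d s"
proof -
  have f: "real (nat \<lfloor>s / d\<rfloor>) \<le> s / d" "s / d < real (nat \<lfloor>s / d\<rfloor>) + 1"
    using assms by (auto simp: of_nat_nat)
  have "d * (s / d) < d * (real (nat \<lfloor>s / d\<rfloor>) + 1)" using f assms by (intro mult_strict_left_mono) auto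
  then show "s < next_grid d s" using assms by (simp add: next_grid_def)
  have "d * (real (nat \<lfloor>s / d\<rfloor>) + 1) \<le> d * (s / d + 1)" using f assms by (intro mult_left_mono) auto
  then show "next_grid d s \<le> s + d" using assms by (simp add: next_grid_def distrib_left)
  have "d * 1 \<le> d * (real (nat \<lfloor>s / d\<rfloor>) + 1)" using assms by (intro mult_left_mono) auto
  then show "d \<le> next_grid d s" by (simp add: next_grid_def)
qed

lemma next_grid_tendsto:
  assumes "0 \<le> s"
  shows "(\<lambda>n. next_grid (1 / real (Suc n)) s) \<longlonglongrightarrow> s"
proof (rule tendsto_sandwich[OF _ _ tendsto_const])
  have "(\<lambda>n. s + 1 / real (Suc n)) \<longlonglongrightarrow> s + 0"
    by (intro tendsto_intros LIMSEQ_Suc[OF lim_1_over_n])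
  then show "(\<lambda>n. s + 1 / real (Suc n)) \<longlonglongrightarrow> s" by simp
qed (use assms next_grid_bounds in \<open>auto intro!: always_eventually less_imp_le simp del: of_nat_Suc\<close>)

text \<open>Summation by parts.\<close>

lemma sum_harm_tail_increments:
  "(\<Sum>i<r. harm_tail r (Suc i) * (y (Suc i) - y i)) = (\<Sum>i=1..r. y i / real i) - y 0 * harm_tail r 1"
proof (induction r)
  case (Suc r)
  have ht: "harm_tail (Suc r) (Suc i) = harm_tail r (Suc i) + 1 / real (Suc r)" if "i \<le> r" for i
    using that by (simp add: harm_tail_def)
  have "(\<Sum>i<Suc r. harm_tail (Suc r) (Suc i) * (y (Suc i) - y i))
      = (\<Sum>i<Suc r. harm_tail r (Suc i) * (y (Suc i) - y i) + 1 / real (Suc r) * (y (Suc i) - y i))"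
    by (intro sum.cong refl) (simp add: ht distrib_right del: of_nat_Suc)
  also have "\<dots> = (\<Sum>i<Suc r. harm_tail r (Suc i) * (y (Suc i) - y i)) + 1 / real (Suc r) * (y (Suc r) - y 0)"
    unfolding sum.distrib sum_distrib_left[symmetric] by (subst sum_lessThan_telescope) simp
  also have "harm_tail r (Suc r) = 0" by (simp add: harm_tail_def)
  then have "(\<Sum>i<Suc r. harm_tail r (Suc i) * (y (Suc i) - y i)) = (\<Sum>i<r. harm_tail r (Suc i) * (y (Suc i) - y i))"
    by simp
  finally show ?case
    unfolding Suc.IH using ht[of 0] by (simp add: algebra_simps diff_divide_distrib del: of_nat_Suc)
qed (simp add: harm_tail_def)

text \<open>For \<open>i\<close> in the first half of \<open>{1..r}\<close> there are at least \<open>r / 2\<close> terms, each at least \<open>1 / r\<close>.\<close>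

lemma harm_tail_ge_half:
  assumes "1 \<le> r" "1 \<le> i" "2 * i \<le> r + 2"
  shows "1 / 2 \<le> harm_tail r i"
proof -
  have ir: "i \<le> r + 1" using assms by linarith
  have "real r / 2 \<le> real (r + 1 - i)" using assms ir by (simp add: of_nat_diff)
  then have "1 / 2 \<le> real (r + 1 - i) * (1 / real r)" using assms by (simp add: field_simps)
  also have "\<dots> = (\<Sum>k=i..r. 1 / real r)" by simp
  also have "\<dots> \<le> harm_tail r i"
    unfolding harm_tail_def using assms by (intro sum_mono divide_left_mono) auto
  finally show ?thesis .
qed

text \<open>The derivative of \<open>exp\<close> has modulus at most \<open>1\<close> on the closed left half plane, which is convex.\<close>

lemma norm_exp_minus_1_le:
  fixes z :: complex
  assumes "Re z \<le> 0"
  shows "norm (exp z - 1) \<le> norm z"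
proof -
  have "norm (exp z - exp 0) \<le> 1 * norm (z - 0)"
  proof (rule field_differentiable_bound[of "{z. Re z \<le> 0}"])
    show "convex {z. Re z \<le> 0}" by (rule convex_halfspace_Re_le)
  qed (use assms in \<open>auto intro!: derivative_eq_intros\<close>)
  then show ?thesis by simp
qed

locale stable_process = prob_space P
  for P :: "'b measure" +
  fixes Y :: "real \<Rightarrow> 'b \<Rightarrow> real" and L :: "real measure" and \<alpha> :: real
  assumes \<alpha>_gt_1: "1 < \<alpha>"
    and stable_L: "stable_law \<alpha> L"
    and levy_Y: "levy_process P Y"
    and distr_Y1: "distr P borel (Y 1) = L"
begin

abbreviation \<Lambda> :: "real \<Rightarrow> complex" where "\<Lambda> \<equiv> stable_exponent \<alpha>"

abbreviation \<psi> :: "real \<Rightarrow> real \<Rightarrow> complex" where "\<psi> s \<equiv> char (distr P borel (Y s))"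

lemma measurable_Y: "0 \<le> s \<Longrightarrow> random_variable borel (Y s)"
  using levy_Y unfolding levy_process_def by blast

lemma AE_Y_0: "AE \<omega> in P. Y 0 \<omega> = 0"
  using levy_Y unfolding levy_process_def by blast

lemma distr_increment:
  "0 \<le> s \<Longrightarrow> 0 \<le> h \<Longrightarrow> distr P borel (\<lambda>\<omega>. Y (s + h) \<omega> - Y s \<omega>) = distr P borel (Y h)"
  using levy_Y unfolding levy_process_def by blast

lemma indep_increments:
  assumes "0 \<le> (r :: nat \<Rightarrow> real) 0" "\<And>i. i < n \<Longrightarrow> r i < r (Suc i)"
  shows "indep_vars (\<lambda>_. borel) (\<lambda>i \<omega>. Y (r (Suc i)) \<omega> - Y (r i) \<omega>) {..<n}"
  using levy_Y assms unfolding levy_process_def by blast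

lemma Y_right_lim:
  assumes "\<omega> \<in> space P" "0 \<le> s" "x \<longlonglongrightarrow> s" "\<And>n. s < x n"
  shows "(\<lambda>n. Y (x n) \<omega>) \<longlonglongrightarrow> Y s \<omega>"
proof -
  have "continuous (at_right s) (\<lambda>s. Y s \<omega>)"
    using levy_Y assms unfolding levy_process_def cadlag_def by blast
  then have "((\<lambda>s. Y s \<omega>) \<longlongrightarrow> Y s \<omega>) (at_right s)" by (simp add: continuous_within)
  moreover have "filterlim x (at_right s) sequentially"
    using assms by (intro tendsto_imp_filterlim_at_right) auto
  ultimately show ?thesis by (rule filterlim_compose)
qed

lemma real_distribution_Y: "0 \<le> s \<Longrightarrow> real_distribution (distr P borel (Y s))"
  by (intro real_distribution_distr measurable_Y)

lemma char_weighted_increments: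
  assumes d: "0 < d"
  shows "char (distr P borel (\<lambda>\<omega>. \<Sum>i<n. w i * (Y (real (Suc i) * d) \<omega> - Y (real i * d) \<omega>))) u
    = (\<Prod>i<n. \<psi> d (u * w i))"
proof -
  define \<Delta> where "\<Delta> i \<omega> = Y (real (Suc i) * d) \<omega> - Y (real i * d) \<omega>" for i \<omega>
  have m: "random_variable borel (\<Delta> i)" for i
    unfolding \<Delta>_def using d by (intro borel_measurable_diff measurable_Y) auto
  have "indep_vars (\<lambda>_. borel) \<Delta> {..<n}"
    unfolding \<Delta>_def[abs_def] using indep_increments[of "\<lambda>i. real i * d" n] d by simp
  then have "indep_vars (\<lambda>_. borel) (\<lambda>i \<omega>. w i * \<Delta> i \<omega>) {..<n}"
    by (rule indep_vars_compose2) auto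
  then have "char (distr P borel (\<lambda>\<omega>. \<Sum>i<n. w i * \<Delta> i \<omega>)) u = (\<Prod>i<n. char (distr P borel (\<lambda>\<omega>. w i * \<Delta> i \<omega>)) u)"
    by (rule char_distr_sum)
  also have "\<dots> = (\<Prod>i<n. \<psi> d (u * w i))"
  proof (intro prod.cong refl)
    fix i
    have "distr P borel (\<Delta> i) = distr P borel (Y d)"
      using distr_increment[of "real i * d" d] d by (simp add: \<Delta>_def[abs_def] distrib_right add.commute)
    then have "\<psi> d (u * w i) = char (distr P borel (\<Delta> i)) (u * w i)" by simp
    then show "char (distr P borel (\<lambda>\<omega>. w i * \<Delta> i \<omega>)) u = \<psi> d (u * w i)"
      using m[of i] unfolding char_def by (subst (asm) integral_distr[OF m], simp, subst integral_distr) (auto simp: mult.assoc)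
  qed
  finally show ?thesis by (simp add: \<Delta>_def)
qed

lemma char_Y_mult:
  assumes "0 < d"
  shows "\<psi> (real n * d) u = \<psi> d u ^ n"
proof -
  have "(\<lambda>\<omega>. \<Sum>i<n. 1 * (Y (real (Suc i) * d) \<omega> - Y (real i * d) \<omega>)) = (\<lambda>\<omega>. Y (0 + real n * d) \<omega> - Y 0 \<omega>)"
    using sum_lessThan_telescope[of "\<lambda>i. Y (real i * d) _" n] by (simp del: of_nat_Suc)
  then have "distr P borel (\<lambda>\<omega>. \<Sum>i<n. 1 * (Y (real (Suc i) * d) \<omega> - Y (real i * d) \<omega>)) = distr P borel (Y (real n * d))"
    using distr_increment[of 0 "real n * d"] assms by simp
  then show ?thesis
    using char_weighted_increments[OF assms, where w="\<lambda>_. 1" and n=n and u=u] by simp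
qed

text \<open>The \<open>n\<close>th powers of both sides agree, so their quotient is a continuous function whose values are
  \<open>n\<close>th roots of unity; it equals \<open>1\<close> at \<open>0\<close>, hence everywhere.\<close>

lemma char_Y_inverse_nat:
  assumes n: "1 \<le> n"
  shows "\<psi> (1 / real n) u = exp (- (\<Lambda> u / of_nat n))"
proof -
  interpret d: real_distribution "distr P borel (Y (1 / real n))" by (intro real_distribution_Y) simp
  define f where "f u = \<psi> (1 / real n) u * exp (\<Lambda> u / of_nat n)" for u
  have \<psi>1: "\<psi> 1 u = exp (- \<Lambda> u)" for u
    using stable_L by (simp add: distr_Y1 stable_law_def stable_char_eq_exp)
  have fn: "f u ^ n = 1" for u
  proof -
    have "\<psi> (1 / real n) u ^ n = exp (- \<Lambda> u)"
      using char_Y_mult[of "1 / real n" n u] n by (simp add: \<psi>1)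
    moreover have "exp (\<Lambda> u / of_nat n) ^ n = exp (\<Lambda> u)"
      using n by (simp add: exp_of_nat_mult[symmetric])
    ultimately show ?thesis by (simp add: f_def power_mult_distrib exp_minus)
  qed
  have "continuous_on UNIV f"
    unfolding f_def using d.isCont_char \<alpha>_gt_1 n
    by (intro continuous_on_mult continuous_on_exp continuous_on_divide continuous_on_stable_exponent continuous_on_const)
      (auto simp: continuous_on_eq_continuous_at)
  moreover have "finite (range f)"
    by (rule finite_subset[OF _ finite_roots_unity[of n]]) (use n fn in auto)
  ultimately have "f constant_on UNIV"
    by (intro continuous_finite_range_constant) auto
  then have "f u = f 0" by (auto simp: constant_on_def)
  also have "f 0 = 1" by (simp add: f_def d.char_zero stable_exponent_0)
  finally show ?thesis by (simp add: f_def exp_minus field_simps)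
qed

text \<open>The times \<open>k / n\<close> approach \<open>s\<close> from the right, where the paths are continuous.\<close>

lemma char_Y:
  assumes s: "0 \<le> s"
  shows "\<psi> s u = exp (- (complex_of_real s * \<Lambda> u))"
proof -
  define x where "x n = next_grid (1 / real (Suc n)) s" for n
  have x: "x \<longlonglongrightarrow> s" "s < x n" for n
    unfolding x_def using next_grid_tendsto[OF s] next_grid_bounds(1)[OF _ s] by (auto simp del: of_nat_Suc)
  have x0: "0 \<le> x n" for n using x(2)[of n] s by simp
  have "\<psi> (x n) u = exp (- (complex_of_real (x n) * \<Lambda> u))" for n
  proof -
    define k where "k = nat \<lfloor>s / (1 / real (Suc n))\<rfloor> + 1"
    have xn: "x n = real k * (1 / real (Suc n))" by (simp add: x_def next_grid_def k_def)
    have "\<psi> (x n) u = exp (- (\<Lambda> u / of_nat (Suc n))) ^ k"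
      unfolding xn by (subst char_Y_mult) (auto simp: char_Y_inverse_nat[symmetric] simp del: of_nat_Suc)
    also have "\<dots> = exp (- (complex_of_real (x n) * \<Lambda> u))"
      by (simp add: xn exp_of_nat_mult[symmetric] del: of_nat_Suc)
    finally show ?thesis .
  qed
  moreover have "(\<lambda>n. exp (- (complex_of_real (x n) * \<Lambda> u))) \<longlonglongrightarrow> exp (- (complex_of_real s * \<Lambda> u))"
    by (intro tendsto_intros x)
  ultimately have 1: "(\<lambda>n. \<psi> (x n) u) \<longlonglongrightarrow> exp (- (complex_of_real s * \<Lambda> u))" by simp
  have "(\<lambda>n. CLINT \<omega>|P. iexp (u * Y (x n) \<omega>)) \<longlonglongrightarrow> (CLINT \<omega>|P. iexp (u * Y s \<omega>))"
  proof (rule integral_dominated_convergence[where w="\<lambda>_. 1"])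
    show "AE \<omega> in P. (\<lambda>n. iexp (u * Y (x n) \<omega>)) \<longlonglongrightarrow> iexp (u * Y s \<omega>)"
      by (intro AE_I2 tendsto_intros Y_right_lim x s)
  qed (use measurable_Y[OF s] measurable_Y[OF x0] in auto)
  then have "(\<lambda>n. \<psi> (x n) u) \<longlonglongrightarrow> \<psi> s u"
    unfolding char_def using measurable_Y[OF s] measurable_Y[OF x0] by (simp add: integral_distr)
  with 1 show ?thesis by (metis LIMSEQ_unique)
qed

text \<open>Self-similarity reduces the first moment at time \<open>s\<close> to the one at time \<open>1\<close>.\<close>

lemma expectation_abs_Y_le:
  obtains C where "C > 0" "\<And>s. 0 \<le> s \<Longrightarrow> integrable P (Y s)"
    "\<And>s. 0 \<le> s \<Longrightarrow> expectation (\<lambda>\<omega>. \<bar>Y s \<omega>\<bar>) \<le> C * s powr (1 / \<alpha>)"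
proof -
  interpret L: real_distribution L using stable_L by (simp add: stable_law_def)
  have "norm (1 - char L u) \<le> norm (\<Lambda> 1) * u powr \<alpha>" if "0 < u" for u
  proof -
    have "char L u = exp (- \<Lambda> u)" using stable_L by (simp add: stable_law_def stable_char_eq_exp)
    then have "norm (1 - char L u) = norm (exp (- \<Lambda> u) - 1)" by (simp add: norm_minus_commute)
    also have "\<dots> \<le> norm (- \<Lambda> u)"
      using Re_stable_exponent[of \<alpha> u] Re_stable_exponent_1_pos[of \<alpha>]
      by (intro norm_exp_minus_1_le) simp
    also have "\<dots> = norm (\<Lambda> 1) * u powr \<alpha>" using norm_stable_exponent[of \<alpha> u] that by simp
    finally show ?thesis .
  qed
  then have "integrable L (\<lambda>x. \<bar>x\<bar> powr 1)" by (intro L.moment_bound(1)[OF _ \<alpha>_gt_1]) auto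
  then have "integrable L (\<lambda>x. \<bar>x\<bar>)" by simp
  then have iL: "integrable L (\<lambda>x. x)" by (rule integrable_abs_iff[THEN iffD1, rotated]) simp
  then have i1: "integrable P (Y 1)"
    unfolding distr_Y1[symmetric] by (subst (asm) integrable_distr_eq) (auto intro: measurable_Y)
  have sc: "distr P borel (Y s) = distr P borel (\<lambda>\<omega>. s powr (1 / \<alpha>) * Y 1 \<omega>)" if s: "0 \<le> s" for s
  proof (rule Levy_uniqueness)
    show "real_distribution (distr P borel (Y s))" by (rule real_distribution_Y[OF s])
    have mY1: "random_variable borel (Y 1)" by (rule measurable_Y) simp
    then show "real_distribution (distr P borel (\<lambda>\<omega>. s powr (1 / \<alpha>) * Y 1 \<omega>))"
      by (intro real_distribution_distr) simp
    show "\<psi> s = char (distr P borel (\<lambda>\<omega>. s powr (1 / \<alpha>) * Y 1 \<omega>))"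
    proof
      fix u
      have "char (distr P borel (\<lambda>\<omega>. s powr (1 / \<alpha>) * Y 1 \<omega>)) u = \<psi> 1 (s powr (1 / \<alpha>) * u)"
        unfolding char_def using mY1 by (simp add: integral_distr mult_ac)
      also have "\<dots> = exp (- \<Lambda> (s powr (1 / \<alpha>) * u))" by (simp add: char_Y)
      also have "\<Lambda> (s powr (1 / \<alpha>) * u) = complex_of_real s * \<Lambda> u"
        using s \<alpha>_gt_1 by (subst stable_exponent_scale) (auto simp: powr_powr)
      finally show "\<psi> s u = char (distr P borel (\<lambda>\<omega>. s powr (1 / \<alpha>) * Y 1 \<omega>)) u"
        by (simp add: char_Y[OF s])
    qed
  qed
  have i: "integrable P (Y s)" if s: "0 \<le> s" for s
  proof -
    have "integrable P (\<lambda>\<omega>. s powr (1 / \<alpha>) * Y 1 \<omega>)" using i1 by simp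
    then have "integrable (distr P borel (\<lambda>\<omega>. s powr (1 / \<alpha>) * Y 1 \<omega>)) (\<lambda>x. x)"
      using measurable_Y[of 1] by (subst integrable_distr_eq) auto
    then show ?thesis unfolding sc[OF s, symmetric]
      by (subst (asm) integrable_distr_eq) (auto intro: measurable_Y s)
  qed
  have E: "expectation (\<lambda>\<omega>. \<bar>Y s \<omega>\<bar>) = s powr (1 / \<alpha>) * expectation (\<lambda>\<omega>. \<bar>Y 1 \<omega>\<bar>)" if s: "0 \<le> s" for s
  proof -
    have "expectation (\<lambda>\<omega>. \<bar>Y s \<omega>\<bar>) = (\<integral>x. \<bar>x\<bar> \<partial>distr P borel (Y s))"
      using measurable_Y[OF s] by (simp add: integral_distr)
    also have "\<dots> = expectation (\<lambda>\<omega>. \<bar>s powr (1 / \<alpha>) * Y 1 \<omega>\<bar>)"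
      unfolding sc[OF s] using measurable_Y[of 1] by (simp add: integral_distr)
    finally show ?thesis by (simp add: abs_mult)
  qed
  define C where "C = expectation (\<lambda>\<omega>. \<bar>Y 1 \<omega>\<bar>) + 1"
  have "C > 0" by (simp add: C_def add_nonneg_pos)
  moreover have "expectation (\<lambda>\<omega>. \<bar>Y s \<omega>\<bar>) \<le> C * s powr (1 / \<alpha>)" if "0 \<le> s" for s
    unfolding E[OF that] by (simp add: C_def mult.commute mult_left_mono)
  ultimately show ?thesis using that i by blast
qed

text \<open>The logarithm of the limiting variable.\<close>

definition W :: "real \<Rightarrow> 'b \<Rightarrow> real" where "W t \<omega> = (LBINT s:{0..t}. Y s \<omega> / s)"

text \<open>The Riemann sum of \<open>W t\<close> over \<open>r\<close> cells of length \<open>t / r\<close>, evaluated at right end points; the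
  length of the cells cancels.\<close>

definition grid_sum :: "real \<Rightarrow> nat \<Rightarrow> 'b \<Rightarrow> real" where
  "grid_sum t r \<omega> = (\<Sum>i=1..r. Y (real i * (t / real r)) \<omega> / real i)"

lemma measurable_grid_sum [measurable]: "0 < t \<Longrightarrow> random_variable borel (grid_sum t r)"
  unfolding grid_sum_def[abs_def]
  by (intro borel_measurable_sum borel_measurable_divide measurable_Y borel_measurable_const) auto

lemma char_grid_sum:
  assumes t: "0 < t" and r: "1 \<le> r"
  shows "char (distr P borel (grid_sum t r)) u
    = exp (- (\<Sum>i=1..r. complex_of_real (t / real r) * \<Lambda> (u * harm_tail r i)))"
proof -
  define d where "d = t / real r"
  have d: "d > 0" using t r by (simp add: d_def)
  define U where "U \<omega> = (\<Sum>i<r. harm_tail r (Suc i) * (Y (real (Suc i) * d) \<omega> - Y (real i * d) \<omega>))" for \<omega>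
  have mU: "random_variable borel U"
    unfolding U_def[abs_def] using d
    by (intro borel_measurable_sum borel_measurable_times borel_measurable_diff measurable_Y borel_measurable_const) auto
  have "AE \<omega> in P. grid_sum t r \<omega> = U \<omega>"
    using AE_Y_0
  proof eventually_elim
    case (elim \<omega>)
    then show ?case
      unfolding U_def sum_harm_tail_increments[of r "\<lambda>i. Y (real i * d) \<omega>"] by (simp add: grid_sum_def d_def)
  qed
  then have "char (distr P borel (grid_sum t r)) u = char (distr P borel U) u"
    unfolding char_def using mU measurable_grid_sum[OF t, of r]
    by (simp add: integral_distr) (intro integral_cong_AE, auto)
  also have "\<dots> = (\<Prod>i<r. \<psi> d (u * harm_tail r (Suc i)))"
    unfolding U_def by (rule char_weighted_increments[OF d])
  also have "\<dots> = exp (- (\<Sum>i<r. complex_of_real d * \<Lambda> (u * harm_tail r (Suc i))))"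
    using d by (simp add: char_Y exp_sum[symmetric] sum_negf)
  also have "(\<Sum>i<r. complex_of_real d * \<Lambda> (u * harm_tail r (Suc i))) = (\<Sum>i=1..r. complex_of_real d * \<Lambda> (u * harm_tail r i))"
    by (rule sum.reindex_bij_witness[of _ "\<lambda>i. i - 1" Suc]) auto
  finally show ?thesis by (simp add: d_def)
qed

text \<open>The integrand of \<open>W t\<close>, as a function on the product space on which Tonelli's theorem is applied.\<close>

definition Z :: "real \<Rightarrow> 'b \<Rightarrow> real \<Rightarrow> real" where
  "Z t \<omega> s = indicator {0<..t} s * (Y s \<omega> / s)"

text \<open>Joint measurability follows from right-continuity: \<open>Y\<close> at the next grid point takes only countably
  many random variables as values, and converges to \<open>Y s\<close> as the mesh shrinks.\<close>

lemma measurable_Z: "case_prod (Z t) \<in> borel_measurable (P \<Otimes>\<^sub>M lborel)"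
proof (rule borel_measurable_LIMSEQ_real[where u="\<lambda>n x. indicator {0<..t} (snd x) * (Y (next_grid (1 / real (Suc n)) (snd x)) (fst x) / snd x)"])
  fix n
  define d where "d = 1 / real (Suc n)"
  have d: "d > 0" by (simp add: d_def)
  have "(\<lambda>x. Y (d * (real (nat \<lfloor>snd x / d\<rfloor>) + 1)) (fst x)) \<in> borel_measurable (P \<Otimes>\<^sub>M lborel)"
  proof (rule measurable_compose_countable[where g="\<lambda>x. nat \<lfloor>snd x / d\<rfloor>" and f="\<lambda>i x. Y (d * (real i + 1)) (fst x)"])
    show "(\<lambda>x. Y (d * (real i + 1)) (fst x)) \<in> borel_measurable (P \<Otimes>\<^sub>M lborel)" for i
      using d by (intro measurable_compose[OF measurable_fst measurable_Y]) simp
  qed measurable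
  then have "(\<lambda>x. indicator {0<..t} (snd x) * (Y (next_grid d (snd x)) (fst x) / snd x)) \<in> borel_measurable (P \<Otimes>\<^sub>M lborel)"
    unfolding next_grid_def by measurable
  then show "(\<lambda>x. indicator {0<..t} (snd x) * (Y (next_grid (1 / real (Suc n)) (snd x)) (fst x) / snd x)) \<in> borel_measurable (P \<Otimes>\<^sub>M lborel)"
    by (simp only: d_def)
next
  fix x :: "'b \<times> real" assume x: "x \<in> space (P \<Otimes>\<^sub>M lborel)"
  show "(\<lambda>n. indicator {0<..t} (snd x) * (Y (next_grid (1 / real (Suc n)) (snd x)) (fst x) / snd x)) \<longlonglongrightarrow> case_prod (Z t) x"
  proof (cases "snd x \<in> {0<..t}")
    case True
    then have s: "snd x > 0" by simp
    have "(\<lambda>n. Y (next_grid (1 / real (Suc n)) (snd x)) (fst x)) \<longlonglongrightarrow> Y (snd x) (fst x)"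
      using x s by (intro Y_right_lim next_grid_tendsto next_grid_bounds(1)) (auto simp: space_pair_measure)
    then show ?thesis using s unfolding Z_def split_beta by (intro tendsto_intros) auto
  qed (simp add: Z_def split_beta)
qed

lemma W_eq: "W t \<omega> = (\<integral>s. Z t \<omega> s \<partial>lborel)"
  unfolding W_def set_lebesgue_integral_def Z_def
  by (intro Bochner_Integration.integral_cong refl) (auto simp: indicator_def)

lemma measurable_W [measurable]: "random_variable borel (W t)"
  unfolding W_eq[abs_def] by (rule lborel.borel_measurable_lebesgue_integral[OF measurable_Z])

text \<open>The sum \<open>grid_sum t r\<close> is the integral of the step function that takes the value of \<open>Y s / s\<close> at the
  next grid point. By Tonelli it is enough to bound the expected modulus of the difference of
  the integrands at each \<open>s\<close>, which is of order \<open>(t / r) powr \<theta> * s powr (\<theta> - 1)\<close> with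
  \<open>\<theta> = 1 / (2 * \<alpha>)\<close>.\<close>

lemma expectation_W_minus_grid_sum:
  assumes t: "0 < t"
  obtains C where "\<And>r. 1 \<le> r \<Longrightarrow> integrable P (\<lambda>\<omega>. \<bar>W t \<omega> - grid_sum t r \<omega>\<bar>)"
    "\<And>r. 1 \<le> r \<Longrightarrow> expectation (\<lambda>\<omega>. \<bar>W t \<omega> - grid_sum t r \<omega>\<bar>) \<le> C * (1 / real r) powr (1 / (2 * \<alpha>))"
proof -
  obtain C where C: "C > 0" "\<And>s. 0 \<le> s \<Longrightarrow> integrable P (Y s)"
    "\<And>s. 0 \<le> s \<Longrightarrow> expectation (\<lambda>\<omega>. \<bar>Y s \<omega>\<bar>) \<le> C * s powr (1 / \<alpha>)"
    using expectation_abs_Y_le by blast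
  define \<theta> where "\<theta> = 1 / (2 * \<alpha>)"
  have \<theta>: "0 < \<theta>" "\<theta> \<le> 1" "1 / \<alpha> = 2 * \<theta>" using \<alpha>_gt_1 by (auto simp: \<theta>_def)
  have inc: "expectation (\<lambda>\<omega>. \<bar>Y v \<omega> - Y s \<omega>\<bar>) \<le> C * (v - s) powr (2 * \<theta>)" if "0 \<le> s" "s \<le> v" for s v
  proof -
    have ms: "random_variable borel (\<lambda>\<omega>. Y v \<omega> - Y s \<omega>)"
      using that by (intro borel_measurable_diff measurable_Y) auto
    have "expectation (\<lambda>\<omega>. \<bar>Y v \<omega> - Y s \<omega>\<bar>) = (\<integral>x. \<bar>x\<bar> \<partial>distr P borel (\<lambda>\<omega>. Y v \<omega> - Y s \<omega>))"
      using ms by (simp add: integral_distr)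
    also have "distr P borel (\<lambda>\<omega>. Y v \<omega> - Y s \<omega>) = distr P borel (Y (v - s))"
      using distr_increment[of s "v - s"] that by simp
    also have "(\<integral>x. \<bar>x\<bar> \<partial>distr P borel (Y (v - s))) = expectation (\<lambda>\<omega>. \<bar>Y (v - s) \<omega>\<bar>)"
      using that measurable_Y[of "v - s"] by (simp add: integral_distr)
    also have "\<dots> \<le> C * (v - s) powr (2 * \<theta>)" using C(3)[of "v - s"] that \<theta> by simp
    finally show ?thesis .
  qed
  define B where "B r = 2 * C * (t / real r) powr \<theta> * (t powr \<theta> / \<theta>)" for r :: nat
  have B0: "B r \<ge> 0" for r using C \<theta> by (simp add: B_def)
  have main: "(\<integral>\<^sup>+\<omega>. ennreal \<bar>W t \<omega> - grid_sum t r \<omega>\<bar> \<partial>P) \<le> ennreal (B r)" if r: "1 \<le> r" for r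
  proof -
    define d where "d = t / real r"
    have d: "d > 0" using t r by (simp add: d_def)
    have rd: "real r * d = t" using r by (simp add: d_def)
    \<comment> \<open>the cells of the step function whose integral is \<open>grid_sum t r\<close>\<close>
    let ?cell = "\<lambda>\<omega> s i. indicator {real (i - 1) * d..<real i * d} s * (Y (real i * d) \<omega> / (real i * d))"
    define F where "F \<omega> s = (\<Sum>i=1..r. ?cell \<omega> s i)" for \<omega> s
    have mF: "case_prod F \<in> borel_measurable (P \<Otimes>\<^sub>M lborel)"
    proof -
      have "(\<lambda>x. Y (real i * d) (fst x)) \<in> borel_measurable (P \<Otimes>\<^sub>M lborel)" for i
        using d by (intro measurable_compose[OF measurable_fst measurable_Y]) simp
      then show ?thesis unfolding F_def split_beta' by measurable
    qed
    have iF: "integrable lborel (F \<omega>)" for \<omega>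
      unfolding F_def[abs_def] using d
      by (intro Bochner_Integration.integrable_sum integrable_mult_left) (auto intro!: integrable_real_indicator)
    have "(\<integral>s. F \<omega> s \<partial>lborel) = (\<Sum>i=1..r. d * (Y (real i * d) \<omega> / (real i * d)))" for \<omega>
    proof -
      have "(\<integral>s. F \<omega> s \<partial>lborel) = (\<Sum>i=1..r. \<integral>s. ?cell \<omega> s i \<partial>lborel)"
        unfolding F_def using d
        by (intro Bochner_Integration.integral_sum integrable_mult_left) (auto intro!: integrable_real_indicator)
      also have "\<dots> = (\<Sum>i=1..r. d * (Y (real i * d) \<omega> / (real i * d)))"
      proof (intro sum.cong refl)
        fix i assume i: "i \<in> {1..r}"
        have "real (i - 1) * d \<le> real i * d" using d by (intro mult_right_mono) auto
        then have "measure lborel {real (i - 1) * d..<real i * d} = real i * d - real (i - 1) * d" by simp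
        also have "\<dots> = d" using i by (simp add: of_nat_diff algebra_simps)
        finally show "(\<integral>s. ?cell \<omega> s i \<partial>lborel) = d * (Y (real i * d) \<omega> / (real i * d))"
          by simp
      qed
      finally show ?thesis .
    qed
    then have VF: "(\<integral>s. F \<omega> s \<partial>lborel) = grid_sum t r \<omega>" for \<omega>
      using d by (simp add: grid_sum_def d_def[symmetric])
    have path: "ennreal \<bar>W t \<omega> - grid_sum t r \<omega>\<bar> \<le> (\<integral>\<^sup>+s. ennreal \<bar>Z t \<omega> s - F \<omega> s\<bar> \<partial>lborel)" if \<omega>: "\<omega> \<in> space P" for \<omega>
    proof (cases "(\<integral>\<^sup>+s. ennreal \<bar>Z t \<omega> s - F \<omega> s\<bar> \<partial>lborel) = \<infinity>")
      case False
      have mZ: "Z t \<omega> \<in> borel_measurable lborel"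
        using measurable_compose[OF measurable_Pair1'[OF \<omega>] measurable_Z[of t]] by simp
      have "integrable lborel (\<lambda>s. Z t \<omega> s - F \<omega> s)"
        using False iF[of \<omega>] mZ by (intro integrableI_bounded) (auto simp: top.not_eq_extremum)
      from Bochner_Integration.integrable_add[OF this iF[of \<omega>]] have iZ: "integrable lborel (Z t \<omega>)" by simp
      have "W t \<omega> - grid_sum t r \<omega> = (\<integral>s. Z t \<omega> s - F \<omega> s \<partial>lborel)"
        using iZ iF[of \<omega>] by (simp add: W_eq VF)
      also have "ennreal \<bar>\<dots>\<bar> \<le> (\<integral>\<^sup>+s. ennreal (norm (Z t \<omega> s - F \<omega> s)) \<partial>lborel)"
        using integral_norm_bound_ennreal[OF Bochner_Integration.integrable_diff[OF iZ iF[of \<omega>]]] by simp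
      finally show ?thesis by simp
    qed simp
    have F_eq: "F \<omega> s = Y (next_grid d s) \<omega> / next_grid d s" if s: "0 < s" "s < t" for \<omega> s
    proof -
      define j where "j = nat \<lfloor>s / d\<rfloor> + 1"
      have grid: "next_grid d s = real j * d" by (simp add: next_grid_def j_def)
      have in_iff: "s \<in> {real (i - 1) * d..<real i * d} \<longleftrightarrow> i = j" if "1 \<le> i" for i
      proof -
        have "s \<in> {real (i - 1) * d..<real i * d} \<longleftrightarrow> real (i - 1) \<le> s / d \<and> s / d < real (i - 1) + 1"
          using d that by (auto simp: pos_le_divide_eq pos_divide_less_eq of_nat_diff)
        also have "\<dots> \<longleftrightarrow> \<lfloor>s / d\<rfloor> = int (i - 1)"
          by (simp add: floor_eq_iff)
        also have "\<dots> \<longleftrightarrow> i = j" using s d that by (auto simp: j_def)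
        finally show ?thesis .
      qed
      have "s / d < real r" using s d rd by (simp add: pos_divide_less_eq)
      then have "nat \<lfloor>s / d\<rfloor> < r" using s d by (simp add: nat_less_iff floor_less_iff)
      then have "j \<le> r" by (simp add: j_def)
      then have j: "j \<in> {1..r}" by (simp add: j_def)
      have "F \<omega> s = (\<Sum>i=1..r. if i = j then Y (real i * d) \<omega> / (real i * d) else 0)"
        unfolding F_def using in_iff by (intro sum.cong refl) (auto simp: indicator_def simp del: atLeastLessThan_iff)
      also have "\<dots> = Y (real j * d) \<omega> / (real j * d)" using j by simp
      finally show ?thesis by (simp add: grid)
    qed
    have F_0: "F \<omega> s = 0" if "s < 0 \<or> t \<le> s" for \<omega> s
      unfolding F_def
    proof (intro sum.neutral ballI)
      fix i assume i: "i \<in> {1..r}"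
      have b: "real i * d \<le> real r * d" "0 \<le> real (i - 1) * d" using i d by (auto intro!: mult_right_mono)
      have "s \<notin> {real (i - 1) * d..<real i * d}"
      proof
        assume "s \<in> {real (i - 1) * d..<real i * d}"
        then have "real (i - 1) * d \<le> s" "s < real i * d" by (simp_all only: atLeastLessThan_iff)
        with b that rd show False by linarith
      qed
      then show "?cell \<omega> s i = 0"
        by (simp add: indicator_def del: atLeastLessThan_iff)
    qed
    have Es: "(\<integral>\<^sup>+\<omega>. ennreal \<bar>Z t \<omega> s - F \<omega> s\<bar> \<partial>P) \<le> ennreal (indicator {0..t} s * (2 * C * d powr \<theta> * s powr (\<theta> - 1)))"
      if s: "s \<noteq> 0" "s \<noteq> t" for s
    proof (cases "0 < s \<and> s < t")
      case True
      define v where "v = next_grid d s"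
      have v: "s < v" "v \<le> s + d" "d \<le> v" using True d by (auto simp: v_def intro: next_grid_bounds)
      have s0: "s > 0" "v > 0" using True v by auto
      have iY: "integrable P (\<lambda>\<omega>. \<bar>Y v \<omega> - Y s \<omega>\<bar> / v + \<bar>Y s \<omega>\<bar> * (1 / s - 1 / v))"
        using s0 by (intro Bochner_Integration.integrable_add integrable_divide integrable_mult_left integrable_abs Bochner_Integration.integrable_diff C) auto
      have "(\<integral>\<^sup>+\<omega>. ennreal \<bar>Z t \<omega> s - F \<omega> s\<bar> \<partial>P) \<le> (\<integral>\<^sup>+\<omega>. ennreal (\<bar>Y v \<omega> - Y s \<omega>\<bar> / v + \<bar>Y s \<omega>\<bar> * (1 / s - 1 / v)) \<partial>P)"
      proof (intro nn_integral_mono ennreal_leI)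
        fix \<omega>
        have "Z t \<omega> s - F \<omega> s = - ((Y v \<omega> - Y s \<omega>) / v) + Y s \<omega> * (1 / s - 1 / v)"
          using True F_eq[of s \<omega>] s0 by (simp add: Z_def v_def[symmetric] field_simps)
        also have "\<bar>\<dots>\<bar> \<le> \<bar>- ((Y v \<omega> - Y s \<omega>) / v)\<bar> + \<bar>Y s \<omega> * (1 / s - 1 / v)\<bar>" by (rule abs_triangle_ineq)
        also have "\<dots> = \<bar>Y v \<omega> - Y s \<omega>\<bar> / v + \<bar>Y s \<omega>\<bar> * (1 / s - 1 / v)"
          using s0 v by (simp add: abs_mult abs_divide divide_left_mono)
        finally show "\<bar>Z t \<omega> s - F \<omega> s\<bar> \<le> \<bar>Y v \<omega> - Y s \<omega>\<bar> / v + \<bar>Y s \<omega>\<bar> * (1 / s - 1 / v)" .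
      qed
      also have "\<dots> = ennreal (expectation (\<lambda>\<omega>. \<bar>Y v \<omega> - Y s \<omega>\<bar> / v + \<bar>Y s \<omega>\<bar> * (1 / s - 1 / v)))"
        using s0 v by (intro nn_integral_eq_integral iY AE_I2) (auto intro!: add_nonneg_nonneg mult_nonneg_nonneg simp: divide_left_mono)
      also have "expectation (\<lambda>\<omega>. \<bar>Y v \<omega> - Y s \<omega>\<bar> / v + \<bar>Y s \<omega>\<bar> * (1 / s - 1 / v))
          = expectation (\<lambda>\<omega>. \<bar>Y v \<omega> - Y s \<omega>\<bar>) / v + expectation (\<lambda>\<omega>. \<bar>Y s \<omega>\<bar>) * (1 / s - 1 / v)"
        using s0 C(2)[of v] C(2)[of s] by simp
      also have "\<dots> \<le> C * (v - s) powr (2 * \<theta>) / v + C * s powr (2 * \<theta>) * (1 / s - 1 / v)"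
        using s0 v C(3)[of s] \<theta> inc[of s v]
        by (intro add_mono divide_right_mono mult_right_mono) (auto simp: divide_left_mono)
      also have "\<dots> = C * ((v - s) powr (2 * \<theta>) / v + s powr (2 * \<theta>) * (1 / s - 1 / v))"
        by (simp add: distrib_left)
      also have "\<dots> \<le> C * (2 * (d powr \<theta> * s powr (\<theta> - 1)))"
        using s0 v d \<theta> C by (intro mult_left_mono increment_quotient_le) auto
      finally show ?thesis using True by (simp add: mult_ac ennreal_leI)
    next
      case False
      then have "F \<omega> s = 0" "Z t \<omega> s = 0" for \<omega>
        using s F_0[of s \<omega>] by (auto simp: Z_def)
      then show ?thesis by simp
    qed
    interpret PL: pair_sigma_finite P lborel ..
    have "(\<integral>\<^sup>+\<omega>. ennreal \<bar>W t \<omega> - grid_sum t r \<omega>\<bar> \<partial>P) \<le> (\<integral>\<^sup>+\<omega>. (\<integral>\<^sup>+s. ennreal \<bar>Z t \<omega> s - F \<omega> s\<bar> \<partial>lborel) \<partial>P)"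
      by (intro nn_integral_mono path)
    also have "\<dots> = (\<integral>\<^sup>+s. (\<integral>\<^sup>+\<omega>. ennreal \<bar>Z t \<omega> s - F \<omega> s\<bar> \<partial>P) \<partial>lborel)"
      using measurable_Z[of t] mF by (intro PL.Fubini'[symmetric]) (simp add: split_beta')
    also have "\<dots> \<le> (\<integral>\<^sup>+s. ennreal (indicator {0..t} s * (2 * C * d powr \<theta> * s powr (\<theta> - 1))) \<partial>lborel)"
    proof (rule nn_integral_mono_AE)
      have "AE s in lborel. s \<noteq> (0::real)" "AE s in lborel. s \<noteq> t" by (rule AE_lborel_singleton)+
      then show "AE s in lborel. (\<integral>\<^sup>+\<omega>. ennreal \<bar>Z t \<omega> s - F \<omega> s\<bar> \<partial>P)
          \<le> ennreal (indicator {0..t} s * (2 * C * d powr \<theta> * s powr (\<theta> - 1)))"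
        by eventually_elim (rule Es)
    qed
    also have "\<dots> = ennreal (2 * C * d powr \<theta> * (t powr \<theta> / \<theta>))"
    proof (rule nn_integral_has_integral_lebesgue)
      have "((\<lambda>s. 2 * C * d powr \<theta> * s powr (\<theta> - 1)) has_integral 2 * C * d powr \<theta> * (t powr (\<theta> - 1 + 1) / (\<theta> - 1 + 1))) {0..t}"
        using \<theta> t by (intro has_integral_mult_right has_integral_powr_from_0) auto
      then show "((\<lambda>s. 2 * C * d powr \<theta> * s powr (\<theta> - 1)) has_integral 2 * C * d powr \<theta> * (t powr \<theta> / \<theta>)) {0..t}"
        by simp
    qed (use C in simp)
    finally show ?thesis by (simp add: B_def d_def)
  qed
  have i: "integrable P (\<lambda>\<omega>. \<bar>W t \<omega> - grid_sum t r \<omega>\<bar>)" if r: "1 \<le> r" for r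
    using main[OF r] measurable_grid_sum[OF t, of r]
    by (intro integrableI_bounded) (auto intro: le_less_trans)
  have E: "expectation (\<lambda>\<omega>. \<bar>W t \<omega> - grid_sum t r \<omega>\<bar>) \<le> 2 * C * t powr \<theta> * (t powr \<theta> / \<theta>) * (1 / real r) powr (1 / (2 * \<alpha>))" if r: "1 \<le> r" for r
  proof -
    have "ennreal (expectation (\<lambda>\<omega>. \<bar>W t \<omega> - grid_sum t r \<omega>\<bar>)) \<le> ennreal (B r)"
      using main[OF r] nn_integral_eq_integral[OF i[OF r]] by simp
    then have "expectation (\<lambda>\<omega>. \<bar>W t \<omega> - grid_sum t r \<omega>\<bar>) \<le> B r" using B0 by (simp add: ennreal_le_iff)
    then show ?thesis unfolding \<theta>_def[symmetric] by (simp add: B_def powr_divide mult_ac)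
  qed
  show ?thesis by (rule that[OF i E])
qed

lemma expectation_W_minus_grid_sum_tendsto:
  assumes t: "0 < t"
  shows "(\<lambda>r. expectation (\<lambda>\<omega>. \<bar>W t \<omega> - grid_sum t r \<omega>\<bar>)) \<longlonglongrightarrow> 0"
    and "1 \<le> r \<Longrightarrow> integrable P (\<lambda>\<omega>. \<bar>W t \<omega> - grid_sum t r \<omega>\<bar>)"
proof -
  obtain C where C: "\<And>r. 1 \<le> r \<Longrightarrow> integrable P (\<lambda>\<omega>. \<bar>W t \<omega> - grid_sum t r \<omega>\<bar>)"
    "\<And>r. 1 \<le> r \<Longrightarrow> expectation (\<lambda>\<omega>. \<bar>W t \<omega> - grid_sum t r \<omega>\<bar>) \<le> C * (1 / real r) powr (1 / (2 * \<alpha>))"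
    using expectation_W_minus_grid_sum[OF t] by metis
  have "(\<lambda>r. C * (1 / real r) powr (1 / (2 * \<alpha>))) \<longlonglongrightarrow> C * 0"
    using \<alpha>_gt_1 by (intro tendsto_intros tendsto_zero_powrI[OF lim_1_over_n tendsto_const]) auto
  then have lim: "(\<lambda>r. C * (1 / real r) powr (1 / (2 * \<alpha>))) \<longlonglongrightarrow> 0" by simp
  show "(\<lambda>r. expectation (\<lambda>\<omega>. \<bar>W t \<omega> - grid_sum t r \<omega>\<bar>)) \<longlonglongrightarrow> 0"
  proof (rule tendsto_sandwich[OF _ _ tendsto_const lim])
    show "eventually (\<lambda>r. expectation (\<lambda>\<omega>. \<bar>W t \<omega> - grid_sum t r \<omega>\<bar>) \<le> C * (1 / real r) powr (1 / (2 * \<alpha>))) sequentially"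
      using eventually_ge_at_top[of 1] by eventually_elim (rule C(2))
  qed simp
  show "1 \<le> r \<Longrightarrow> integrable P (\<lambda>\<omega>. \<bar>W t \<omega> - grid_sum t r \<omega>\<bar>)" by (rule C)
qed

lemma expectation_Lipschitz_grid_sum_tendsto:
  fixes g :: "real \<Rightarrow> 'c :: {banach, second_countable_topology}"
  assumes t: "0 < t" and g1: "\<And>x. norm (g x) \<le> 1" and lip: "\<And>x y. norm (g x - g y) \<le> K * \<bar>x - y\<bar>"
    and [measurable]: "g \<in> borel_measurable borel"
  shows "(\<lambda>r. integral\<^sup>L P (\<lambda>\<omega>. g (grid_sum t r \<omega>))) \<longlonglongrightarrow> integral\<^sup>L P (\<lambda>\<omega>. g (W t \<omega>))"
proof -
  have "(\<lambda>r. K * expectation (\<lambda>\<omega>. \<bar>W t \<omega> - grid_sum t r \<omega>\<bar>)) \<longlonglongrightarrow> K * 0"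
    by (intro tendsto_intros expectation_W_minus_grid_sum_tendsto t)
  then have lim: "(\<lambda>r. K * expectation (\<lambda>\<omega>. \<bar>W t \<omega> - grid_sum t r \<omega>\<bar>)) \<longlonglongrightarrow> 0" by simp
  have ig: "integrable P (\<lambda>\<omega>. g (f \<omega>))" if [measurable]: "random_variable borel f" for f
    by (rule integrable_const_bound[of _ 1]) (auto simp: g1)
  have "norm (integral\<^sup>L P (\<lambda>\<omega>. g (grid_sum t r \<omega>)) - integral\<^sup>L P (\<lambda>\<omega>. g (W t \<omega>))) \<le> K * expectation (\<lambda>\<omega>. \<bar>W t \<omega> - grid_sum t r \<omega>\<bar>)"
    if r: "1 \<le> r" for r
  proof -
    have "integral\<^sup>L P (\<lambda>\<omega>. g (grid_sum t r \<omega>)) - integral\<^sup>L P (\<lambda>\<omega>. g (W t \<omega>)) = (\<integral>\<omega>. g (grid_sum t r \<omega>) - g (W t \<omega>) \<partial>P)"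
      using t by (intro Bochner_Integration.integral_diff[symmetric] ig) auto
    also have "norm \<dots> \<le> (\<integral>\<omega>. norm (g (grid_sum t r \<omega>) - g (W t \<omega>)) \<partial>P)"
      by (rule integral_norm_bound)
    also have "\<dots> \<le> (\<integral>\<omega>. K * \<bar>W t \<omega> - grid_sum t r \<omega>\<bar> \<partial>P)"
    proof (rule integral_mono)
      show "integrable P (\<lambda>\<omega>. norm (g (grid_sum t r \<omega>) - g (W t \<omega>)))"
        using t by (intro integrable_norm Bochner_Integration.integrable_diff ig) auto
      show "integrable P (\<lambda>\<omega>. K * \<bar>W t \<omega> - grid_sum t r \<omega>\<bar>)"
        by (intro integrable_mult_right expectation_W_minus_grid_sum_tendsto t r)
      show "norm (g (grid_sum t r \<omega>) - g (W t \<omega>)) \<le> K * \<bar>W t \<omega> - grid_sum t r \<omega>\<bar>" for \<omega>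
        using lip[of "grid_sum t r \<omega>" "W t \<omega>"] by (simp add: abs_minus_commute)
    qed
    finally show ?thesis by simp
  qed
  then have "eventually (\<lambda>r. norm (integral\<^sup>L P (\<lambda>\<omega>. g (grid_sum t r \<omega>)) - integral\<^sup>L P (\<lambda>\<omega>. g (W t \<omega>)))
      \<le> K * expectation (\<lambda>\<omega>. \<bar>W t \<omega> - grid_sum t r \<omega>\<bar>)) sequentially"
    by (rule eventually_sequentiallyI)
  then have "(\<lambda>r. integral\<^sup>L P (\<lambda>\<omega>. g (grid_sum t r \<omega>)) - integral\<^sup>L P (\<lambda>\<omega>. g (W t \<omega>))) \<longlonglongrightarrow> 0"
    by (rule Lim_null_comparison[OF _ lim])
  then show ?thesis by (simp add: LIM_zero_iff)
qed

text \<open>At least half of the weights \<open>harm_tail r i\<close> are at least \<open>1/2\<close>, which gives a bound for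
  the characteristic functions of the approximating sums that does not depend on \<open>r\<close> and
  passes to the limit.\<close>

lemma norm_char_W_le:
  assumes t: "0 < t"
  shows "norm (char (distr P borel (W t)) u) \<le> exp (- (t / 2 * Re (\<Lambda> 1) * (1 / 2) powr \<alpha> * \<bar>u\<bar> powr \<alpha>))"
proof -
  let ?b = "exp (- (t / 2 * Re (\<Lambda> 1) * (1 / 2) powr \<alpha> * \<bar>u\<bar> powr \<alpha>))"
  have iexp_lip: "norm (iexp (u * x) - iexp (u * y)) \<le> \<bar>u\<bar> * \<bar>x - y\<bar>" for x y :: real
  proof -
    have "iexp (u * x) - iexp (u * y) = iexp (u * y) * (iexp (u * x - u * y) - 1)"
      by (simp add: algebra_simps exp_add[symmetric])
    then have "norm (iexp (u * x) - iexp (u * y)) = norm (iexp (u * x - u * y) - 1)" by (simp add: norm_mult)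
    also have "\<dots> \<le> \<bar>u * x - u * y\<bar>" using iexp_approx1[of "u * x - u * y" 0] by simp
    also have "\<dots> = \<bar>u\<bar> * \<bar>x - y\<bar>" by (simp add: right_diff_distrib[symmetric] abs_mult)
    finally show ?thesis .
  qed
  have "(\<lambda>r. CLINT \<omega>|P. iexp (u * grid_sum t r \<omega>)) \<longlonglongrightarrow> (CLINT \<omega>|P. iexp (u * W t \<omega>))"
    by (rule expectation_Lipschitz_grid_sum_tendsto[OF t _ iexp_lip]) auto
  then have "(\<lambda>r. char (distr P borel (grid_sum t r)) u) \<longlonglongrightarrow> char (distr P borel (W t)) u"
    unfolding char_def using t by (simp add: integral_distr)
  then have lim: "(\<lambda>r. norm (char (distr P borel (grid_sum t r)) u)) \<longlonglongrightarrow> norm (char (distr P borel (W t)) u)"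
    by (rule tendsto_norm)
  have "norm (char (distr P borel (grid_sum t r)) u) \<le> ?b" if r: "1 \<le> r" for r
  proof -
    define I where "I = {1..r} \<inter> {i. 2 * i \<le> r + 2}"
    have cI: "real r / 2 \<le> real (card I)"
    proof -
      have "{1..(r + 1) div 2} \<subseteq> I" using r by (auto simp: I_def)
      then have "(r + 1) div 2 \<le> card I" using card_mono[of I "{1..(r + 1) div 2}"] by (simp add: I_def)
      then show ?thesis by linarith
    qed
    have nn: "0 \<le> Re (\<Lambda> v)" for v
      using Re_stable_exponent[of \<alpha> v] Re_stable_exponent_1_pos[of \<alpha>] by simp
    have "real r / 2 * (Re (\<Lambda> 1) * (\<bar>u\<bar> * (1 / 2)) powr \<alpha>) \<le> real (card I) * (Re (\<Lambda> 1) * (\<bar>u\<bar> * (1 / 2)) powr \<alpha>)"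
      using cI Re_stable_exponent_1_pos[of \<alpha>] by (intro mult_right_mono) auto
    also have "real (card I) * (Re (\<Lambda> 1) * (\<bar>u\<bar> * (1 / 2)) powr \<alpha>) = (\<Sum>i\<in>I. Re (\<Lambda> 1) * (\<bar>u\<bar> * (1 / 2)) powr \<alpha>)"
      by simp
    also have "\<dots> \<le> (\<Sum>i\<in>I. Re (\<Lambda> (u * harm_tail r i)))"
    proof (rule sum_mono)
      fix i assume "i \<in> I"
      then have "1 / 2 \<le> harm_tail r i" using harm_tail_ge_half[of r i] r by (auto simp: I_def)
      then have "(\<bar>u\<bar> * (1 / 2)) powr \<alpha> \<le> \<bar>u * harm_tail r i\<bar> powr \<alpha>"
        unfolding abs_mult using \<alpha>_gt_1 by (intro powr_mono2 mult_left_mono) auto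
      then show "Re (\<Lambda> 1) * (\<bar>u\<bar> * (1 / 2)) powr \<alpha> \<le> Re (\<Lambda> (u * harm_tail r i))"
        unfolding Re_stable_exponent[of \<alpha> "u * harm_tail r i"]
        using Re_stable_exponent_1_pos[of \<alpha>] by (intro mult_left_mono) auto
    qed
    also have "\<dots> \<le> (\<Sum>i=1..r. Re (\<Lambda> (u * harm_tail r i)))"
      by (intro sum_mono2) (auto simp: I_def nn)
    finally have "t / real r * (real r / 2 * (Re (\<Lambda> 1) * (\<bar>u\<bar> * (1 / 2)) powr \<alpha>))
        \<le> t / real r * (\<Sum>i=1..r. Re (\<Lambda> (u * harm_tail r i)))"
      using t by (intro mult_left_mono) auto
    moreover have "t / real r * (real r / 2 * (Re (\<Lambda> 1) * (\<bar>u\<bar> * (1 / 2)) powr \<alpha>))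
        = t / 2 * Re (\<Lambda> 1) * (1 / 2) powr \<alpha> * \<bar>u\<bar> powr \<alpha>"
      unfolding powr_mult[of "\<bar>u\<bar>"] using r by (simp add: mult_ac)
    ultimately have "t / 2 * Re (\<Lambda> 1) * (1 / 2) powr \<alpha> * \<bar>u\<bar> powr \<alpha> \<le> t / real r * (\<Sum>i=1..r. Re (\<Lambda> (u * harm_tail r i)))"
      by (simp only:)
    then show ?thesis
      unfolding char_grid_sum[OF t r] norm_exp_eq_Re by (simp add: sum_distrib_left)
  qed
  then show ?thesis
    by (intro LIMSEQ_le_const2[OF lim]) auto
qed

lemma measure_W_singleton:
  assumes t: "0 < t"
  shows "measure (distr P borel (W t)) {x} = 0"
proof -
  interpret d: real_distribution "distr P borel (W t)" by (intro real_distribution_distr) simp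
  define c where "c = t / 2 * Re (\<Lambda> 1) * (1 / 2) powr \<alpha>"
  have c: "c > 0" using t Re_stable_exponent_1_pos[of \<alpha>] by (simp add: c_def)
  have "filterlim (\<lambda>u::real. c * \<bar>u\<bar> powr \<alpha>) at_top at_infinity"
  proof (rule filterlim_at_top_mono)
    show "filterlim (\<lambda>u::real. c * \<bar>u\<bar>) at_top at_infinity"
      using filterlim_tendsto_pos_mult_at_top[OF tendsto_const c filterlim_norm_at_top[where 'a=real]] by simp
    show "eventually (\<lambda>u::real. c * \<bar>u\<bar> \<le> c * \<bar>u\<bar> powr \<alpha>) at_infinity"
      unfolding eventually_at_infinity
    proof (intro exI[of _ 1] allI impI)
      fix u :: real assume "1 \<le> norm u"
      then have "\<bar>u\<bar> powr 1 \<le> \<bar>u\<bar> powr \<alpha>" using \<alpha>_gt_1 by (intro powr_mono) auto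
      then show "c * \<bar>u\<bar> \<le> c * \<bar>u\<bar> powr \<alpha>" using c by simp
    qed
  qed
  then have "filterlim (\<lambda>u::real. - (c * \<bar>u\<bar> powr \<alpha>)) at_bot at_infinity"
    unfolding filterlim_uminus_at_bot by simp
  then have "((\<lambda>u::real. exp (- (c * \<bar>u\<bar> powr \<alpha>))) \<longlongrightarrow> 0) at_infinity"
    by (rule filterlim_compose[OF exp_at_bot])
  then have "(char (distr P borel (W t)) \<longlongrightarrow> 0) at_infinity"
    by (rule Lim_null_comparison[rotated]) (use norm_char_W_le[OF t] in \<open>auto simp: c_def intro!: always_eventually\<close>)
  then show ?thesis by (rule d.measure_singleton_eq_0)
qed

end

section \<open>From Lipschitz functions to distribution functions\<close>

definition ramp :: "real \<Rightarrow> real \<Rightarrow> real \<Rightarrow> real" where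
  "ramp y \<delta> z = max 0 (min 1 (1 + (y - z) / \<delta>))"

lemma abs_ramp_le_1: "\<bar>ramp y \<delta> z\<bar> \<le> 1"
  by (simp add: ramp_def)

lemma ramp_Lipschitz:
  assumes "0 < \<delta>"
  shows "\<bar>ramp y \<delta> z - ramp y \<delta> w\<bar> \<le> 1 / \<delta> * \<bar>z - w\<bar>"
proof -
  have "\<bar>max 0 (min 1 (1 + p)) - max 0 (min 1 (1 + q))\<bar> \<le> \<bar>p - q\<bar>" for p q :: real
    by (simp add: max_def min_def abs_if)
  then have "\<bar>ramp y \<delta> z - ramp y \<delta> w\<bar> \<le> \<bar>(y - z) / \<delta> - (y - w) / \<delta>\<bar>"
    unfolding ramp_def .
  also have "(y - z) / \<delta> - (y - w) / \<delta> = (w - z) / \<delta>" by (simp add: diff_divide_distrib)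
  finally show ?thesis using assms by (simp add: abs_divide abs_minus_commute)
qed

lemma ramp_eq_1: "0 < \<delta> \<Longrightarrow> z \<le> y \<Longrightarrow> ramp y \<delta> z = 1"
  by (simp add: ramp_def)

lemma ramp_eq_0: "0 < \<delta> \<Longrightarrow> y + \<delta> \<le> z \<Longrightarrow> ramp y \<delta> z = 0"
  by (simp add: ramp_def field_simps)

lemma measurable_ramp [measurable]: "ramp y \<delta> \<in> borel_measurable borel"
  unfolding ramp_def[abs_def] by measurable

lemma eventually_inverse_Suc_less:
  assumes "0 < e"
  shows "eventually (\<lambda>j. 1 / real (Suc j) < e) sequentially"
  using order_tendstoD(2)[OF LIMSEQ_Suc[OF lim_1_over_n] assms] .

lemma ramp_tendsto_atMost: "(\<lambda>j. ramp y (1 / real (Suc j)) z) \<longlonglongrightarrow> indicator {..y} z"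
proof (cases "z \<le> y")
  case True
  then show ?thesis by (simp add: ramp_eq_1)
next
  case False
  have "eventually (\<lambda>j. ramp y (1 / real (Suc j)) z = 0) sequentially"
    using eventually_inverse_Suc_less[of "z - y"] False
    by (auto elim!: eventually_mono intro!: ramp_eq_0 simp del: of_nat_Suc)
  then show ?thesis using False by (simp add: tendsto_eventually)
qed

lemma ramp_tendsto_lessThan:
  "(\<lambda>j. ramp (y - 1 / real (Suc j)) (1 / real (Suc j)) z) \<longlonglongrightarrow> indicator {..<y} z"
proof (cases "z < y")
  case True
  have "eventually (\<lambda>j. ramp (y - 1 / real (Suc j)) (1 / real (Suc j)) z = 1) sequentially"
    using eventually_inverse_Suc_less[of "y - z"] True
    by (auto elim!: eventually_mono intro!: ramp_eq_1 simp del: of_nat_Suc)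
  then show ?thesis using True by (simp add: tendsto_eventually)
next
  case False
  then show ?thesis by (simp add: ramp_eq_0)
qed

text \<open>The indicator of \<open>{..y}\<close> lies between two ramps whose integrals converge to the masses of
  \<open>{..<y}\<close> and \<open>{..y}\<close>, and these agree because \<open>y\<close> is not an atom.\<close>

lemma log_avg_indicator_tendsto:
  fixes v :: "nat \<Rightarrow> real"
  assumes \<nu>: "real_distribution \<nu>" and atom: "measure \<nu> {y} = 0"
    and up: "\<And>j. log_avg (\<lambda>n. ramp y (1 / real (Suc j)) (v n)) \<longlonglongrightarrow> (\<integral>z. ramp y (1 / real (Suc j)) z \<partial>\<nu>)"
    and low: "\<And>j. log_avg (\<lambda>n. ramp (y - 1 / real (Suc j)) (1 / real (Suc j)) (v n))
      \<longlonglongrightarrow> (\<integral>z. ramp (y - 1 / real (Suc j)) (1 / real (Suc j)) z \<partial>\<nu>)"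
  shows "log_avg (\<lambda>n. indicator {..y} (v n)) \<longlonglongrightarrow> measure \<nu> {..y}"
proof -
  interpret real_distribution \<nu> by fact
  have Up: "(\<lambda>j. \<integral>z. ramp y (1 / real (Suc j)) z \<partial>\<nu>) \<longlonglongrightarrow> (\<integral>z. indicator {..y} z \<partial>\<nu>)"
    by (rule integral_dominated_convergence[where w="\<lambda>_. 1"])
      (use abs_ramp_le_1 ramp_tendsto_atMost in auto)
  have Low: "(\<lambda>j. \<integral>z. ramp (y - 1 / real (Suc j)) (1 / real (Suc j)) z \<partial>\<nu>) \<longlonglongrightarrow> (\<integral>z. indicator {..<y} z \<partial>\<nu>)"
    by (rule integral_dominated_convergence[where w="\<lambda>_. 1"])
      (use abs_ramp_le_1 ramp_tendsto_lessThan in auto)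
  have "measure \<nu> {..y} = measure \<nu> ({..<y} \<union> {y})" by (rule arg_cong[where f="measure \<nu>"]) auto
  also have "\<dots> = measure \<nu> {..<y}" using atom by (subst finite_measure_Union) auto
  finally have eq: "measure \<nu> {..<y} = measure \<nu> {..y}" by simp
  show ?thesis
  proof (rule order_tendstoI)
    fix c assume "measure \<nu> {..y} < c"
    then have "eventually (\<lambda>j. (\<integral>z. ramp y (1 / real (Suc j)) z \<partial>\<nu>) < c) sequentially"
      by (intro order_tendstoD(2)[OF Up]) simp
    then obtain j where "(\<integral>z. ramp y (1 / real (Suc j)) z \<partial>\<nu>) < c" by (auto simp: eventually_sequentially)
    from order_tendstoD(2)[OF up this]
    show "eventually (\<lambda>N. log_avg (\<lambda>n. indicator {..y} (v n)) N < c) sequentially"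
    proof eventually_elim
      case (elim N)
      have "log_avg (\<lambda>n. indicator {..y} (v n)) N \<le> log_avg (\<lambda>n. ramp y (1 / real (Suc j)) (v n)) N"
        by (rule log_avg_mono) (auto simp: indicator_def ramp_eq_1, simp add: ramp_def)
      with elim show ?case by linarith
    qed
  next
    fix c assume "c < measure \<nu> {..y}"
    then have "eventually (\<lambda>j. c < (\<integral>z. ramp (y - 1 / real (Suc j)) (1 / real (Suc j)) z \<partial>\<nu>)) sequentially"
      using eq by (intro order_tendstoD(1)[OF Low]) simp
    then obtain j where "c < (\<integral>z. ramp (y - 1 / real (Suc j)) (1 / real (Suc j)) z \<partial>\<nu>)" by (auto simp: eventually_sequentially)
    from order_tendstoD(1)[OF low this]
    show "eventually (\<lambda>N. c < log_avg (\<lambda>n. indicator {..y} (v n)) N) sequentially"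
    proof eventually_elim
      case (elim N)
      have "log_avg (\<lambda>n. ramp (y - 1 / real (Suc j)) (1 / real (Suc j)) (v n)) N \<le> log_avg (\<lambda>n. indicator {..y} (v n)) N"
      proof (rule log_avg_mono)
        fix n
        show "ramp (y - 1 / real (Suc j)) (1 / real (Suc j)) (v n) \<le> indicator {..y} (v n)"
          using abs_ramp_le_1[of "y - 1 / real (Suc j)" "1 / real (Suc j)" "v n"]
            ramp_eq_0[of "1 / real (Suc j)" "y - 1 / real (Suc j)" "v n"]
          by (auto simp: indicator_def simp del: of_nat_Suc)
      qed
      with elim show ?case by linarith
    qed
  qed
qed

section \<open>The almost sure limit theorem\<close>

locale attracted_sums_with_process = attracted_sums M X a L \<alpha> \<mu> + W: stable_process P Y L \<alpha>
  for M :: "'a measure" and X a L \<alpha> \<mu> and P :: "'b measure" and Y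
begin

text \<open>Replacing \<open>T\<close> by \<open>T + R\<close> changes the logarithmic average of a Lipschitz function by at most a
  multiple of the logarithmic average of \<open>\<bar>R\<bar>\<close>, which vanishes in the limit.\<close>

lemma AE_log_avg_Lipschitz:
  fixes g :: "real \<Rightarrow> real"
  assumes t: "0 < t" "t \<le> 1" and g1: "\<And>x. \<bar>g x\<bar> \<le> 1" and lip: "\<And>x y. \<bar>g x - g y\<bar> \<le> K * \<bar>x - y\<bar>"
    and [measurable]: "g \<in> borel_measurable borel"
  shows "AE \<omega> in M. log_avg (\<lambda>n. g (T n (nat \<lfloor>real n * t\<rfloor>) \<omega> + R n (nat \<lfloor>real n * t\<rfloor>) \<omega>))
    \<longlonglongrightarrow> (\<integral>z. g z \<partial>distr P borel (W.W t))"
proof -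
  define m where "m n = nat \<lfloor>real n * t\<rfloor>" for n
  have m: "m n \<le> n" for n
  proof -
    have "real n * t \<le> real n * 1" using t by (intro mult_left_mono) auto
    then show ?thesis unfolding m_def by linarith
  qed
  define e where "e = (\<integral>z. g z \<partial>distr P borel (W.W t))"
  have "(\<lambda>n. expectation (\<lambda>\<omega>. g (T n (m n) \<omega>))) \<longlonglongrightarrow> e"
    unfolding m_def
  proof (rule expectation_T_tendsto[OF t _ _ _ g1 lip])
    show "real_distribution (distr P borel (W.grid_sum t r))" for r
      using t by (intro W.real_distribution_distr) simp
    show "char (distr P borel (W.grid_sum t r)) u = exp (- (\<Sum>i=1..r. complex_of_real (t / real r) * \<Lambda> (u * harm_tail r i)))"
      if "1 \<le> r" for r u
      by (rule W.char_grid_sum[OF t(1) that])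
    show "(\<lambda>r. integral\<^sup>L (distr P borel (W.grid_sum t r)) g) \<longlonglongrightarrow> e"
      using W.expectation_Lipschitz_grid_sum_tendsto[OF t(1), of g K] g1 lip t
      by (simp add: integral_distr e_def)
  qed
  then have mean_lim: "log_avg (\<lambda>n. expectation (\<lambda>\<omega>. g (T n (m n) \<omega>))) \<longlonglongrightarrow> e" by (rule log_avg_tendsto)
  have "AE \<omega> in M. log_avg (\<lambda>n. g (T n (m n) \<omega>) - expectation (\<lambda>\<omega>. g (T n (m n) \<omega>))) \<longlonglongrightarrow> 0"
    using m g1 lip by (intro AE_log_avg_centred) auto
  moreover have "AE \<omega> in M. log_avg (\<lambda>n. \<bar>R n (m n) \<omega>\<bar>) \<longlonglongrightarrow> 0" by (rule AE_log_avg_R[OF m])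
  ultimately show ?thesis
    unfolding m_def[symmetric] e_def[symmetric]
  proof eventually_elim
    case (elim \<omega>)
    define \<Delta> where "\<Delta> n = g (T n (m n) \<omega> + R n (m n) \<omega>) - g (T n (m n) \<omega>)" for n
    have "(\<lambda>N. K * log_avg (\<lambda>n. \<bar>R n (m n) \<omega>\<bar>) N) \<longlonglongrightarrow> K * 0" by (intro tendsto_intros elim)
    then have lim: "(\<lambda>N. K * log_avg (\<lambda>n. \<bar>R n (m n) \<omega>\<bar>) N) \<longlonglongrightarrow> 0" by simp
    have "norm (log_avg \<Delta> N) \<le> K * log_avg (\<lambda>n. \<bar>R n (m n) \<omega>\<bar>) N" for N
    proof -
      have "\<bar>\<Delta> n\<bar> \<le> K * \<bar>R n (m n) \<omega>\<bar>" for n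
        using lip[of "T n (m n) \<omega> + R n (m n) \<omega>" "T n (m n) \<omega>"] by (simp add: \<Delta>_def)
      then have "log_avg (\<lambda>n. \<bar>\<Delta> n\<bar>) N \<le> log_avg (\<lambda>n. K * \<bar>R n (m n) \<omega>\<bar>) N" by (intro log_avg_mono)
      then show ?thesis using log_avg_abs_le[of \<Delta> N] by (simp add: log_avg_cmult)
    qed
    then have "log_avg \<Delta> \<longlonglongrightarrow> 0" by (intro Lim_null_comparison[OF always_eventually lim]) simp
    from tendsto_add[OF tendsto_add[OF elim(1) mean_lim] this]
    show ?case by (simp add: log_avg_add[symmetric] \<Delta>_def)
  qed
qed

text \<open>The case \<open>t = 0\<close> is separate because \<open>W 0\<close> vanishes, so that its law has an atom; there all terms
  of the average are equal.\<close>

lemma AE_log_avg_indicator: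
  assumes t: "0 \<le> t" "t \<le> 1"
  shows "AE \<omega> in M. log_avg (\<lambda>n. indicator {..y} (T n (nat \<lfloor>real n * t\<rfloor>) \<omega> + R n (nat \<lfloor>real n * t\<rfloor>) \<omega>))
    \<longlonglongrightarrow> measure (distr P borel (W.W t)) {..y}"
proof (cases "t = 0")
  case True
  have W0: "W.W 0 = (\<lambda>\<omega>. 0)" by (simp add: W.W_eq fun_eq_iff W.Z_def)
  have "measure (distr P borel (W.W 0)) {..y} = indicator {..y} 0"
    unfolding W0 by (simp add: measure_return)
  then show ?thesis
    using True log_avg_const[of "indicator {..y} 0"] by (simp add: T_def R_def)
next
  case False
  then have t0: "0 < t" using t by simp
  let ?v = "\<lambda>\<omega> n. T n (nat \<lfloor>real n * t\<rfloor>) \<omega> + R n (nat \<lfloor>real n * t\<rfloor>) \<omega>"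
  have "AE \<omega> in M. log_avg (\<lambda>n. ramp z \<delta> (?v \<omega> n)) \<longlonglongrightarrow> (\<integral>x. ramp z \<delta> x \<partial>distr P borel (W.W t))"
    if "0 < \<delta>" for z \<delta>
    using abs_ramp_le_1 ramp_Lipschitz[OF that] by (intro AE_log_avg_Lipschitz t0 t measurable_ramp)
  then have "AE \<omega> in M. \<forall>j. log_avg (\<lambda>n. ramp y (1 / real (Suc j)) (?v \<omega> n)) \<longlonglongrightarrow> (\<integral>x. ramp y (1 / real (Suc j)) x \<partial>distr P borel (W.W t))"
    "AE \<omega> in M. \<forall>j. log_avg (\<lambda>n. ramp (y - 1 / real (Suc j)) (1 / real (Suc j)) (?v \<omega> n))
      \<longlonglongrightarrow> (\<integral>x. ramp (y - 1 / real (Suc j)) (1 / real (Suc j)) x \<partial>distr P borel (W.W t))"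
    unfolding AE_all_countable by simp_all
  then show ?thesis
  proof eventually_elim
    case (elim \<omega>)
    show ?case
      by (rule log_avg_indicator_tendsto)
        (use elim in \<open>auto intro!: W.real_distribution_distr W.measure_W_singleton t0 simp del: of_nat_Suc\<close>)
  qed
qed

lemma AE_sum_product_cdf:
  assumes t: "0 \<le> t" "t \<le> 1"
  shows "AE \<omega> in M. (\<lambda>N. 1 / clog (real N) *
        (\<Sum>n=1..N. 1 / real n * indicator {\<omega> \<in> space M. sum_product X \<mu> a n t \<omega> \<le> x} \<omega>))
      \<longlonglongrightarrow> exp_integral_cdf P Y t x"
proof -
  have X_pos': "AE \<omega> in M. \<forall>k\<in>{1..}. X k \<omega> > 0"
    by (subst AE_ball_countable) (auto intro: X_pos)
  have cdf: "exp_integral_cdf P Y t x = W.prob {\<omega> \<in> space P. exp (W.W t \<omega>) \<le> x}"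
    unfolding exp_integral_cdf_def W.W_def[symmetric] cdf_def
    by (subst measure_distr) (auto intro!: arg_cong[where f="measure P"])
  let ?v = "\<lambda>n \<omega>. T n (nat \<lfloor>real n * t\<rfloor>) \<omega> + R n (nat \<lfloor>real n * t\<rfloor>) \<omega>"
  have log_avg_eq: "1 / clog (real N) * (\<Sum>n=1..N. 1 / real n * indicator {\<omega> \<in> space M. sum_product X \<mu> a n t \<omega> \<le> x} \<omega>)
      = log_avg (\<lambda>n. of_bool (exp (?v n \<omega>) \<le> x)) N"
    if "\<omega> \<in> space M" "\<forall>k\<in>{1..}. X k \<omega> > 0" for \<omega> N
  proof -
    have "indicator {\<omega> \<in> space M. sum_product X \<mu> a n t \<omega> \<le> x} \<omega> = (of_bool (exp (?v n \<omega>) \<le> x) :: real)" if "1 \<le> n" for n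
      using sum_product_eq_exp[OF that, of \<omega> t] \<open>\<omega> \<in> space M\<close> \<open>\<forall>k\<in>{1..}. X k \<omega> > 0\<close>
      by (simp add: indicator_def)
    then have "(\<Sum>n=1..N. 1 / real n * indicator {\<omega> \<in> space M. sum_product X \<mu> a n t \<omega> \<le> x} \<omega>)
        = (\<Sum>n=1..N. of_bool (exp (?v n \<omega>) \<le> x) / real n)"
      by (intro sum.cong refl) simp
    then show ?thesis by (simp add: log_avg_def)
  qed
  show ?thesis
  proof (cases "x > 0")
    case True
    have F: "exp_integral_cdf P Y t x = measure (distr P borel (W.W t)) {..ln x}"
      unfolding cdf using True by (subst measure_distr) (auto intro!: arg_cong[where f="measure P"] simp: ln_ge_iff)
    have B: "of_bool (exp z \<le> x) = (indicator {..ln x} z :: real)" for z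
      using True by (simp add: indicator_def ln_ge_iff)
    show ?thesis
      using AE_log_avg_indicator[OF t, of "ln x"] X_pos' AE_space
      by eventually_elim (simp only: log_avg_eq F B)
  next
    case False
    then have no: "\<not> exp z \<le> x" for z :: real using exp_gt_zero[of z] by linarith
    have F: "exp_integral_cdf P Y t x = 0" by (simp add: cdf no)
    show ?thesis
      using X_pos' AE_space
      by eventually_elim (simp only: log_avg_eq no F, simp add: log_avg_def)
  qed
qed

end

theorem theorem2:
  fixes M :: "'a measure" and X :: "nat \<Rightarrow> 'a \<Rightarrow> real"
    and P :: "'b measure" and Y :: "real \<Rightarrow> 'b \<Rightarrow> real"
    and L :: "real measure" and \<alpha> \<mu> :: real and a :: "nat \<Rightarrow> real"
  assumes "1 < \<alpha>" and "\<alpha> \<le> 2"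
    and "stable_law \<alpha> L"
    and "prob_space M"
    and "iid M X"
    and "\<And>n. n \<ge> 1 \<Longrightarrow> AE \<omega> in M. X n \<omega> > 0"
    and "integrable M (X 1)" and "integral\<^sup>L M (X 1) = \<mu>"
    and "in_domain_of_attraction M X L"
    and "\<And>n. n \<ge> 1 \<Longrightarrow> a n > 0"
    and "weak_conv_m (\<lambda>n. distr M borel (\<lambda>\<omega>. (partial_sum X n \<omega> - \<mu> * real n) / a n)) L"
    and "levy_process P Y" and "distr P borel (Y 1) = L"
  shows "\<forall>t\<in>{0..1}. \<forall>x. AE \<omega> in M.
    (\<lambda>N. 1 / clog (real N) *
        (\<Sum>n=1..N. 1 / real n * indicator {\<omega> \<in> space M. sum_product X \<mu> a n t \<omega> \<le> x} \<omega>))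
      \<longlonglongrightarrow> exp_integral_cdf P Y t x"
proof -
  interpret M: prob_space M by fact
  interpret P: prob_space P using assms by (simp add: levy_process_def)
  interpret attracted_sums_with_process M X a L \<alpha> \<mu> P Y
    by unfold_locales (fact assms)+
  show ?thesis using AE_sum_product_cdf by simp
qed

end
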